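(* Let $(\Lambda,\sigma)$ be a subshift presented by a symbolic matrix system $(\mathcal M,I)$. Let $\phi$ be a forward automorphism of $(\Lambda,\sigma)$ defined by a properly strong shift equivalence in $N$-step $$(\mathcal P^{(j)},\mathcal Q^{(j)},X^{(j)},Y^{(j)}):(\mathcal M^{(j-1)},I^{(j-1)})\underset{1-pr}{\approx}(\mathcal M^{(j)},I^{(j)}),\qquad j=1,\dots,N,$$ with $(\mathcal M^{(0)},I^{(0)})=(\mathcal M^{(N)},I^{(N)})=(\mathcal M,I)$. If $\phi$ is expansive with $\frac1k$ as its expansive constant for some $k\in\mathbb N$, then the dynamical system $(\Lambda,\phi)$ is topologically conjugate to the subshift presented by the $2k$-higher block of the symbolic matrix system $(\mathcal P^{[N]},I^{[N]})$ relative to the LR textile $\lambda$-graph system $\mathcal T$ defined by the specified equivalence $$\mathcal M^{[N]}_{l,l+1}\mathcal P^{[N]}_{l+1,l+2}\overset{\kappa_{\mathcal P}}{\simeq}\mathcal P^{[N]}_{l,l+1}\mathcal M^{[N]}_{l+1,l+2},\qquad l\in\mathbb Z_+,$$ where $$\mathcal P^{[N]}_{l,l+1}=\mathcal P^{(1)}_{2Nl}Y^{(1)}_{2Nl+1}\mathcal P^{(2)}_{2Nl+2}Y^{(2)}_{2Nl+3}\cdots\mathcal P^{(N)}_{2Nl+2N-2}Y^{(N)}_{2Nl+2N-1},$$ $$I^{[N]}_{l,l+1}=I_{Nl,Nl+1}I_{Nl+1,Nl+2}\cdots I_{N(l+1)-1,N(l+1)},\qquad \mathcal M^{[N]}_{l,l+1}=\mathcal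 M_{Nl,Nl+1}I_{Nl+1,Nl+2}\cdots I_{N(l+1)-1,N(l+1)}$$ (with $\mathcal M^{[1]}=\mathcal M$, $I^{[1]}=I$).
   Context: Subshifts. $\mathbb Z_+=\{0,1,2,\dots\}$, $\mathbb N=\{1,2,\dots\}$. For a finite alphabet $\Sigma$, $\sigma$ is the left shift on $\Sigma^{\mathbb Z}$; a subshift is a closed shift-invariant subset; an automorphism is a homeomorphism commuting with $\sigma$. $(X,f)$ and $(Y,g)$ are topologically conjugate if $hf=gh$ for some homeomorphism $h:X\to Y$. $\Lambda$ carries the metric $\delta(\alpha,\alpha')=0$ if $\alpha=\alpha'$ and $\delta(\alpha,\alpha')=\frac1{r+1}$ otherwise, $r=\min\{|i|:\alpha_i\ne\alpha'_i\}$. A constant $c>0$ is an expansive constant of a homeomorphism $f$ if for all $x\ne y$ there is $i\in\mathbb Z$ with $\delta(f^ix,f^iy)\ge c$ (so $\sigma$ has expansive constant $1$). Symbolic matrices. A symbolic matrix over $\Sigma$ is a finite matrix whose entries are finite formal sums (possibly $0$) of elements of $\Sigma$; products are formed formally by concatenation, and $0$-$1$ matrices multiply in the obvious way. For a bijection $\kappa$ (a specification) from a subset of $\Sigma$ onto a subset of $\Sigma'$, $\mathcal A\overset{\kappa}{\simeq}\mathcal A'$ means that $\mathcal A'$ is obtained from $\mathcal A$ by replacing every symbol $a$ in its components by $\kappa(a)$. Symbolic matrix systems. A symbolic matrix system $(\mathcal M,I)$ over $\Sigma$ consists of $m(l)\times m(l+1)$ matrices $\mathcal M_{l,l+1}$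 (symbolic over $\Sigma$) and $I_{l,l+1}$ (entries in $\{0,1\}$), $l\in\mathbb Z_+$, with $I_{l,l+1}\mathcal M_{l+1,l+2}=\mathcal M_{l,l+1}I_{l+1,l+2}$, each row of $I_{l,l+1}$ having at least one $1$ and each column exactly one $1$. It is identified with the $\lambda$-graph system $\mathfrak L^{\mathcal M}$ having vertex sets $V^{\mathcal M}_l=\{v^l_1,\dots,v^l_{m(l)}\}$, an edge in $E^{\mathcal M}_{l,l+1}$ from $v^l_i$ to $v^{l+1}_j$ labeled $\alpha$ for every occurrence of $\alpha$ in $\mathcal M_{l,l+1}(i,j)$, and surjections $\iota:V_{l+1}\to V_l$ with $\iota(v^{l+1}_j)=v^l_i$ iff $I_{l,l+1}(i,j)=1$. Source, terminal, label maps are $s,t,\lambda$ (with superscript). Standing assumptions: every vertex emits an edge and every vertex in $V_l$, $l\ge1$, receives one; no two distinct edges have the same source, terminal and label; distinct edges with the same label have distinct terminals (left-resolving). For $l\ge1$, $\varphi_l^{\mathcal M}:E_{l,l+1}\to E_{l-1,l}$ sends $e$ to the unique edge with source $\iota(s(e))$, terminal $\iota(t(e))$ and label $\lambda(e)$. The presented subshift $\Lambda_{\mathcal M}$ consists of the bi-infinite sequences all of whose finite subwords are label words of finite paths (consecutive edges in $E_{l,l+1},E_{l+1,l+2},\dots$, starting at any level $l$). Proper strong shift equivalence. $(\mathcal P,\mathcal Q,X,Y):(\mathcal M,I)\underset{1-pr}{\approx}(\mathcal M',I')$ (over $\Sigma,\Sigma'$) means: there are alphabets $C,D$, specifications $\kappa:\Sigma\to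 CD$, $\kappa':\Sigma'\to DC$, increasing (not necessarily strictly) sequences $n(l),n'(l)$, and for each $l\in\mathbb Z_+$ an $n(l)\times n'(l+1)$ matrix $\mathcal P_l$ over $C$, an $n'(l)\times n(l+1)$ matrix $\mathcal Q_l$ over $D$, an $n(l)\times n(l+1)$ $0$-$1$ matrix $X_l$, an $n'(l)\times n'(l+1)$ $0$-$1$ matrix $Y_l$ with $$\mathcal M_{l,l+1}\overset{\kappa}{\simeq}\mathcal P_{2l}\mathcal Q_{2l+1},\quad \mathcal M'_{l,l+1}\overset{\kappa'}{\simeq}\mathcal Q_{2l}\mathcal P_{2l+1},\quad I_{l,l+1}=X_{2l}X_{2l+1},\quad I'_{l,l+1}=Y_{2l}Y_{2l+1},$$ $$X_l\mathcal P_{l+1}=\mathcal P_lY_{l+1},\qquad Y_l\mathcal Q_{l+1}=\mathcal Q_lX_{l+1}.$$ An $N$-step equivalence is a chain of $N$ such; the data of the $j$-th step are $C^{(j)},D^{(j)}$, $\kappa_0^{(j)}:\Sigma^{(j-1)}\to C^{(j)}D^{(j)}$, $\kappa_1^{(j)}:\Sigma^{(j)}\to D^{(j)}C^{(j)}$, $\mathcal P^{(j)}_l,\mathcal Q^{(j)}_l,X^{(j)}_l,Y^{(j)}_l$, with $\Sigma^{(j)}$ the alphabet of $(\mathcal M^{(j)},I^{(j)})$, $\Sigma^{(0)}=\Sigma^{(N)}=\Sigma$. With $\zeta_+^{(j)}((c_id_i)_i)=(d_ic_{i+1})_i$ and specifications acting symbolwise, the forward automorphism defined by the chain is $\phi=\big((\kappa_1^{(N)})^{-1}\zeta_+^{(N)}\kappa_0^{(N)}\big)\circ\cdots\circ\big((\kappa_1^{(1)})^{-1}\zeta_+^{(1)}\kappa_0^{(1)}\big)$.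 The specification $\kappa_{\mathcal P}$, from $\Sigma C^{(1)}\cdots C^{(N)}$ to $C^{(1)}\cdots C^{(N)}\Sigma$: for a word $a_0c_1\cdots c_N$, put successively $\kappa_0^{(j)}(a_{j-1})=c'_jd_j$ and $a_j=(\kappa_1^{(j)})^{-1}(d_jc_j)\in\Sigma^{(j)}$, $j=1,\dots,N$; then $\kappa_{\mathcal P}(a_0c_1\cdots c_N)=c'_1\cdots c'_Na_N$. The pairs $(\mathcal M^{[N]},I^{[N]})$ and $(\mathcal P^{[N]},I^{[N]})$ are symbolic matrix systems over $\Sigma$ and $C^{(1)}\cdots C^{(N)}$ with the same vertex sets and the same $I$-matrices. LR textile $\lambda$-graph systems. Let $(\mathcal A,I)$ and $(\mathcal B,I)$ be symbolic matrix systems with common vertex sets and common matrices $I_{l,l+1}$, and $\mathcal A_{l,l+1}\mathcal B_{l+1,l+2}\overset{\kappa}{\simeq}\mathcal B_{l,l+1}\mathcal A_{l+1,l+2}$ for all $l$. The associated LR textile $\lambda$-graph system $\mathcal T$ has the $\lambda$-graph system $\mathfrak L^{\mathcal K}$ with $V^{\mathcal K}_l=E^{\mathcal B}_{l,l+1}$, $\iota^{\mathcal K}=\varphi^{\mathcal B}_{l+1}:E^{\mathcal B}_{l+1,l+2}\to E^{\mathcal B}_{l,l+1}$, and $E^{\mathcal K}_{l,l+1}$ the set of squares $(f',f,e,e')\in E^{\mathcal B}_{l,l+1}\times E^{\mathcal B}_{l+1,l+2}\times E^{\mathcal A}_{l,l+1}\times E^{\mathcal A}_{l+1,l+2}$ with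 $s(e)=s(f')$, $t(e)=s(f)$, $t(f')=s(e')$, $t(e')=t(f)$ and $\kappa(\lambda(e)\lambda(f))=\lambda(f')\lambda(e')$; the source, terminal and label of $(f',f,e,e')$ are $f'$, $f$ and $(\lambda(f'),\lambda(f),\lambda(e),\lambda(e'))$; put $p(f',f,e,e')=e$ and $q(f',f,e,e')=e'$. Here $\mathcal A=\mathcal M^{[N]}$, $\mathcal B=\mathcal P^{[N]}$. Relative higher block. For $n\ge2$ the $n$-higher block of $(\mathcal B,I)$ relative to $\mathcal T$ is the $\lambda$-graph system (equivalently symbolic matrix system) whose vertices at level $l$ are the paths $(e_1,\dots,e_{n-1})$ in $\mathfrak L^{\mathcal A}$ starting at level $l$ ($e_i\in E^{\mathcal A}_{l+i-1,l+i}$), whose edges from level $l$ to $l+1$ are the paths $(g_1,\dots,g_{n-1})$ in $\mathfrak L^{\mathcal K}$ with $g_i\in E^{\mathcal K}_{l+i-1,l+i}$, with source $(p(g_1),\dots,p(g_{n-1}))$, terminal $(q(g_1),\dots,q(g_{n-1}))$ and label $(\lambda^{\mathcal K}(g_1),\dots,\lambda^{\mathcal K}(g_{n-1}))$, and whose map $\iota$ applies the maps $\varphi^{\mathcal A}$ edgewise. *)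

theory Defs
  imports
    "HOL-Analysis.Function_Topology"
    "HOL-Library.Monad_Syntax"
    "Jordan_Normal_Form.Matrix"
begin

section \<open>Symbolic matrices\<close>

text \<open>A finite formal sum of symbols is a finite multiset, so a symbolic matrix is a matrix of
  multisets. In a formal product the two-letter word \<open>ab\<close> is the pair \<open>(a, b)\<close>, which allows
  the two factors to have different alphabets; longer words are lists.\<close>

type_synonym 'a smat = "'a multiset mat"

definition symbols :: "'a smat \<Rightarrow> 'a set" where
  "symbols A = (\<Union>x\<in>elements_mat A. set_mset x)"

definition zero_one :: "nat mat \<Rightarrow> bool" where
  "zero_one X \<longleftrightarrow> elements_mat X \<subseteq> {0, 1}"

definition smat_mult :: "'a smat \<Rightarrow> 'b smat \<Rightarrow> ('a \<times> 'b) smat" (infixl "\<odot>" 70) where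
  "A \<odot> B = mat (dim_row A) (dim_col B)
     (\<lambda>(i, j). \<Sum>k<dim_col A. \<Sum>a\<in>#A $$ (i, k). image_mset (Pair a) (B $$ (k, j)))"

definition nat_smat_mult :: "nat mat \<Rightarrow> 'a smat \<Rightarrow> 'a smat" (infixr "\<odot>\<^sub>l" 70) where
  "X \<odot>\<^sub>l A = mat (dim_row X) (dim_col A)
     (\<lambda>(i, j). \<Sum>k<dim_col X. repeat_mset (X $$ (i, k)) (A $$ (k, j)))"

definition smat_nat_mult :: "'a smat \<Rightarrow> nat mat \<Rightarrow> 'a smat" (infixl "\<odot>\<^sub>r" 70) where
  "A \<odot>\<^sub>r X = mat (dim_row A) (dim_col X)
     (\<lambda>(i, j). \<Sum>k<dim_col A. repeat_mset (X $$ (k, j)) (A $$ (i, k)))"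

text \<open>The formal product of a nonempty list of symbolic matrices; the entries of a product of
  \<open>N\<close> factors are formal sums of words of length \<open>N\<close>.\<close>

fun word_prod :: "'a smat list \<Rightarrow> 'a list smat" where
  "word_prod [A] = map_mat (image_mset (\<lambda>a. [a])) A"
| "word_prod (A # B # As) = map_mat (image_mset (\<lambda>(a, w). a # w)) (A \<odot> word_prod (B # As))"

text \<open>A specification is a bijection from a subset of \<open>A\<close> onto a subset of \<open>B\<close>,
  here an injective partial map.\<close>

definition specification_map :: "'a set \<Rightarrow> 'b set \<Rightarrow> ('a \<rightharpoonup> 'b) \<Rightarrow> bool" where
  "specification_map A B \<kappa> \<longleftrightarrow> dom \<kappa> \<subseteq> A \<and> ran \<kappa> \<subseteq> B \<and> inj_on \<kappa> (dom \<kappa>)"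

definition spec_inv :: "('a \<rightharpoonup> 'b) \<Rightarrow> ('b \<rightharpoonup> 'a)" where
  "spec_inv \<kappa> b = (if b \<in> ran \<kappa> then Some (THE a. \<kappa> a = Some b) else None)"

definition smat_equiv :: "('a \<rightharpoonup> 'b) \<Rightarrow> 'a smat \<Rightarrow> 'b smat \<Rightarrow> bool" where
  "smat_equiv \<kappa> A A' \<longleftrightarrow> symbols A \<subseteq> dom \<kappa> \<and> A' = map_mat (image_mset (\<lambda>a. the (\<kappa> a))) A"


section \<open>Symbolic matrix systems and \<open>\<lambda>\<close>-graph systems\<close>

text \<open>\<open>M l\<close> and \<open>I l\<close> stand for the matrices with index \<open>l, l+1\<close>. The last four conjuncts
  are the standing assumptions: every vertex emits an edge, every vertex of level at least \<open>1\<close>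
  receives one, an edge is determined by source, terminal and label, and the system is
  left-resolving.\<close>

definition symbolic_matrix_system ::
  "'a set \<Rightarrow> (nat \<Rightarrow> 'a smat) \<Rightarrow> (nat \<Rightarrow> nat mat) \<Rightarrow> bool" where
  "symbolic_matrix_system S M I \<longleftrightarrow> finite S \<and> (\<exists>m :: nat \<Rightarrow> nat. \<forall>l.
     M l \<in> carrier_mat (m l) (m (l + 1)) \<and> symbols (M l) \<subseteq> S \<and>
     I l \<in> carrier_mat (m l) (m (l + 1)) \<and> zero_one (I l) \<and>
     (\<forall>i<m l. \<exists>j<m (l + 1). I l $$ (i, j) = 1) \<and>
     (\<forall>j<m (l + 1). \<exists>!i. i < m l \<and> I l $$ (i, j) = 1) \<and>
     I l \<odot>\<^sub>l M (l + 1) = M l \<odot>\<^sub>r I (l + 1) \<and>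
     (\<forall>i<m l. \<exists>j<m (l + 1). M l $$ (i, j) \<noteq> {#}) \<and>
     (\<forall>j<m (l + 1). \<exists>i<m l. M l $$ (i, j) \<noteq> {#}) \<and>
     (\<forall>i<m l. \<forall>j<m (l + 1). \<forall>a. count (M l $$ (i, j)) a \<le> 1) \<and>
     (\<forall>i<m l. \<forall>i'<m l. \<forall>j<m (l + 1). \<forall>a.
        a \<in># M l $$ (i, j) \<and> a \<in># M l $$ (i', j) \<longrightarrow> i = i'))"

text \<open>\<open>edges G l\<close> is \<open>E\<^bsub>l,l+1\<^esub>\<close>, and \<open>iota G l\<close> maps \<open>verts G (l + 1)\<close> to \<open>verts G l\<close>.
  The same element may serve as a vertex (or an edge) of several levels; levels are always
  tracked explicitly.\<close>

record ('v, 'e, 'a) lgraph =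
  verts :: "nat \<Rightarrow> 'v set"
  edges :: "nat \<Rightarrow> 'e set"
  src :: "'e \<Rightarrow> 'v"
  tgt :: "'e \<Rightarrow> 'v"
  lab :: "'e \<Rightarrow> 'a"
  iota :: "nat \<Rightarrow> 'v \<Rightarrow> 'v"

text \<open>Since the entries of a symbolic matrix system have no multiplicities, the edge for an
  occurrence of \<open>a\<close> in the entry \<open>(i, j)\<close> can be taken to be the triple \<open>(i, a, j)\<close>.\<close>

definition lambda_graph ::
  "(nat \<Rightarrow> 'a smat) \<Rightarrow> (nat \<Rightarrow> nat mat) \<Rightarrow> (nat, nat \<times> 'a \<times> nat, 'a) lgraph" where
  "lambda_graph M I = \<lparr>
     verts = (\<lambda>l. {..<dim_row (I l)}),
     edges = (\<lambda>l. {(i, a, j). i < dim_row (M l) \<and> j < dim_col (M l) \<and> a \<in># M l $$ (i, j)}),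
     src = (\<lambda>(i, a, j). i),
     tgt = (\<lambda>(i, a, j). j),
     lab = (\<lambda>(i, a, j). a),
     iota = (\<lambda>l j. THE i. i < dim_row (I l) \<and> I l $$ (i, j) = 1)\<rparr>"

text \<open>The map \<open>\<phi>\<^sub>l : E\<^bsub>l,l+1\<^esub> \<rightarrow> E\<^bsub>l-1,l\<^esub>\<close>, for \<open>l \<ge> 1\<close>.\<close>

definition edge_iota :: "('v, 'e, 'a, 'z) lgraph_scheme \<Rightarrow> nat \<Rightarrow> 'e \<Rightarrow> 'e" where
  "edge_iota G l e = (THE e'. e' \<in> edges G (l - 1) \<and> src G e' = iota G (l - 1) (src G e) \<and>
     tgt G e' = iota G l (tgt G e) \<and> lab G e' = lab G e)"

definition is_path :: "('v, 'e, 'a, 'z) lgraph_scheme \<Rightarrow> nat \<Rightarrow> 'e list \<Rightarrow> bool" where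
  "is_path G l es \<longleftrightarrow> (\<forall>i<length es. es ! i \<in> edges G (l + i)) \<and>
     (\<forall>i. i + 1 < length es \<longrightarrow> tgt G (es ! i) = src G (es ! (i + 1)))"


section \<open>Subshifts and dynamical systems\<close>

definition shift_map :: "(int \<Rightarrow> 'a) \<Rightarrow> (int \<Rightarrow> 'a)" where
  "shift_map x = (\<lambda>i. x (i + 1))"

definition presented_subshift :: "('v, 'e, 'a, 'z) lgraph_scheme \<Rightarrow> (int \<Rightarrow> 'a) set" where
  "presented_subshift G = {x. \<forall>(i :: int) (n :: nat). \<exists>l es.
     is_path G l es \<and> map (lab G) es = map (\<lambda>j. x (i + int j)) [0..<n]}"

definition seq_topology :: "(int \<Rightarrow> 'a) set \<Rightarrow> (int \<Rightarrow> 'a) topology" where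
  "seq_topology L = subtopology (product_topology (\<lambda>_. discrete_topology UNIV) UNIV) L"

definition topologically_conjugate ::
  "'a topology \<Rightarrow> ('a \<Rightarrow> 'a) \<Rightarrow> 'b topology \<Rightarrow> ('b \<Rightarrow> 'b) \<Rightarrow> bool" where
  "topologically_conjugate X f Y g \<longleftrightarrow>
     (\<exists>h. homeomorphic_map X Y h \<and> (\<forall>x\<in>topspace X. h (f x) = g (h x)))"

definition seq_dist :: "(int \<Rightarrow> 'a) \<Rightarrow> (int \<Rightarrow> 'a) \<Rightarrow> real" where
  "seq_dist x y = (if x = y then 0
     else 1 / (real (LEAST r. \<exists>i. x i \<noteq> y i \<and> r = nat \<bar>i\<bar>) + 1))"

definition int_iterate :: "'a set \<Rightarrow> ('a \<Rightarrow> 'a) \<Rightarrow> int \<Rightarrow> 'a \<Rightarrow> 'a" where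
  "int_iterate X f i = (if 0 \<le> i then f ^^ nat i else inv_into X f ^^ nat (- i))"

definition expansive_constant ::
  "(int \<Rightarrow> 'a) set \<Rightarrow> ((int \<Rightarrow> 'a) \<Rightarrow> (int \<Rightarrow> 'a)) \<Rightarrow> real \<Rightarrow> bool" where
  "expansive_constant L f c \<longleftrightarrow> c > 0 \<and>
     (\<forall>x\<in>L. \<forall>y\<in>L. x \<noteq> y \<longrightarrow> (\<exists>i. seq_dist (int_iterate L f i x) (int_iterate L f i y) \<ge> c))"


section \<open>Proper strong shift equivalence\<close>

definition proper_sse_1 ::
  "'a set \<Rightarrow> (nat \<Rightarrow> 'a smat) \<Rightarrow> (nat \<Rightarrow> nat mat) \<Rightarrow>
   'b set \<Rightarrow> (nat \<Rightarrow> 'b smat) \<Rightarrow> (nat \<Rightarrow> nat mat) \<Rightarrow>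
   'c set \<Rightarrow> 'd set \<Rightarrow> ('a \<rightharpoonup> 'c \<times> 'd) \<Rightarrow> ('b \<rightharpoonup> 'd \<times> 'c) \<Rightarrow>
   (nat \<Rightarrow> 'c smat) \<Rightarrow> (nat \<Rightarrow> 'd smat) \<Rightarrow> (nat \<Rightarrow> nat mat) \<Rightarrow> (nat \<Rightarrow> nat mat) \<Rightarrow> bool" where
  "proper_sse_1 S M I S' M' I' C D \<kappa> \<kappa>' P Q X Y \<longleftrightarrow>
     finite C \<and> finite D \<and>
     specification_map S (C \<times> D) \<kappa> \<and> specification_map S' (D \<times> C) \<kappa>' \<and>
     (\<exists>n n' :: nat \<Rightarrow> nat. mono n \<and> mono n' \<and> (\<forall>l.
        P l \<in> carrier_mat (n l) (n' (l + 1)) \<and> symbols (P l) \<subseteq> C \<and>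
        Q l \<in> carrier_mat (n' l) (n (l + 1)) \<and> symbols (Q l) \<subseteq> D \<and>
        X l \<in> carrier_mat (n l) (n (l + 1)) \<and> zero_one (X l) \<and>
        Y l \<in> carrier_mat (n' l) (n' (l + 1)) \<and> zero_one (Y l))) \<and>
     (\<forall>l. smat_equiv \<kappa> (M l) (P (2 * l) \<odot> Q (2 * l + 1)) \<and>
          smat_equiv \<kappa>' (M' l) (Q (2 * l) \<odot> P (2 * l + 1)) \<and>
          I l = X (2 * l) * X (2 * l + 1) \<and>
          I' l = Y (2 * l) * Y (2 * l + 1) \<and>
          X l \<odot>\<^sub>l P (l + 1) = P l \<odot>\<^sub>r Y (l + 1) \<and>
          Y l \<odot>\<^sub>l Q (l + 1) = Q l \<odot>\<^sub>r X (l + 1))"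

text \<open>The first argument of every family is the index of the step (\<open>j = 1, \<dots>, N\<close>), respectively
  of the symbolic matrix system (\<open>j = 0, \<dots>, N\<close>), in the chain.\<close>

definition proper_sse_chain ::
  "nat \<Rightarrow> (nat \<Rightarrow> 'a set) \<Rightarrow> (nat \<Rightarrow> nat \<Rightarrow> 'a smat) \<Rightarrow> (nat \<Rightarrow> nat \<Rightarrow> nat mat) \<Rightarrow>
   (nat \<Rightarrow> 'c set) \<Rightarrow> (nat \<Rightarrow> 'd set) \<Rightarrow>
   (nat \<Rightarrow> 'a \<rightharpoonup> 'c \<times> 'd) \<Rightarrow> (nat \<Rightarrow> 'a \<rightharpoonup> 'd \<times> 'c) \<Rightarrow>
   (nat \<Rightarrow> nat \<Rightarrow> 'c smat) \<Rightarrow> (nat \<Rightarrow> nat \<Rightarrow> 'd smat) \<Rightarrow>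
   (nat \<Rightarrow> nat \<Rightarrow> nat mat) \<Rightarrow> (nat \<Rightarrow> nat \<Rightarrow> nat mat) \<Rightarrow> bool" where
  "proper_sse_chain N S M I C D \<kappa>\<^sub>0 \<kappa>\<^sub>1 P Q X Y \<longleftrightarrow>
     (\<forall>j\<le>N. symbolic_matrix_system (S j) (M j) (I j)) \<and>
     (\<forall>j\<in>{1..N}. proper_sse_1 (S (j - 1)) (M (j - 1)) (I (j - 1)) (S j) (M j) (I j)
        (C j) (D j) (\<kappa>\<^sub>0 j) (\<kappa>\<^sub>1 j) (P j) (Q j) (X j) (Y j))"

text \<open>On sequences with a symbol outside the domain of a specification the following maps take
  unspecified values; this does not concern the sequences of the presented subshifts.\<close>

definition spec_act :: "('a \<rightharpoonup> 'b) \<Rightarrow> (int \<Rightarrow> 'a) \<Rightarrow> (int \<Rightarrow> 'b)" where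
  "spec_act \<kappa> x = (\<lambda>i. the (\<kappa> (x i)))"

definition zeta_plus :: "(int \<Rightarrow> 'c \<times> 'd) \<Rightarrow> (int \<Rightarrow> 'd \<times> 'c)" where
  "zeta_plus x = (\<lambda>i. (snd (x i), fst (x (i + 1))))"

primrec forward_automorphism ::
  "nat \<Rightarrow> (nat \<Rightarrow> 'a \<rightharpoonup> 'c \<times> 'd) \<Rightarrow> (nat \<Rightarrow> 'a \<rightharpoonup> 'd \<times> 'c) \<Rightarrow> (int \<Rightarrow> 'a) \<Rightarrow> (int \<Rightarrow> 'a)" where
  "forward_automorphism 0 \<kappa>\<^sub>0 \<kappa>\<^sub>1 = id"
| "forward_automorphism (Suc j) \<kappa>\<^sub>0 \<kappa>\<^sub>1 =
     (spec_act (spec_inv (\<kappa>\<^sub>1 (Suc j))) \<circ> zeta_plus \<circ> spec_act (\<kappa>\<^sub>0 (Suc j)))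
     \<circ> forward_automorphism j \<kappa>\<^sub>0 \<kappa>\<^sub>1"


section \<open>The systems attached to a chain and the specification between them\<close>

definition I_pow :: "nat \<Rightarrow> (nat \<Rightarrow> nat mat) \<Rightarrow> nat \<Rightarrow> nat mat" where
  "I_pow N I l = foldl (*) (I (N * l)) (map I [N * l + 1..<N * (l + 1)])"

definition M_pow :: "nat \<Rightarrow> (nat \<Rightarrow> 'a smat) \<Rightarrow> (nat \<Rightarrow> nat mat) \<Rightarrow> nat \<Rightarrow> 'a smat" where
  "M_pow N M I l = foldl (\<odot>\<^sub>r) (M (N * l)) (map I [N * l + 1..<N * (l + 1)])"

definition P_pow ::
  "nat \<Rightarrow> (nat \<Rightarrow> nat \<Rightarrow> 'c smat) \<Rightarrow> (nat \<Rightarrow> nat \<Rightarrow> nat mat) \<Rightarrow> nat \<Rightarrow> 'c list smat" where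
  "P_pow N P Y l = word_prod
     (map (\<lambda>j. P j (2 * N * l + 2 * j - 2) \<odot>\<^sub>r Y j (2 * N * l + 2 * j - 1)) [1..<N + 1])"

text \<open>\<open>kappa_P_list\<close> treats the steps of the list in order; the argument \<open>(a, c\<^sub>1 \<dots> c\<^sub>N)\<close> is
  the word \<open>a c\<^sub>1 \<dots> c\<^sub>N\<close>, and the result is undefined as soon as one of the required values
  of a specification or of an inverse specification is.\<close>

fun kappa_P_list ::
  "(('a \<rightharpoonup> 'c \<times> 'd) \<times> ('a \<rightharpoonup> 'd \<times> 'c)) list \<Rightarrow> 'a \<times> 'c list \<rightharpoonup> 'c list \<times> 'a" where
  "kappa_P_list [] (a, []) = Some ([], a)"
| "kappa_P_list ((\<kappa>\<^sub>0, \<kappa>\<^sub>1) # \<kappa>s) (a, c # cs) = do {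
     (c', d) \<leftarrow> \<kappa>\<^sub>0 a;
     a' \<leftarrow> spec_inv \<kappa>\<^sub>1 (d, c);
     (cs', b) \<leftarrow> kappa_P_list \<kappa>s (a', cs);
     Some (c' # cs', b)
   }"
| "kappa_P_list _ _ = None"

definition kappa_P ::
  "nat \<Rightarrow> (nat \<Rightarrow> 'a \<rightharpoonup> 'c \<times> 'd) \<Rightarrow> (nat \<Rightarrow> 'a \<rightharpoonup> 'd \<times> 'c) \<Rightarrow>
   'a \<times> 'c list \<rightharpoonup> 'c list \<times> 'a" where
  "kappa_P N \<kappa>\<^sub>0 \<kappa>\<^sub>1 = kappa_P_list (map (\<lambda>j. (\<kappa>\<^sub>0 j, \<kappa>\<^sub>1 j)) [1..<N + 1])"


section \<open>LR textile \<open>\<lambda>\<close>-graph systems\<close>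

definition specified_equivalence ::
  "'a set \<Rightarrow> 'b set \<Rightarrow> (nat \<Rightarrow> 'a smat) \<Rightarrow> (nat \<Rightarrow> 'b smat) \<Rightarrow> (nat \<Rightarrow> nat mat) \<Rightarrow>
   ('a \<times> 'b \<rightharpoonup> 'b \<times> 'a) \<Rightarrow> bool" where
  "specified_equivalence S T A B I \<kappa> \<longleftrightarrow>
     symbolic_matrix_system S A I \<and> symbolic_matrix_system T B I \<and>
     specification_map (S \<times> T) (T \<times> S) \<kappa> \<and>
     (\<forall>l. smat_equiv \<kappa> (A l \<odot> B (l + 1)) (B l \<odot> A (l + 1)))"

type_synonym ('e, 'f) square = "'f \<times> 'f \<times> 'e \<times> 'e"

definition textile_squares ::
  "('v, 'e, 'a) lgraph \<Rightarrow> ('v, 'f, 'b) lgraph \<Rightarrow> ('a \<times> 'b \<rightharpoonup> 'b \<times> 'a) \<Rightarrow>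
   nat \<Rightarrow> ('e, 'f) square set" where
  "textile_squares A B \<kappa> l = {(f', f, e, e').
     f' \<in> edges B l \<and> f \<in> edges B (l + 1) \<and> e \<in> edges A l \<and> e' \<in> edges A (l + 1) \<and>
     src A e = src B f' \<and> tgt A e = src B f \<and> tgt B f' = src A e' \<and> tgt A e' = tgt B f \<and>
     \<kappa> (lab A e, lab B f) = Some (lab B f', lab A e')}"

definition textile_K ::
  "('v, 'e, 'a) lgraph \<Rightarrow> ('v, 'f, 'b) lgraph \<Rightarrow> ('a \<times> 'b \<rightharpoonup> 'b \<times> 'a) \<Rightarrow>
   ('f, ('e, 'f) square, ('a, 'b) square) lgraph" where
  "textile_K A B \<kappa> = \<lparr>
     verts = edges B,
     edges = textile_squares A B \<kappa>,
     src = (\<lambda>(f', f, e, e'). f'),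
     tgt = (\<lambda>(f', f, e, e'). f),
     lab = (\<lambda>(f', f, e, e'). (lab B f', lab B f, lab A e, lab A e')),
     iota = (\<lambda>l. edge_iota B (l + 1))\<rparr>"

record ('v, 'e, 'f, 'a, 'b) textile =
  graph_A :: "('v, 'e, 'a) lgraph"
  graph_K :: "('f, ('e, 'f) square, ('a, 'b) square) lgraph"
  hom_p :: "('e, 'f) square \<Rightarrow> 'e"
  hom_q :: "('e, 'f) square \<Rightarrow> 'e"

definition lr_textile ::
  "('v, 'e, 'a) lgraph \<Rightarrow> ('v, 'f, 'b) lgraph \<Rightarrow> ('a \<times> 'b \<rightharpoonup> 'b \<times> 'a) \<Rightarrow>
   ('v, 'e, 'f, 'a, 'b) textile" where
  "lr_textile A B \<kappa> = \<lparr>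
     graph_A = A,
     graph_K = textile_K A B \<kappa>,
     hom_p = (\<lambda>(f', f, e, e'). e),
     hom_q = (\<lambda>(f', f, e, e'). e')\<rparr>"

definition relative_higher_block ::
  "nat \<Rightarrow> ('v, 'e, 'f, 'a, 'b) textile \<Rightarrow>
   ('e list, ('e, 'f) square list, ('a, 'b) square list) lgraph" where
  "relative_higher_block n T = \<lparr>
     verts = (\<lambda>l. {es. length es = n - 1 \<and> is_path (graph_A T) l es}),
     edges = (\<lambda>l. {gs. length gs = n - 1 \<and> is_path (graph_K T) l gs}),
     src = map (hom_p T),
     tgt = map (hom_q T),
     lab = map (lab (graph_K T)),
     iota = (\<lambda>l es. map2 (\<lambda>i e. edge_iota (graph_A T) (l + i) e) [1..<n] es)\<rparr>"

end

theory Submission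
  imports Defs "HOL-Analysis.T1_Spaces"
begin

text \<open>A symbolic matrix is handled through its letter relations: \<open>(i, j)\<close> is related by \<open>a\<close> when \<open>a\<close>
  occurs in the entry \<open>(i, j)\<close>. Formal products become compositions of relations, and since all
  entries are simple and columns left-resolving, a matrix is determined by these relations.

  One step of a proper equivalence gives matrices \<open>F l = P (2l) Y (2l+1)\<close> satisfying
  \<open>M l F (l+1) \<simeq> F l M' (l+1)\<close>, and composing \<open>N\<close> of them gives the specified equivalence.

  For the conjugacy consider the two-dimensional configurations over the two alphabets all of whose
  finite windows are realized by rectangular patches of squares of the textile system. Patches
  extend in all four directions (to the top and the left as long as the level allows it, and every
  finite word of the subshifts is realized at arbitrarily high levels), so by compactness every
  point of \<open>\<Lambda>\<close> is the row \<open>0\<close> of a configuration, and every point of the subshift of the \<open>2k\<close>-higher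
  block is its vertical strip of width \<open>2k-1\<close>. Consecutive rows are related by \<open>\<phi>\<close>, so a
  configuration is determined by its row \<open>0\<close>; by expansiveness it is also determined by the strip.
  Both maps are thus homeomorphisms from the compact space of configurations, and they carry the
  vertical shift to \<open>\<phi>\<close> and to \<open>\<sigma>\<close>.\<close>

section \<open>Symbolic matrices as families of relations\<close>

text \<open>Levels start at 0 and grow both downwards and to the right, so a new row above or a new
  column on the left lowers the starting level by one. This is why windows are cut out of longer
  words, whose surplus initial part only serves to reach a high level. A proper equivalence states
  neither left-resolving nor emission and reception conditions for \<open>P\<close>,
  \<open>Q\<close> or for the odd levels. All that is wanted of \<open>P (2l) Y (2l+1)\<close> must
  be forced by the two systems at the even levels, and multiplicities have to be counted there.
  Hence \<open>resolving\<close> and \<open>col_one\<close> are stated as column sums, a form that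
  survives products. Each of the \<open>N\<close> steps climbs one level, so a full turn of the
  chain climbs \<open>N\<close> levels of the same system; the lifts inside \<open>M_pow\<close>
  make an edge of \<open>M\<close> span the same distance. The width comes from the metric:
  \<open>1/(r+1) \<ge> 1/k\<close> means \<open>r < k\<close>, so a difference is detected in one of
  the \<open>2k-1\<close> columns \<open>1-k, ..., k-1\<close>, and \<open>2k\<close> is the block
  length whose edges consist of \<open>2k-1\<close> squares.\<close>

definition ent :: "'a smat \<Rightarrow> 'a \<Rightarrow> (nat \<times> nat) set" where
  "ent A a = {(i, j). i < dim_row A \<and> j < dim_col A \<and> a \<in># A $$ (i, j)}"

definition supp :: "nat mat \<Rightarrow> (nat \<times> nat) set" where
  "supp X = {(i, j). i < dim_row X \<and> j < dim_col X \<and> X $$ (i, j) \<noteq> 0}"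

text \<open>One bound per column and letter encodes both that entries have no multiplicities and
  that equally labelled edges into a vertex have one source; see
  \<open>resolving_iff\<close>.\<close>

definition resolving :: "'a smat \<Rightarrow> bool" where
  "resolving A \<longleftrightarrow> (\<forall>a. \<forall>j<dim_col A. (\<Sum>i<dim_row A. count (A $$ (i, j)) a) \<le> 1)"

text \<open>The 0-1 condition and the single 1 in each column, packed into one equation. Rows are
  left free, as a vertex may have several lifts.\<close>

definition col_one :: "nat mat \<Rightarrow> bool" where
  "col_one X \<longleftrightarrow> (\<forall>j<dim_col X. (\<Sum>i<dim_row X. X $$ (i, j)) = 1)"

section \<open>Multiplicities and letter relations of products\<close>

lemma count_image_Pair: "count (image_mset (Pair a) Y) (a', b) = (if a = a' then count Y b else 0)"
  by (induction Y) auto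

lemma count_Pair_product:
  "count (\<Sum>a\<in>#X. image_mset (Pair a) Y) (a', b) = count X a' * count Y b"
  by (induction X) (auto simp: count_image_Pair)

lemma smat_mult_dims [simp]:
  "dim_row (A \<odot> B) = dim_row A" "dim_col (A \<odot> B) = dim_col B"
  "dim_row (X \<odot>\<^sub>l A) = dim_row X" "dim_col (X \<odot>\<^sub>l A) = dim_col A"
  "dim_row (A \<odot>\<^sub>r X) = dim_row A" "dim_col (A \<odot>\<^sub>r X) = dim_col X"
  by (simp_all add: smat_mult_def nat_smat_mult_def smat_nat_mult_def)

lemma count_smat_mult:
  assumes "i < dim_row A" "j < dim_col B"
  shows "count ((A \<odot> B) $$ (i, j)) (a, b) =
    (\<Sum>k<dim_col A. count (A $$ (i, k)) a * count (B $$ (k, j)) b)"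
  using assms by (simp add: smat_mult_def count_sum count_Pair_product)

lemma count_nat_smat_mult:
  assumes "i < dim_row X" "j < dim_col A"
  shows "count ((X \<odot>\<^sub>l A) $$ (i, j)) a = (\<Sum>k<dim_col X. X $$ (i, k) * count (A $$ (k, j)) a)"
  using assms by (simp add: nat_smat_mult_def count_sum)

lemma count_smat_nat_mult:
  assumes "i < dim_row A" "j < dim_col X"
  shows "count ((A \<odot>\<^sub>r X) $$ (i, j)) a = (\<Sum>k<dim_col A. count (A $$ (i, k)) a * X $$ (k, j))"
  using assms by (simp add: smat_nat_mult_def count_sum mult.commute)

lemma index_nat_mult:
  assumes "i < dim_row X" "j < dim_col Y" "dim_col X = dim_row Y"
  shows "(X * Y) $$ (i, j) = (\<Sum>k<dim_col X. X $$ (i, k) * Y $$ (k, j) :: nat)"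
  using assms by (simp add: scalar_prod_def lessThan_atLeast0)

lemma in_ent_iff:
  "(i, j) \<in> ent A a \<longleftrightarrow> i < dim_row A \<and> j < dim_col A \<and> 0 < count (A $$ (i, j)) a"
  by (auto simp: ent_def)

lemma in_supp_iff:
  "(i, j) \<in> supp X \<longleftrightarrow> i < dim_row X \<and> j < dim_col X \<and> 0 < X $$ (i, j)"
  by (auto simp: supp_def)

text \<open>Naturals cannot cancel. This turns the sum over an intermediate index into the
  existential quantifier of a relational composition.\<close>

lemma sum_mult_neq_0:
  fixes f g :: "nat \<Rightarrow> nat"
  shows "0 < (\<Sum>k<n. f k * g k) \<longleftrightarrow> (\<exists>k<n. 0 < f k \<and> 0 < g k)"
  by (induction n) (auto simp: less_Suc_eq)

lemma ent_smat_mult: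
  assumes "dim_col A = dim_row B"
  shows "ent (A \<odot> B) (a, b) = ent A a O ent B b"
proof -
  have "(i, j) \<in> ent (A \<odot> B) (a, b) \<longleftrightarrow> (i, j) \<in> ent A a O ent B b" for i j
    unfolding relcomp_unfold mem_Collect_eq case_prod_conv in_ent_iff smat_mult_dims
    by (simp only: count_smat_mult sum_mult_neq_0 cong: conj_cong) (use assms in auto)
  then show ?thesis by auto
qed

lemma ent_nat_smat_mult:
  assumes "dim_col X = dim_row A"
  shows "ent (X \<odot>\<^sub>l A) a = supp X O ent A a"
proof -
  have "(i, j) \<in> ent (X \<odot>\<^sub>l A) a \<longleftrightarrow> (i, j) \<in> supp X O ent A a" for i j
    unfolding relcomp_unfold mem_Collect_eq case_prod_conv in_ent_iff in_supp_iff smat_mult_dims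
    by (simp only: count_nat_smat_mult sum_mult_neq_0 cong: conj_cong) (use assms in auto)
  then show ?thesis by auto
qed

lemma ent_smat_nat_mult:
  assumes "dim_col A = dim_row X"
  shows "ent (A \<odot>\<^sub>r X) a = ent A a O supp X"
proof -
  have "(i, j) \<in> ent (A \<odot>\<^sub>r X) a \<longleftrightarrow> (i, j) \<in> ent A a O supp X" for i j
    unfolding relcomp_unfold mem_Collect_eq case_prod_conv in_ent_iff in_supp_iff smat_mult_dims
    by (simp only: count_smat_nat_mult sum_mult_neq_0 cong: conj_cong) (use assms in auto)
  then show ?thesis by auto
qed

lemma supp_mult:
  assumes "dim_col X = dim_row Y"
  shows "supp (X * Y) = supp X O supp Y"
proof -
  have "(i, j) \<in> supp (X * Y) \<longleftrightarrow> (i, j) \<in> supp X O supp Y" for i j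
    unfolding relcomp_unfold mem_Collect_eq case_prod_conv in_supp_iff index_mult_mat(2,3)
    by (simp only: index_nat_mult[OF _ _ assms] sum_mult_neq_0 cong: conj_cong) (use assms in auto)
  then show ?thesis by auto
qed

section \<open>Column sums of products\<close>

lemma sum_product_col:
  fixes f g :: "nat \<Rightarrow> nat \<Rightarrow> nat"
  shows "(\<Sum>i<m. \<Sum>k<n. f i k * g k j) = (\<Sum>k<n. (\<Sum>i<m. f i k) * g k j)"
  by (subst sum.swap) (simp add: sum_distrib_right)

lemma sum_mult_le_one:
  fixes f g :: "nat \<Rightarrow> nat"
  assumes "\<And>k. k < n \<Longrightarrow> f k \<le> 1" "(\<Sum>k<n. g k) \<le> 1"
  shows "(\<Sum>k<n. f k * g k) \<le> 1"
proof -
  have "(\<Sum>k<n. f k * g k) \<le> (\<Sum>k<n. g k)"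
    by (rule sum_mono) (use assms(1) in force)
  then show ?thesis using assms(2) by linarith
qed

lemma resolving_smat_mult:
  assumes "resolving A" "resolving B" "dim_col A = dim_row B"
  shows "resolving (A \<odot> B)"
  unfolding resolving_def
proof (intro allI impI)
  fix ab :: "'a \<times> 'b" and j assume j: "j < dim_col (A \<odot> B)"
  obtain a b where ab: "ab = (a, b)" by (cases ab)
  have "(\<Sum>i<dim_row A. count ((A \<odot> B) $$ (i, j)) ab) =
      (\<Sum>k<dim_col A. (\<Sum>i<dim_row A. count (A $$ (i, k)) a) * count (B $$ (k, j)) b)"
    using j by (simp add: ab count_smat_mult) (rule sum_product_col)
  also have "\<dots> \<le> 1"
    using assms j by (intro sum_mult_le_one) (auto simp: resolving_def)
  finally show "(\<Sum>i<dim_row (A \<odot> B). count ((A \<odot> B) $$ (i, j)) ab) \<le> 1" by simp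
qed

lemma resolving_nat_smat_mult:
  assumes "col_one X" "resolving A" "dim_col X = dim_row A"
  shows "resolving (X \<odot>\<^sub>l A)"
  unfolding resolving_def
proof (intro allI impI)
  fix a j assume j: "j < dim_col (X \<odot>\<^sub>l A)"
  have "(\<Sum>i<dim_row X. count ((X \<odot>\<^sub>l A) $$ (i, j)) a) =
      (\<Sum>k<dim_col X. (\<Sum>i<dim_row X. X $$ (i, k)) * count (A $$ (k, j)) a)"
    using j by (simp add: count_nat_smat_mult) (rule sum_product_col)
  also have "\<dots> \<le> 1"
    using assms j by (intro sum_mult_le_one) (auto simp: resolving_def col_one_def)
  finally show "(\<Sum>i<dim_row (X \<odot>\<^sub>l A). count ((X \<odot>\<^sub>l A) $$ (i, j)) a) \<le> 1" by simp
qed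

lemma resolving_smat_nat_mult:
  assumes "resolving A" "col_one X" "dim_col A = dim_row X"
  shows "resolving (A \<odot>\<^sub>r X)"
  unfolding resolving_def
proof (intro allI impI)
  fix a j assume j: "j < dim_col (A \<odot>\<^sub>r X)"
  have "(\<Sum>i<dim_row A. count ((A \<odot>\<^sub>r X) $$ (i, j)) a) =
      (\<Sum>k<dim_col A. (\<Sum>i<dim_row A. count (A $$ (i, k)) a) * X $$ (k, j))"
    using j by (simp add: count_smat_nat_mult) (rule sum_product_col)
  also have "\<dots> \<le> 1"
    using assms j by (intro sum_mult_le_one) (auto simp: resolving_def col_one_def)
  finally show "(\<Sum>i<dim_row (A \<odot>\<^sub>r X). count ((A \<odot>\<^sub>r X) $$ (i, j)) a) \<le> 1" by simp
qed

lemma col_one_mult: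
  assumes "col_one X" "col_one Y" "dim_col X = dim_row Y"
  shows "col_one (X * Y)"
  unfolding col_one_def
proof (intro allI impI)
  fix j assume j: "j < dim_col (X * Y)"
  have "(\<Sum>i<dim_row X. (X * Y) $$ (i, j)) =
      (\<Sum>k<dim_col X. (\<Sum>i<dim_row X. X $$ (i, k)) * Y $$ (k, j))"
    using j assms(3) by (simp add: index_nat_mult del: index_mult_mat(1)) (rule sum_product_col)
  also have "\<dots> = (\<Sum>k<dim_col X. Y $$ (k, j))"
    using assms(1) by (simp add: col_one_def)
  also have "\<dots> = 1" using assms j by (simp add: col_one_def)
  finally show "(\<Sum>i<dim_row (X * Y). (X * Y) $$ (i, j)) = 1" by simp
qed

text \<open>Splits a column-sum bound into the two standing assumptions behind it: simple entries,
  and a unique row for each letter of a column.\<close>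

lemma sum_le_one_iff:
  fixes f :: "nat \<Rightarrow> nat"
  shows "(\<Sum>i<n. f i) \<le> 1 \<longleftrightarrow>
    (\<forall>i<n. f i \<le> 1) \<and> (\<forall>i<n. \<forall>i'<n. f i \<noteq> 0 \<and> f i' \<noteq> 0 \<longrightarrow> i = i')" (is "?l \<longleftrightarrow> ?r")
proof
  assume l: ?l
  have "f i \<le> 1" if "i < n" for i
    using member_le_sum[of i "{..<n}" f] that l by auto
  moreover have "i = i'" if "i < n" "i' < n" "f i \<noteq> 0 \<and> f i' \<noteq> 0" for i i'
  proof (rule ccontr)
    assume "i \<noteq> i'"
    then have "f i + f i' = (\<Sum>i\<in>{i, i'}. f i)" by simp
    also have "\<dots> \<le> (\<Sum>i<n. f i)" by (rule sum_mono2) (use that in auto)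
    finally show False using l that by linarith
  qed
  ultimately show ?r by blast
next
  assume r: ?r
  show ?l
  proof (cases "\<exists>i<n. f i \<noteq> 0")
    case True
    then obtain i where i: "i < n" "f i \<noteq> 0" by blast
    then have "(\<Sum>i<n. f i) = (\<Sum>i\<in>{i}. f i)"
      using r by (intro sum.mono_neutral_right) auto
    then show ?thesis using r i by simp
  qed simp
qed

lemma resolving_iff:
  "resolving A \<longleftrightarrow>
     (\<forall>i<dim_row A. \<forall>j<dim_col A. \<forall>a. count (A $$ (i, j)) a \<le> 1) \<and>
     (\<forall>i<dim_row A. \<forall>i'<dim_row A. \<forall>j<dim_col A. \<forall>a.
        a \<in># A $$ (i, j) \<and> a \<in># A $$ (i', j) \<longrightarrow> i = i')"
proof -
  have "resolving A \<longleftrightarrow> (\<forall>a. \<forall>j<dim_col A. (\<forall>i<dim_row A. count (A $$ (i, j)) a \<le> 1) \<and>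
    (\<forall>i<dim_row A. \<forall>i'<dim_row A. a \<in># A $$ (i, j) \<and> a \<in># A $$ (i', j) \<longrightarrow> i = i'))"
    unfolding resolving_def sum_le_one_iff by simp
  then show ?thesis by blast
qed

lemma col_one_iff:
  "col_one X \<longleftrightarrow> zero_one X \<and> (\<forall>j<dim_col X. \<exists>!i. i < dim_row X \<and> X $$ (i, j) = 1)"
proof -
  have e: "elements_mat X \<subseteq> {0, 1} \<longleftrightarrow> (\<forall>i<dim_row X. \<forall>j<dim_col X. X $$ (i, j) \<le> 1)"
    by (force simp: elements_mat_def le_Suc_eq)
  have s: "(\<Sum>i<dim_row X. X $$ (i, j)) = 1 \<longleftrightarrow>
      (\<forall>i<dim_row X. X $$ (i, j) \<le> 1) \<and> (\<exists>!i. i < dim_row X \<and> X $$ (i, j) = 1)" for j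
  proof -
    have "(\<Sum>i<dim_row X. X $$ (i, j)) = 1 \<longleftrightarrow>
        (\<Sum>i<dim_row X. X $$ (i, j)) \<le> 1 \<and> (\<Sum>i<dim_row X. X $$ (i, j)) \<noteq> 0" by linarith
    also have "\<dots> \<longleftrightarrow> (\<forall>i<dim_row X. X $$ (i, j) \<le> 1) \<and>
        (\<forall>i<dim_row X. \<forall>i'<dim_row X. X $$ (i, j) \<noteq> 0 \<and> X $$ (i', j) \<noteq> 0 \<longrightarrow> i = i') \<and>
        (\<exists>i<dim_row X. X $$ (i, j) \<noteq> 0)"
      unfolding sum_le_one_iff by (simp add: Bex_def)
    also have "\<dots> \<longleftrightarrow> (\<forall>i<dim_row X. X $$ (i, j) \<le> 1) \<and>
        (\<forall>i<dim_row X. \<forall>i'<dim_row X. X $$ (i, j) = 1 \<and> X $$ (i', j) = 1 \<longrightarrow> i = i') \<and>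
        (\<exists>i<dim_row X. X $$ (i, j) = 1)"
    proof (rule conj_cong[OF refl])
      assume le: "\<forall>i<dim_row X. X $$ (i, j) \<le> 1"
      then have "X $$ (i, j) \<noteq> 0 \<longleftrightarrow> X $$ (i, j) = 1" if "i < dim_row X" for i
        using that by (metis le_antisym less_one not_le zero_neq_one)
      then show "(\<forall>i<dim_row X. \<forall>i'<dim_row X. X $$ (i, j) \<noteq> 0 \<and> X $$ (i', j) \<noteq> 0 \<longrightarrow> i = i') \<and>
          (\<exists>i<dim_row X. X $$ (i, j) \<noteq> 0) \<longleftrightarrow>
        (\<forall>i<dim_row X. \<forall>i'<dim_row X. X $$ (i, j) = 1 \<and> X $$ (i', j) = 1 \<longrightarrow> i = i') \<and>
          (\<exists>i<dim_row X. X $$ (i, j) = 1)"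
        by (simp cong: conj_cong)
    qed
    finally show ?thesis by blast
  qed
  have "(\<forall>j<c. (\<forall>i<r. P i j) \<and> U j) \<longleftrightarrow> (\<forall>i<r. \<forall>j<c. P i j) \<and> (\<forall>j<c. U j)"
    for P :: "nat \<Rightarrow> nat \<Rightarrow> bool" and U c r by blast
  then show ?thesis unfolding col_one_def zero_one_def e s .
qed

lemma col_oneD:
  assumes "col_one X" "(i, j) \<in> supp X" "(i', j) \<in> supp X"
  shows "i = i'"
proof -
  have "(\<Sum>i<dim_row X. X $$ (i, j)) \<le> 1" using assms by (auto simp: col_one_def in_supp_iff)
  then show ?thesis using assms unfolding sum_le_one_iff by (auto simp: in_supp_iff)
qed

lemma col_one_ex:
  assumes "col_one X" "j < dim_col X"
  shows "\<exists>i. (i, j) \<in> supp X"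
proof -
  have "(\<Sum>i<dim_row X. X $$ (i, j)) \<noteq> 0" using assms by (auto simp: col_one_def)
  then show ?thesis using assms by (auto simp: in_supp_iff)
qed

lemma smat_eqI:
  assumes "resolving A" "resolving B" "dim_row A = dim_row B" "dim_col A = dim_col B"
    and "\<And>a. ent A a = ent B a"
  shows "A = B"
proof (rule eq_matI)
  fix i j assume ij: "i < dim_row B" "j < dim_col B"
  show "A $$ (i, j) = B $$ (i, j)"
  proof (rule multiset_eqI)
    fix a
    have "count (A $$ (i, j)) a \<le> 1" "count (B $$ (i, j)) a \<le> 1"
      using assms ij by (auto simp: resolving_iff)
    moreover have "(i, j) \<in> ent A a \<longleftrightarrow> (i, j) \<in> ent B a" using assms by simp
    ultimately show "count (A $$ (i, j)) a = count (B $$ (i, j)) a"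
      using ij assms(3,4) unfolding in_ent_iff by (metis One_nat_def bot_nat_0.not_eq_extremum le_Suc_eq le_zero_eq)
  qed
qed (use assms in auto)

section \<open>Renaming symbols along a specification\<close>

lemma symbols_iff: "a \<in> symbols A \<longleftrightarrow> ent A a \<noteq> {}"
  by (force simp: symbols_def elements_mat_def ent_def)

lemma ent_map_mat:
  assumes "i < dim_row A" "j < dim_col A"
  shows "(i, j) \<in> ent (map_mat (image_mset f) A) b \<longleftrightarrow> (\<exists>a. f a = b \<and> (i, j) \<in> ent A a)"
  using assms by (auto simp: ent_def)

lemma ent_bounds: "(i, j) \<in> ent A a \<Longrightarrow> i < dim_row A \<and> j < dim_col A"
  by (simp add: in_ent_iff)

text \<open>Injectivity is not assumed, so several letters may be renamed to \<open>b\<close>; hence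
  the union. Under injectivity it has a single term, see \<open>smat_equiv_ent_eq\<close>.\<close>

lemma ent_smat_equiv:
  assumes "smat_equiv \<kappa> A B"
  shows "ent B b = (\<Union>a\<in>{a. \<kappa> a = Some b}. ent A a)"
proof -
  have dom: "a \<in> dom \<kappa>" if "(i, j) \<in> ent A a" for a i j
  proof -
    have "a \<in> symbols A" using that by (auto simp: symbols_iff)
    then show ?thesis using assms by (auto simp: smat_equiv_def)
  qed
  have B: "B = map_mat (image_mset (\<lambda>a. the (\<kappa> a))) A" using assms by (simp add: smat_equiv_def)
  have "(i, j) \<in> ent B b \<longleftrightarrow> (\<exists>a. \<kappa> a = Some b \<and> (i, j) \<in> ent A a)" for i j
  proof (cases "i < dim_row A \<and> j < dim_col A")
    case True
    then show ?thesis unfolding B using ent_map_mat[of i A j "\<lambda>a. the (\<kappa> a)" b] dom by force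
  next
    case False
    then show ?thesis unfolding B by (auto dest!: ent_bounds)
  qed
  then show ?thesis by auto
qed

text \<open>No two letters of \<open>A\<close> are merged, so the count of \<open>b\<close> in an
  entry is the count of its only preimage, or 0 if there is none.\<close>

lemma resolving_map_mat:
  assumes "resolving A" "inj_on f (symbols A)"
  shows "resolving (map_mat (image_mset f) A)"
  unfolding resolving_def
proof (intro allI impI)
  fix b j assume j: "j < dim_col (map_mat (image_mset f) A)"
  show "(\<Sum>i<dim_row (map_mat (image_mset f) A). count (map_mat (image_mset f) A $$ (i, j)) b) \<le> 1"
  proof (cases "\<exists>a\<in>symbols A. f a = b")
    case True
    then obtain a where a: "a \<in> symbols A" "f a = b" by blast
    have "count (image_mset f (A $$ (i, j))) b = count (A $$ (i, j)) a" if "i < dim_row A" for i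
    proof -
      have "x = a" if "x \<in># A $$ (i, j)" "f x = b" for x
      proof -
        have "x \<in> symbols A" using \<open>i < dim_row A\<close> j that(1)
          by (auto simp: symbols_iff ent_def)
        then show ?thesis using assms(2) a that(2) by (auto dest: inj_onD)
      qed
      then have "f -` {b} \<inter> set_mset (A $$ (i, j)) \<subseteq> {a}" by auto
      then have "count (image_mset f (A $$ (i, j))) b = sum (count (A $$ (i, j))) ({a} \<inter> set_mset (A $$ (i, j)))"
        unfolding count_image_mset using a by (intro sum.cong) auto
      then show ?thesis by (cases "a \<in># A $$ (i, j)") (auto simp: not_in_iff)
    qed
    then show ?thesis using assms(1) j by (simp add: resolving_def)
  next
    case False
    have "count (image_mset f (A $$ (i, j))) b = 0" if "i < dim_row A" for i
    proof -
      have "b \<notin># image_mset f (A $$ (i, j))"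
        using False that j by (auto simp: symbols_iff ent_def)
      then show ?thesis by (meson count_eq_zero_iff)
    qed
    then show ?thesis using j by simp
  qed
qed

text \<open>The renamed \<open>A\<close> and \<open>B\<close> are both resolving and have the same
  letter relations, so they coincide by \<open>smat_eqI\<close>.\<close>

lemma smat_equivI:
  assumes "resolving A" "resolving B" "dim_row A = dim_row B" "dim_col A = dim_col B"
    and inj: "inj_on \<kappa> (dom \<kappa>)" and dom: "\<And>a. ent A a \<noteq> {} \<Longrightarrow> a \<in> dom \<kappa>"
    and ent: "\<And>b. ent B b = (\<Union>a\<in>{a. \<kappa> a = Some b}. ent A a)"
  shows "smat_equiv \<kappa> A B"
proof -
  let ?f = "\<lambda>a. the (\<kappa> a)"
  have sub: "symbols A \<subseteq> dom \<kappa>" by (rule subsetI) (metis dom symbols_iff)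
  have "inj_on ?f (dom \<kappa>)" by (rule inj_onI) (metis domIff inj inj_onD option.expand)
  then have "inj_on ?f (symbols A)" using sub inj_on_subset by blast
  then have res: "resolving (map_mat (image_mset ?f) A)" using assms(1) by (rule resolving_map_mat[rotated])
  have "smat_equiv \<kappa> A (map_mat (image_mset ?f) A)" using sub by (simp add: smat_equiv_def)
  then have "ent B b = ent (map_mat (image_mset ?f) A) b" for b
    by (simp only: ent ent_smat_equiv)
  then have "B = map_mat (image_mset ?f) A"
    using assms res by (intro smat_eqI) auto
  then show ?thesis using sub by (simp add: smat_equiv_def)
qed

text \<open>For the letter relations of a matrix: every vertex emits and every vertex receives. It
  is stated for arbitrary families so that it also applies to relations indexed by words.\<close>

definition full :: "('a \<Rightarrow> (nat \<times> nat) set) \<Rightarrow> nat \<Rightarrow> nat \<Rightarrow> bool" where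
  "full E m n \<longleftrightarrow> (\<forall>i<m. \<exists>a j. (i, j) \<in> E a) \<and> (\<forall>j<n. \<exists>a i. (i, j) \<in> E a)"

lemma full_comp:
  assumes "full E m n" "full F n p" "\<And>a. E a \<subseteq> {..<m} \<times> {..<n}" "\<And>b. F b \<subseteq> {..<n} \<times> {..<p}"
  shows "full (\<lambda>(a, b). E a O F b) m p"
  unfolding full_def
proof (intro conjI allI impI)
  fix i assume "i < m"
  then obtain a k where ak: "(i, k) \<in> E a" using assms(1) by (auto simp: full_def)
  then have "k < n" using assms(3)[of a] by auto
  then obtain b j where "(k, j) \<in> F b" using assms(2) by (auto simp: full_def)
  then show "\<exists>ab j. (i, j) \<in> (case ab of (a, b) \<Rightarrow> E a O F b)" using ak by (intro exI[of _ "(a, b)"]) auto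
next
  fix j assume "j < p"
  then obtain b k where bk: "(k, j) \<in> F b" using assms(2) by (auto simp: full_def)
  then have "k < n" using assms(4)[of b] by auto
  then obtain a i where "(i, k) \<in> E a" using assms(1) by (auto simp: full_def)
  then show "\<exists>ab i. (i, j) \<in> (case ab of (a, b) \<Rightarrow> E a O F b)" using bk by (intro exI[of _ "(a, b)"]) auto
qed

text \<open>The commutation clause at level \<open>l\<close> is translated with the help of the
  other clauses at level \<open>l + 1\<close>. The equivalence is therefore proved for all levels at
  once, with the level sizes \<open>m\<close> fixed.\<close>

lemma symbolic_matrix_system_iff:
  "symbolic_matrix_system S M I \<longleftrightarrow> finite S \<and> (\<exists>m. \<forall>l.
     M l \<in> carrier_mat (m l) (m (l + 1)) \<and> symbols (M l) \<subseteq> S \<and>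
     I l \<in> carrier_mat (m l) (m (l + 1)) \<and> col_one (I l) \<and>
     (\<forall>i<m l. \<exists>j. (i, j) \<in> supp (I l)) \<and>
     full (ent (M l)) (m l) (m (l + 1)) \<and> resolving (M l) \<and>
     (\<forall>a. supp (I l) O ent (M (l + 1)) a = ent (M l) a O supp (I (l + 1))))"
  (is "_ \<longleftrightarrow> _ \<and> (\<exists>m. \<forall>l. ?R m l)")
proof -
  let ?L = "\<lambda>m l. M l \<in> carrier_mat (m l) (m (l + 1)) \<and> symbols (M l) \<subseteq> S \<and>
     I l \<in> carrier_mat (m l) (m (l + 1)) \<and> zero_one (I l) \<and>
     (\<forall>i<m l. \<exists>j<m (l + 1). I l $$ (i, j) = 1) \<and>
     (\<forall>j<m (l + 1). \<exists>!i. i < m l \<and> I l $$ (i, j) = 1) \<and>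
     I l \<odot>\<^sub>l M (l + 1) = M l \<odot>\<^sub>r I (l + 1) \<and>
     (\<forall>i<m l. \<exists>j<m (l + 1). M l $$ (i, j) \<noteq> {#}) \<and>
     (\<forall>j<m (l + 1). \<exists>i<m l. M l $$ (i, j) \<noteq> {#}) \<and>
     (\<forall>i<m l. \<forall>j<m (l + 1). \<forall>a. count (M l $$ (i, j)) a \<le> 1) \<and>
     (\<forall>i<m l. \<forall>i'<m l. \<forall>j<m (l + 1). \<forall>a.
        a \<in># M l $$ (i, j) \<and> a \<in># M l $$ (i', j) \<longrightarrow> i = i')"
  have "(\<forall>l. ?L m l) \<longleftrightarrow> (\<forall>l. ?R m l)" for m
  proof -
    have aux: "(\<forall>i<m l. \<exists>j<m (l + 1). I l $$ (i, j) = 1) \<longleftrightarrow> (\<forall>i<m l. \<exists>j. (i, j) \<in> supp (I l))"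
      if "I l \<in> carrier_mat (m l) (m (l + 1))" "zero_one (I l)" for l
    proof -
      have "0 < I l $$ (i, j) \<longleftrightarrow> I l $$ (i, j) = 1" if "i < m l" "j < m (l + 1)" for i j
        using that \<open>zero_one (I l)\<close> \<open>I l \<in> _\<close> by (fastforce simp: zero_one_def elements_mat_def)
      then show ?thesis using that(1) by (simp add: in_supp_iff) blast
    qed
    have aux2: "(\<forall>i<m l. \<exists>j<m (l + 1). M l $$ (i, j) \<noteq> {#}) \<and> (\<forall>j<m (l + 1). \<exists>i<m l. M l $$ (i, j) \<noteq> {#})
       \<longleftrightarrow> full (ent (M l)) (m l) (m (l + 1))"
      if "M l \<in> carrier_mat (m l) (m (l + 1))" for l
    proof -
      have ne: "X \<noteq> {#} \<longleftrightarrow> (\<exists>a. a \<in># X)" for X :: "'a multiset" by auto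
      show ?thesis using that unfolding full_def ent_def ne by (simp, blast)
    qed
    have comm: "I l \<odot>\<^sub>l M (l + 1) = M l \<odot>\<^sub>r I (l + 1) \<longleftrightarrow>
        (\<forall>a. supp (I l) O ent (M (l + 1)) a = ent (M l) a O supp (I (l + 1)))"
      if "M l \<in> carrier_mat (m l) (m (l + 1))" "I l \<in> carrier_mat (m l) (m (l + 1))"
        "M (l + 1) \<in> carrier_mat (m (l + 1)) (m (l + 2))" "I (l + 1) \<in> carrier_mat (m (l + 1)) (m (l + 2))"
        "col_one (I l)" "col_one (I (l + 1))" "resolving (M l)" "resolving (M (l + 1))" for l
    proof
      assume eq: "I l \<odot>\<^sub>l M (l + 1) = M l \<odot>\<^sub>r I (l + 1)"
      show "\<forall>a. supp (I l) O ent (M (l + 1)) a = ent (M l) a O supp (I (l + 1))"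
      proof
        fix a
        have "supp (I l) O ent (M (l + 1)) a = ent (I l \<odot>\<^sub>l M (l + 1)) a"
          using that by (subst ent_nat_smat_mult) auto
        also have "\<dots> = ent (M l) a O supp (I (l + 1))"
          unfolding eq using that by (subst ent_smat_nat_mult) auto
        finally show "supp (I l) O ent (M (l + 1)) a = ent (M l) a O supp (I (l + 1))" .
      qed
    next
      assume "\<forall>a. supp (I l) O ent (M (l + 1)) a = ent (M l) a O supp (I (l + 1))"
      then show "I l \<odot>\<^sub>l M (l + 1) = M l \<odot>\<^sub>r I (l + 1)"
        using that by (intro smat_eqI)
          (auto simp: ent_nat_smat_mult ent_smat_nat_mult intro!: resolving_nat_smat_mult resolving_smat_nat_mult)
    qed
    have dims: "dim_row (M l) = m l" "dim_col (M l) = m (l + 1)" if "M l \<in> carrier_mat (m l) (m (l + 1))" for l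
      using that by auto
    have dimsI: "dim_row (I l) = m l" "dim_col (I l) = m (l + 1)" if "I l \<in> carrier_mat (m l) (m (l + 1))" for l
      using that by auto
    show ?thesis
    proof
      assume L: "\<forall>l. ?L m l"
      have M: "M l \<in> carrier_mat (m l) (m (l + 1))" and S: "symbols (M l) \<subseteq> S"
        and I: "I l \<in> carrier_mat (m l) (m (l + 1))" and z: "zero_one (I l)"
        and row: "\<forall>i<m l. \<exists>j<m (l + 1). I l $$ (i, j) = 1"
        and col: "\<forall>j<m (l + 1). \<exists>!i. i < m l \<and> I l $$ (i, j) = 1"
        and co: "I l \<odot>\<^sub>l M (l + 1) = M l \<odot>\<^sub>r I (l + 1)"
        and emit: "\<forall>i<m l. \<exists>j<m (l + 1). M l $$ (i, j) \<noteq> {#}"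
        and receive: "\<forall>j<m (l + 1). \<exists>i<m l. M l $$ (i, j) \<noteq> {#}"
        and simple: "\<forall>i<m l. \<forall>j<m (l + 1). \<forall>a. count (M l $$ (i, j)) a \<le> 1"
        and left: "\<forall>i<m l. \<forall>i'<m l. \<forall>j<m (l + 1). \<forall>a.
          a \<in># M l $$ (i, j) \<and> a \<in># M l $$ (i', j) \<longrightarrow> i = i'" for l
        using spec[OF L, of l] by - ((elim conjE, assumption)+)
      have c: "col_one (I l)" for l
        unfolding col_one_iff dimsI[OF I] using z col by (intro conjI)
      have r: "resolving (M l)" for l
        unfolding resolving_iff dims[OF M] using simple left by (intro conjI)
      show "\<forall>l. ?R m l"
      proof (intro allI impI conjI M S I c r)
        fix l
        show "\<exists>j. (i, j) \<in> supp (I l)" if "i < m l" for i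
          using aux[OF I z, of l] row that by blast
        show "full (ent (M l)) (m l) (m (l + 1))"
          using aux2[OF M] emit receive by blast
        show "supp (I l) O ent (M (l + 1)) a = ent (M l) a O supp (I (l + 1))" for a
          using comm[OF M I, of l] M[of "l + 1"] I[of "l + 1"] c r co by simp
      qed
    next
      assume R: "\<forall>l. ?R m l"
      have M: "M l \<in> carrier_mat (m l) (m (l + 1))" and S: "symbols (M l) \<subseteq> S"
        and I: "I l \<in> carrier_mat (m l) (m (l + 1))" and c: "col_one (I l)"
        and row: "\<forall>i<m l. \<exists>j. (i, j) \<in> supp (I l)"
        and f: "full (ent (M l)) (m l) (m (l + 1))" and r: "resolving (M l)"
        and co: "\<forall>a. supp (I l) O ent (M (l + 1)) a = ent (M l) a O supp (I (l + 1))" for l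
        using spec[OF R, of l] by - ((elim conjE, assumption)+)
      have z: "zero_one (I l)" and col: "\<forall>j<m (l + 1). \<exists>!i. i < m l \<and> I l $$ (i, j) = 1" for l
        using c[of l] unfolding col_one_iff dimsI[OF I] by - ((elim conjE, assumption)+)
      have simple: "\<forall>i<m l. \<forall>j<m (l + 1). \<forall>a. count (M l $$ (i, j)) a \<le> 1"
        and left: "\<forall>i<m l. \<forall>i'<m l. \<forall>j<m (l + 1). \<forall>a.
          a \<in># M l $$ (i, j) \<and> a \<in># M l $$ (i', j) \<longrightarrow> i = i'" for l
        using r[of l] unfolding resolving_iff dims[OF M] by - ((elim conjE, assumption)+)
      have emit: "\<forall>i<m l. \<exists>j<m (l + 1). M l $$ (i, j) \<noteq> {#}"
        and receive: "\<forall>j<m (l + 1). \<exists>i<m l. M l $$ (i, j) \<noteq> {#}" for l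
        using iffD2[OF aux2[OF M] f[of l]] by - ((elim conjE, assumption)+)
      have row1: "\<forall>i<m l. \<exists>j<m (l + 1). I l $$ (i, j) = 1" for l
        by (rule iffD2[OF aux[OF I z] row])
      have co': "I l \<odot>\<^sub>l M (l + 1) = M l \<odot>\<^sub>r I (l + 1)" for l
        using comm[OF M I, of l] M[of "l + 1"] I[of "l + 1"] c r co by simp
      show "\<forall>l. ?L m l"
        by (rule allI) (intro conjI M S I z row1 col co' emit receive simple left)
    qed
  qed
  then show ?thesis unfolding symbolic_matrix_system_def by presburger
qed

section \<open>One step of a proper strong shift equivalence\<close>

text \<open>\<open>m l\<close> is the number of vertices of level \<open>l\<close>.\<close>

definition sms :: "(nat \<Rightarrow> nat) \<Rightarrow> 'a set \<Rightarrow> (nat \<Rightarrow> 'a smat) \<Rightarrow> (nat \<Rightarrow> nat mat) \<Rightarrow> bool" where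
  "sms m S M I \<longleftrightarrow> finite S \<and> (\<forall>l.
     M l \<in> carrier_mat (m l) (m (l + 1)) \<and> symbols (M l) \<subseteq> S \<and>
     I l \<in> carrier_mat (m l) (m (l + 1)) \<and> col_one (I l) \<and>
     (\<forall>i<m l. \<exists>j. (i, j) \<in> supp (I l)) \<and>
     full (ent (M l)) (m l) (m (l + 1)) \<and> resolving (M l) \<and>
     (\<forall>a. supp (I l) O ent (M (l + 1)) a = ent (M l) a O supp (I (l + 1))))"

lemma symbolic_matrix_system_sms: "symbolic_matrix_system S M I \<longleftrightarrow> (\<exists>m. sms m S M I)"
  unfolding symbolic_matrix_system_iff sms_def by simp

lemma smsD:
  assumes "sms m S M I"
  shows "finite S" "M l \<in> carrier_mat (m l) (m (l + 1))" "symbols (M l) \<subseteq> S"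
    "I l \<in> carrier_mat (m l) (m (l + 1))" "col_one (I l)" "i < m l \<Longrightarrow> \<exists>j. (i, j) \<in> supp (I l)"
    "full (ent (M l)) (m l) (m (l + 1))" "resolving (M l)"
    "supp (I l) O ent (M (l + 1)) a = ent (M l) a O supp (I (l + 1))"
  using assms unfolding sms_def by auto

text \<open>Letter relations would be too coarse here: this and the next identity are applied to
  \<open>P\<close>, \<open>X\<close>, \<open>Y\<close> in order to bound multiplicities.\<close>

lemma assoc_nat_smat_nat_mult:
  assumes "dim_col X = dim_row A" "dim_col A = dim_row Y"
  shows "(X \<odot>\<^sub>l A) \<odot>\<^sub>r Y = X \<odot>\<^sub>l (A \<odot>\<^sub>r Y)"
proof (rule eq_matI)
  fix i j assume "i < dim_row (X \<odot>\<^sub>l (A \<odot>\<^sub>r Y))" "j < dim_col (X \<odot>\<^sub>l (A \<odot>\<^sub>r Y))"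
  then have ij: "i < dim_row X" "j < dim_col Y" by simp_all
  show "((X \<odot>\<^sub>l A) \<odot>\<^sub>r Y) $$ (i, j) = (X \<odot>\<^sub>l (A \<odot>\<^sub>r Y)) $$ (i, j)"
  proof (rule multiset_eqI)
    fix a
    have "count (((X \<odot>\<^sub>l A) \<odot>\<^sub>r Y) $$ (i, j)) a =
        (\<Sum>k<dim_col A. (\<Sum>k'<dim_col X. X $$ (i, k') * count (A $$ (k', k)) a) * Y $$ (k, j))"
      using ij by (simp add: count_smat_nat_mult count_nat_smat_mult)
    also have "\<dots> = (\<Sum>k'<dim_col X. X $$ (i, k') * (\<Sum>k<dim_col A. count (A $$ (k', k)) a * Y $$ (k, j)))"
      unfolding sum_distrib_left sum_distrib_right by (subst sum.swap) (simp add: mult.assoc)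
    also have "\<dots> = count ((X \<odot>\<^sub>l (A \<odot>\<^sub>r Y)) $$ (i, j)) a"
      using ij assms by (simp add: count_smat_nat_mult count_nat_smat_mult)
    finally show "count (((X \<odot>\<^sub>l A) \<odot>\<^sub>r Y) $$ (i, j)) a = count ((X \<odot>\<^sub>l (A \<odot>\<^sub>r Y)) $$ (i, j)) a" .
  qed
qed simp_all

lemma assoc_nat_nat_smat_mult:
  assumes "dim_col X = dim_row Y" "dim_col Y = dim_row A"
  shows "(X * Y) \<odot>\<^sub>l A = X \<odot>\<^sub>l (Y \<odot>\<^sub>l A)"
proof (rule eq_matI)
  fix i j assume "i < dim_row (X \<odot>\<^sub>l (Y \<odot>\<^sub>l A))" "j < dim_col (X \<odot>\<^sub>l (Y \<odot>\<^sub>l A))"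
  then have ij: "i < dim_row X" "j < dim_col A" by simp_all
  show "((X * Y) \<odot>\<^sub>l A) $$ (i, j) = (X \<odot>\<^sub>l (Y \<odot>\<^sub>l A)) $$ (i, j)"
  proof (rule multiset_eqI)
    fix a
    have "count (((X * Y) \<odot>\<^sub>l A) $$ (i, j)) a =
        (\<Sum>k<dim_col Y. (\<Sum>k'<dim_col X. X $$ (i, k') * Y $$ (k', k)) * count (A $$ (k, j)) a)"
      using ij assms by (simp add: count_nat_smat_mult index_nat_mult del: index_mult_mat(1))
    also have "\<dots> = (\<Sum>k'<dim_col X. X $$ (i, k') * (\<Sum>k<dim_col Y. Y $$ (k', k) * count (A $$ (k, j)) a))"
      unfolding sum_distrib_left sum_distrib_right by (subst sum.swap) (simp add: mult.assoc)
    also have "\<dots> = count ((X \<odot>\<^sub>l (Y \<odot>\<^sub>l A)) $$ (i, j)) a"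
      using ij assms by (simp add: count_nat_smat_mult)
    finally show "count (((X * Y) \<odot>\<^sub>l A) $$ (i, j)) a = count ((X \<odot>\<^sub>l (Y \<odot>\<^sub>l A)) $$ (i, j)) a" .
  qed
qed simp_all

text \<open>What is kept of one step once \<open>Q\<close> and the odd levels are eliminated.
  \<open>F l\<close> leads from level \<open>l\<close> of the first system to level
  \<open>l + 1\<close> of the second. The letter \<open>d\<close> shared by
  \<open>\<kappa> a\<close> and \<open>\<kappa>' a'\<close> couples the two sides of a square, and
  the last two clauses say that a nonempty product on either side belongs to such a
  coupling.\<close>

definition textile_step where
  "textile_step m M I m' M' I' C \<kappa> \<kappa>' F \<longleftrightarrow> (\<forall>l.
     F l \<in> carrier_mat (m l) (m' (l + 1)) \<and> symbols (F l) \<subseteq> C \<and> resolving (F l) \<and>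
     full (ent (F l)) (m l) (m' (l + 1)) \<and>
     (\<forall>c. supp (I l) O ent (F (l + 1)) c = ent (F l) c O supp (I' (l + 1))) \<and>
     (\<forall>a c c' d a'. \<kappa> a = Some (c', d) \<and> \<kappa>' a' = Some (d, c) \<longrightarrow>
        ent (M l) a O ent (F (l + 1)) c = ent (F l) c' O ent (M' (l + 1)) a') \<and>
     (\<forall>a c. ent (M l) a O ent (F (l + 1)) c \<noteq> {} \<longrightarrow>
        (\<exists>c' d a'. \<kappa> a = Some (c', d) \<and> \<kappa>' a' = Some (d, c))) \<and>
     (\<forall>c' a'. ent (F l) c' O ent (M' (l + 1)) a' \<noteq> {} \<longrightarrow>
        (\<exists>a c d. \<kappa> a = Some (c', d) \<and> \<kappa>' a' = Some (d, c))))"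

lemma smat_equiv_ent_eq:
  assumes "smat_equiv \<kappa> A B" "inj_on \<kappa> (dom \<kappa>)" "\<kappa> a = Some b"
  shows "ent B b = ent A a"
proof -
  have "{a. \<kappa> a = Some b} = {a}" using assms(2,3) by (auto intro: inj_onD[OF assms(2)])
  then show ?thesis using ent_smat_equiv[OF assms(1)] by simp
qed

lemma smat_equiv_dims:
  "smat_equiv \<kappa> A B \<Longrightarrow> dim_row B = dim_row A \<and> dim_col B = dim_col A"
  by (simp add: smat_equiv_def)

lemma smat_equiv_resolving:
  assumes "smat_equiv \<kappa> A B" "inj_on \<kappa> (dom \<kappa>)" "resolving A"
  shows "resolving B"
proof -
  have "inj_on (\<lambda>a. the (\<kappa> a)) (dom \<kappa>)"
    by (rule inj_onI) (metis domIff assms(2) inj_onD option.expand)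
  then have "inj_on (\<lambda>a. the (\<kappa> a)) (symbols A)"
    using assms(1) inj_on_subset unfolding smat_equiv_def by blast
  then show ?thesis using assms(1,3) resolving_map_mat by (simp add: smat_equiv_def)
qed

text \<open>At the odd levels nothing forces \<open>X l\<close> and \<open>Y l\<close> to be functional, so the column \<open>j\<close> of \<open>F l\<close> is not
  controlled directly. Instead one uses \<open>F l Y (2l+2) = I l P (2l+2)\<close> in a column \<open>w\<close> that is joined
  to \<open>j\<close> by \<open>Y (2l+2)\<close> and whose row in \<open>Q (2l+3)\<close> is nonzero.\<close>

lemma proper_sse_1_textile_step:
  assumes sms: "sms m S M I" and sms': "sms m' S' M' I'"
    and sse: "proper_sse_1 S M I S' M' I' C D \<kappa> \<kappa>' P Q X Y"
    and F: "\<And>l. F l = P (2 * l) \<odot>\<^sub>r Y (2 * l + 1)"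
  shows "textile_step m M I m' M' I' C \<kappa> \<kappa>' F"
proof -
  have inj: "inj_on \<kappa> (dom \<kappa>)" "inj_on \<kappa>' (dom \<kappa>')"
    using sse by (auto simp: proper_sse_1_def specification_map_def)
  obtain n n' where "\<forall>l. P l \<in> carrier_mat (n l) (n' (l + 1)) \<and> symbols (P l) \<subseteq> C \<and>
        Q l \<in> carrier_mat (n' l) (n (l + 1)) \<and> symbols (Q l) \<subseteq> D \<and>
        X l \<in> carrier_mat (n l) (n (l + 1)) \<and> zero_one (X l) \<and>
        Y l \<in> carrier_mat (n' l) (n' (l + 1)) \<and> zero_one (Y l)"
    using sse unfolding proper_sse_1_def by blast
  then have
    dP: "dim_row (P l) = n l" "dim_col (P l) = n' (l + 1)" and sP: "symbols (P l) \<subseteq> C" and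
    dQ: "dim_row (Q l) = n' l" "dim_col (Q l) = n (l + 1)" and
    dX: "dim_row (X l) = n l" "dim_col (X l) = n (l + 1)" and
    dY: "dim_row (Y l) = n' l" "dim_col (Y l) = n' (l + 1)" for l by auto
  have all: "\<forall>l. smat_equiv \<kappa> (M l) (P (2 * l) \<odot> Q (2 * l + 1)) \<and>
          smat_equiv \<kappa>' (M' l) (Q (2 * l) \<odot> P (2 * l + 1)) \<and>
          I l = X (2 * l) * X (2 * l + 1) \<and>
          I' l = Y (2 * l) * Y (2 * l + 1) \<and>
          X l \<odot>\<^sub>l P (l + 1) = P l \<odot>\<^sub>r Y (l + 1) \<and>
          Y l \<odot>\<^sub>l Q (l + 1) = Q l \<odot>\<^sub>r X (l + 1)"
    using sse unfolding proper_sse_1_def by (elim conjE)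
  have eqM: "smat_equiv \<kappa> (M l) (P (2 * l) \<odot> Q (2 * l + 1))"
    and eqM': "smat_equiv \<kappa>' (M' l) (Q (2 * l) \<odot> P (2 * l + 1))"
    and IX: "I l = X (2 * l) * X (2 * l + 1)" and IY: "I' l = Y (2 * l) * Y (2 * l + 1)"
    and XP: "X l \<odot>\<^sub>l P (l + 1) = P l \<odot>\<^sub>r Y (l + 1)"
    and YQ: "Y l \<odot>\<^sub>l Q (l + 1) = Q l \<odot>\<^sub>r X (l + 1)" for l
    using spec[OF all, of l] by - ((elim conjE, assumption)+)
  \<comment> \<open>Only the even levels of \<open>n\<close> and \<open>n'\<close> are levels of the
    two systems.\<close>
  have nm: "n (2 * l) = m l" "n' (2 * l) = m' l" for l
    using smat_equiv_dims[OF eqM[of l]] smat_equiv_dims[OF eqM'[of l]]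
      smsD(2)[OF sms, of l] smsD(2)[OF sms', of l] dP dQ by auto
  have nm2: "n (Suc (Suc (2 * l))) = m (Suc l)" "n' (Suc (Suc (2 * l))) = m' (Suc l)" for l
    using nm[of "Suc l"] by simp_all
  define p where "p l c = ent (P l) c" for l c
  define q where "q l d = ent (Q l) d" for l d
  define x where "x l = supp (X l)" for l
  define y where "y l = supp (Y l)" for l
  have pq: "p (2 * l) c O q (2 * l + 1) d = (\<Union>a\<in>{a. \<kappa> a = Some (c, d)}. ent (M l) a)" for l c d
    unfolding p_def q_def ent_smat_equiv[OF eqM, symmetric] by (rule ent_smat_mult[symmetric]) (simp add: dP dQ)
  have qp: "q (2 * l) d O p (2 * l + 1) c = (\<Union>a\<in>{a. \<kappa>' a = Some (d, c)}. ent (M' l) a)" for l c d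
    unfolding p_def q_def ent_smat_equiv[OF eqM', symmetric] by (rule ent_smat_mult[symmetric]) (simp add: dP dQ)
  have M_pq: "ent (M l) a = p (2 * l) c O q (2 * l + 1) d" if "\<kappa> a = Some (c, d)" for l a c d
    using smat_equiv_ent_eq[OF eqM inj(1) that] unfolding p_def q_def
    by (subst ent_smat_mult[symmetric]) (simp_all add: dP dQ)
  have M_qp: "ent (M' l) a = q (2 * l) d O p (2 * l + 1) c" if "\<kappa>' a = Some (d, c)" for l a c d
    using smat_equiv_ent_eq[OF eqM' inj(2) that] unfolding p_def q_def
    by (subst ent_smat_mult[symmetric]) (simp_all add: dP dQ)
  have dom: "\<exists>c d. \<kappa> a = Some (c, d)" if "(i, j) \<in> ent (M l) a" for i j l a
  proof -
    have "a \<in> symbols (M l)" using that by (auto simp: symbols_iff)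
    then have "a \<in> dom \<kappa>" using eqM[of l] unfolding smat_equiv_def by (elim conjE) (rule subsetD)
    then show ?thesis by auto
  qed
  have dom': "\<exists>d c. \<kappa>' a = Some (d, c)" if "(i, j) \<in> ent (M' l) a" for i j l a
  proof -
    have "a \<in> symbols (M' l)" using that by (auto simp: symbols_iff)
    then have "a \<in> dom \<kappa>'" using eqM'[of l] unfolding smat_equiv_def by (elim conjE) (rule subsetD)
    then show ?thesis by auto
  qed
  have xx: "supp (I l) = x (2 * l) O x (2 * l + 1)" for l
    unfolding x_def IX by (rule supp_mult) (simp add: dX)
  have yy: "supp (I' l) = y (2 * l) O y (2 * l + 1)" for l
    unfolding y_def IY by (rule supp_mult) (simp add: dY)
  have xp: "x l O p (l + 1) c = p l c O y (l + 1)" for l c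
    using arg_cong[OF XP[of l], of "\<lambda>A. ent A c"] unfolding x_def p_def y_def
    by (simp add: ent_nat_smat_mult ent_smat_nat_mult dX dP dY)
  have yq: "y l O q (l + 1) d = q l d O x (l + 1)" for l d
    using arg_cong[OF YQ[of l], of "\<lambda>A. ent A d"] unfolding x_def q_def y_def
    by (simp add: ent_nat_smat_mult ent_smat_nat_mult dX dQ dY)
  have entF: "ent (F l) c = p (2 * l) c O y (2 * l + 1)" for l c
    unfolding F p_def y_def by (rule ent_smat_nat_mult) (simp add: dP dY)
  have pb: "i < n l" "j < n' (l + 1)" if "(i, j) \<in> p l c" for i j l c
    using that by (auto simp: p_def dP dest: ent_bounds)
  have qb: "i < n' l" "j < n (l + 1)" if "(i, j) \<in> q l c" for i j l c
    using that by (auto simp: q_def dQ dest: ent_bounds)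
  have yb: "i < n' l" "j < n' (l + 1)" if "(i, j) \<in> y l" for i j l
    using that by (auto simp: y_def dY in_supp_iff)
  \<comment> \<open>The letter \<open>c\<close> is carried across both factors of
    \<open>I l\<close>; \<open>y\<close> is split off only once, on the right, so that no
    information about a single odd-level \<open>y\<close> is used.\<close>
  have I_p: "supp (I l) O p (2 * l + 2) c = ent (F l) c O y (2 * l + 2)" for l c
  proof -
    have "supp (I l) O p (2 * l + 2) c = x (2 * l) O (p (2 * l + 1) c O y (2 * l + 2))"
      using xp[of "2 * l + 1" c] by (simp add: xx O_assoc)
    also have "\<dots> = (x (2 * l) O p (2 * l + 1) c) O y (2 * l + 2)" by (simp add: O_assoc)
    also have "\<dots> = ent (F l) c O y (2 * l + 2)" using xp[of "2 * l" c] by (simp add: entF)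
    finally show ?thesis .
  qed
  have intertwine: "supp (I l) O ent (F (l + 1)) c = ent (F l) c O supp (I' (l + 1))" for l c
  proof -
    have "supp (I l) O ent (F (l + 1)) c = (supp (I l) O p (2 * l + 2) c) O y (2 * l + 3)"
      by (simp add: entF O_assoc eval_nat_numeral)
    also have "\<dots> = ent (F l) c O supp (I' (l + 1))"
      unfolding I_p yy by (simp add: O_assoc eval_nat_numeral)
    finally show ?thesis .
  qed
  \<comment> \<open>Both sides of the square rule are brought to the common form
    \<open>p y q p\<close>, in which \<open>a\<close> and \<open>a'\<close> are visible only through
    \<open>c'\<close>, \<open>d\<close>, \<open>c\<close>.\<close>
  have square: "ent (M l) a O ent (F (l + 1)) c = p (2 * l) c' O y (2 * l + 1) O q (2 * l + 2) d O p (2 * l + 3) c"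
    if "\<kappa> a = Some (c', d)" for l a c c' d
  proof -
    have "ent (M l) a O ent (F (l + 1)) c =
        p (2 * l) c' O q (2 * l + 1) d O (p (2 * l + 2) c O y (2 * l + 3))"
      by (simp add: M_pq[OF that] entF O_assoc eval_nat_numeral)
    also have "p (2 * l + 2) c O y (2 * l + 3) = x (2 * l + 2) O p (2 * l + 3) c"
      using xp[of "2 * l + 2" c] by (simp add: eval_nat_numeral)
    also have "p (2 * l) c' O q (2 * l + 1) d O x (2 * l + 2) O p (2 * l + 3) c =
        p (2 * l) c' O (q (2 * l + 1) d O x (2 * l + 2)) O p (2 * l + 3) c" by (simp add: O_assoc)
    also have "q (2 * l + 1) d O x (2 * l + 2) = y (2 * l + 1) O q (2 * l + 2) d"
      using yq[of "2 * l + 1" d] by (simp add: eval_nat_numeral)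
    finally show ?thesis by (simp add: O_assoc)
  qed
  have square': "ent (F l) c' O ent (M' (l + 1)) a' = p (2 * l) c' O y (2 * l + 1) O q (2 * l + 2) d O p (2 * l + 3) c"
    if "\<kappa>' a' = Some (d, c)" for l a' c c' d
    by (simp add: M_qp[OF that] entF O_assoc eval_nat_numeral)
  \<comment> \<open>A lift \<open>v\<close> of \<open>j\<close> is reached through an intermediate
    \<open>w\<close>. An edge leaving \<open>v\<close> begins with a \<open>q\<close>-edge of some
    letter \<open>d\<close>, which \<open>yq\<close> pulls back along \<open>y (2 * l + 3)\<close>
    to an edge leaving \<open>w\<close>.\<close>
  have live: "\<exists>w. (j, w) \<in> y (2 * l + 2) \<and> (\<exists>v. (w, v) \<in> y (2 * l + 3)) \<and> (\<exists>d s. (w, s) \<in> q (2 * l + 3) d)"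
    if j: "j < m' (l + 1)" for j l
  proof -
    obtain v where "(j, v) \<in> supp (I' (l + 1))" using smsD(6)[OF sms' j] by blast
    then obtain w where w: "(j, w) \<in> y (2 * l + 2)" "(w, v) \<in> y (2 * l + 3)"
      unfolding yy by (auto simp: eval_nat_numeral)
    have "v < m' (l + 2)" using yb(2)[OF w(2)] nm(2)[of "l + 2"] by (simp add: eval_nat_numeral)
    then obtain a' z where az: "(v, z) \<in> ent (M' (l + 2)) a'"
      using smsD(7)[OF sms', of "l + 2"] by (auto simp: full_def)
    then obtain d c where dc: "\<kappa>' a' = Some (d, c)" using dom' by blast
    obtain z' where "(v, z') \<in> q (2 * (l + 2)) d" using az unfolding M_qp[OF dc] by blast
    then have "(w, z') \<in> y (2 * l + 3) O q (2 * l + 3 + 1) d" using w(2) by (auto simp: eval_nat_numeral)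
    then have "\<exists>s. (w, s) \<in> q (2 * l + 3) d" unfolding yq by blast
    then show ?thesis using w by blast
  qed
  have resF: "resolving (F l)" for l
    unfolding resolving_def
  proof (intro allI impI)
    fix c j assume "j < dim_col (F l)"
    then have j: "j < n' (2 * l + 2)" by (simp add: F dY)
    then have "j < m' (l + 1)" using nm(2)[of "l + 1"] by simp
    then obtain w d s where w: "(j, w) \<in> y (2 * l + 2)" "(w, s) \<in> q (2 * l + 3) d" using live by blast
    have wb: "w < n' (2 * l + 3)" using yb(2)[OF w(1)] by (simp add: eval_nat_numeral)
    have sb: "s < n (2 * l + 4)" using qb(2)[OF w(2)] by (simp add: eval_nat_numeral)
    have Yjw: "Y (2 * l + 2) $$ (j, w) \<ge> 1" using w(1) by (simp add: y_def in_supp_iff Suc_leI)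
    have Qws: "count (Q (2 * l + 3) $$ (w, s)) d \<ge> 1" using w(2) by (simp add: q_def in_ent_iff Suc_leI)
    have "F l \<odot>\<^sub>r Y (2 * l + 2) = (X (2 * l) \<odot>\<^sub>l P (2 * l + 1)) \<odot>\<^sub>r Y (2 * l + 2)"
      by (simp only: F XP)
    also have "\<dots> = X (2 * l) \<odot>\<^sub>l (P (2 * l + 1) \<odot>\<^sub>r Y (2 * l + 2))"
      by (rule assoc_nat_smat_nat_mult) (simp_all add: dX dP dY)
    also have "P (2 * l + 1) \<odot>\<^sub>r Y (2 * l + 2) = X (2 * l + 1) \<odot>\<^sub>l P (2 * l + 2)"
      using XP[of "2 * l + 1"] by simp
    also have "X (2 * l) \<odot>\<^sub>l X (2 * l + 1) \<odot>\<^sub>l P (2 * l + 2) = I l \<odot>\<^sub>l P (2 * l + 2)"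
      unfolding IX by (rule assoc_nat_nat_smat_mult[symmetric]) (simp_all add: dX dP)
    finally have FY: "F l \<odot>\<^sub>r Y (2 * l + 2) = I l \<odot>\<^sub>l P (2 * l + 2)" .
    have resPQ: "resolving (P (2 * l + 2) \<odot> Q (2 * l + 3))"
      using smat_equiv_resolving[OF eqM inj(1) smsD(8)[OF sms], of "l + 1"] by (simp add: eval_nat_numeral)
    \<comment> \<open>Column \<open>j\<close> of \<open>F l\<close> is dominated by column
      \<open>w\<close> of \<open>I l P (2l+2)\<close>, because \<open>Y\<close> has a positive entry
      at \<open>(j, w)\<close>. Column sums of \<open>I l\<close> are 1, so this is the column sum
      of \<open>P (2l+2)\<close> at \<open>w\<close>, dominated in turn by column \<open>s\<close>
      of \<open>P Q\<close>, because \<open>Q\<close> has a \<open>d\<close> at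
      \<open>(w, s)\<close>. The last matrix renames \<open>M (l + 1)\<close>, hence is
      resolving.\<close>
    have "(\<Sum>i<n (2 * l). count (F l $$ (i, j)) c) \<le> (\<Sum>i<n (2 * l). count ((F l \<odot>\<^sub>r Y (2 * l + 2)) $$ (i, w)) c)"
    proof (rule sum_mono)
      fix i assume "i \<in> {..<n (2 * l)}"
      then have e: "count ((F l \<odot>\<^sub>r Y (2 * l + 2)) $$ (i, w)) c =
          (\<Sum>k<n' (2 * l + 2). count (F l $$ (i, k)) c * Y (2 * l + 2) $$ (k, w))"
        using wb by (subst count_smat_nat_mult) (simp_all add: F dP dY eval_nat_numeral)
      have a: "\<dots> \<ge> count (F l $$ (i, j)) c * Y (2 * l + 2) $$ (j, w)"
        using j by (intro member_le_sum[where f = "\<lambda>k. count (F l $$ (i, k)) c * Y (2 * l + 2) $$ (k, w)"]) auto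
      have b: "count (F l $$ (i, j)) c \<le> count (F l $$ (i, j)) c * Y (2 * l + 2) $$ (j, w)"
        using mult_le_mono2[OF Yjw, of "count (F l $$ (i, j)) c"] by (simp only: mult_1_right)
      show "count (F l $$ (i, j)) c \<le> count ((F l \<odot>\<^sub>r Y (2 * l + 2)) $$ (i, w)) c"
        unfolding e by (rule order_trans[OF b a])
    qed
    also have "\<dots> = (\<Sum>i<n (2 * l). \<Sum>k<n (2 * l + 2). I l $$ (i, k) * count (P (2 * l + 2) $$ (k, w)) c)"
      unfolding FY using wb IX by (intro sum.cong refl)
        (subst count_nat_smat_mult, simp_all add: dX dP eval_nat_numeral)
    also have "\<dots> = (\<Sum>k<n (2 * l + 2). (\<Sum>i<n (2 * l). I l $$ (i, k)) * count (P (2 * l + 2) $$ (k, w)) c)"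
      by (rule sum_product_col)
    also have "\<dots> = (\<Sum>k<n (2 * l + 2). count (P (2 * l + 2) $$ (k, w)) c)"
    proof (rule sum.cong[OF refl])
      fix k assume "k \<in> {..<n (2 * l + 2)}"
      then have "(\<Sum>i<n (2 * l). I l $$ (i, k)) = 1"
        using smsD(5)[OF sms, of l] IX[of l] by (simp add: col_one_def dX)
      then show "(\<Sum>i<n (2 * l). I l $$ (i, k)) * count (P (2 * l + 2) $$ (k, w)) c =
          count (P (2 * l + 2) $$ (k, w)) c" by simp
    qed
    also have "\<dots> \<le> (\<Sum>k<n (2 * l + 2). count ((P (2 * l + 2) \<odot> Q (2 * l + 3)) $$ (k, s)) (c, d))"
    proof (rule sum_mono)
      fix k assume "k \<in> {..<n (2 * l + 2)}"
      then have e: "count ((P (2 * l + 2) \<odot> Q (2 * l + 3)) $$ (k, s)) (c, d) =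
          (\<Sum>w<n' (2 * l + 3). count (P (2 * l + 2) $$ (k, w)) c * count (Q (2 * l + 3) $$ (w, s)) d)"
        using sb by (subst count_smat_mult) (simp_all add: dP dQ eval_nat_numeral)
      have a: "\<dots> \<ge> count (P (2 * l + 2) $$ (k, w)) c * count (Q (2 * l + 3) $$ (w, s)) d"
        using wb by (intro member_le_sum[where f = "\<lambda>w. count (P (2 * l + 2) $$ (k, w)) c * count (Q (2 * l + 3) $$ (w, s)) d"]) auto
      have b: "count (P (2 * l + 2) $$ (k, w)) c \<le>
          count (P (2 * l + 2) $$ (k, w)) c * count (Q (2 * l + 3) $$ (w, s)) d"
        using mult_le_mono2[OF Qws, of "count (P (2 * l + 2) $$ (k, w)) c"] by (simp only: mult_1_right)
      show "count (P (2 * l + 2) $$ (k, w)) c \<le>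
          count ((P (2 * l + 2) \<odot> Q (2 * l + 3)) $$ (k, s)) (c, d)"
        unfolding e by (rule order_trans[OF b a])
    qed
    also have "\<dots> \<le> 1"
      using resPQ sb unfolding resolving_def by (simp add: dP dQ eval_nat_numeral)
    finally show "(\<Sum>i<dim_row (F l). count (F l $$ (i, j)) c) \<le> 1" by (simp add: F dP)
  qed
  \<comment> \<open>An edge leaving \<open>i\<close> splits into \<open>p\<close> and
    \<open>q\<close> at \<open>u\<close>. Lifting its terminal and applying \<open>yq\<close>
    produces a \<open>y\<close>-edge leaving \<open>u\<close>, which completes an edge of
    \<open>F l\<close>.\<close>
  have rowF: "\<exists>c j. (i, j) \<in> ent (F l) c" if i: "i < m l" for i l
  proof -
    obtain a k where ak: "(i, k) \<in> ent (M l) a" using smsD(7)[OF sms, of l] i by (auto simp: full_def)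
    obtain c d where cd: "\<kappa> a = Some (c, d)" using dom[OF ak] by blast
    obtain u where u: "(i, u) \<in> p (2 * l) c" "(u, k) \<in> q (2 * l + 1) d" using ak unfolding M_pq[OF cd] by blast
    have "k < m (l + 1)" using qb(2)[OF u(2)] nm(1)[of "l + 1"] by simp
    then obtain z where "(k, z) \<in> supp (I (l + 1))" using smsD(6)[OF sms] by blast
    then obtain z' where "(k, z') \<in> x (2 * l + 2)" unfolding xx by auto
    then have "(u, z') \<in> y (2 * l + 1) O q (2 * l + 1 + 1) d" using u(2) unfolding yq by auto
    then show ?thesis using u(1) unfolding entF by blast
  qed
  have colF: "\<exists>c i. (i, j) \<in> ent (F l) c" if j: "j < m' (l + 1)" for j l
  proof -
    obtain w v where w: "(j, w) \<in> y (2 * l + 2)" "(w, v) \<in> y (2 * l + 3)" using live[OF j] by blast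
    obtain a' k where ak: "(k, j) \<in> ent (M' l) a'" using smsD(7)[OF sms', of l] j by (auto simp: full_def)
    obtain d c where dc: "\<kappa>' a' = Some (d, c)" using dom'[OF ak] by blast
    obtain t where t: "(t, j) \<in> p (2 * l + 1) c" using ak unfolding M_qp[OF dc] by blast
    then have "(t, w) \<in> x (2 * l + 1) O p (2 * l + 1 + 1) c" using w(1) unfolding xp by auto
    then obtain r where r: "(r, w) \<in> p (2 * l + 2) c" by auto
    then have "r < m (l + 1)" using pb(1)[OF r] nm(1)[of "l + 1"] by simp
    then obtain i where "(i, r) \<in> supp (I l)"
      using col_one_ex[OF smsD(5)[OF sms], of r l] smsD(4)[OF sms, of l] by auto
    then have "(i, w) \<in> supp (I l) O p (2 * l + 2) c" using r by blast
    then obtain j' where j': "(i, j') \<in> ent (F l) c" "(j', w) \<in> y (2 * l + 2)" unfolding I_p by blast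
    \<comment> \<open>Intertwining only yields some \<open>j'\<close> that shares the successor
      \<open>w\<close> with \<open>j\<close>. Column \<open>v\<close> of \<open>I'\<close> has a
      single 1, which identifies the two.\<close>
    have "(j', v) \<in> supp (I' (l + 1))" "(j, v) \<in> supp (I' (l + 1))"
      using w j' unfolding yy by (auto simp: eval_nat_numeral)
    then have "j' = j" using col_oneD[OF smsD(5)[OF sms']] by blast
    then show ?thesis using j' by blast
  qed
  show ?thesis
    unfolding textile_step_def
  proof (intro allI conjI impI)
    fix l
    show "F l \<in> carrier_mat (m l) (m' (l + 1))"
      unfolding F by (rule carrier_matI) (simp_all add: dP dY nm nm2)
    show "symbols (F l) \<subseteq> C"
    proof
      fix c assume "c \<in> symbols (F l)"
      then have "c \<in> symbols (P (2 * l))" unfolding symbols_iff entF p_def by blast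
      then show "c \<in> C" using sP by blast
    qed
    show "resolving (F l)" by (rule resF)
    show "full (ent (F l)) (m l) (m' (l + 1))" unfolding full_def using rowF colF by blast
    show "supp (I l) O ent (F (l + 1)) c = ent (F l) c O supp (I' (l + 1))" for c by (rule intertwine)
    show "ent (M l) a O ent (F (l + 1)) c = ent (F l) c' O ent (M' (l + 1)) a'"
      if "\<kappa> a = Some (c', d) \<and> \<kappa>' a' = Some (d, c)" for a c c' d a'
      using that by (simp only: square square')
    show "\<exists>c' d a'. \<kappa> a = Some (c', d) \<and> \<kappa>' a' = Some (d, c)"
      if ne: "ent (M l) a O ent (F (l + 1)) c \<noteq> {}" for a c
    proof -
      obtain i j where "(i, j) \<in> ent (M l) a" using ne by blast
      then obtain c' d where cd: "\<kappa> a = Some (c', d)" using dom by blast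
      have "q (2 * (l + 1)) d O p (2 * (l + 1) + 1) c \<noteq> {}"
        using ne unfolding square[OF cd] by (auto simp: eval_nat_numeral)
      then obtain a' where "\<kappa>' a' = Some (d, c)" unfolding qp by blast
      then show ?thesis using cd by blast
    qed
    show "\<exists>a c d. \<kappa> a = Some (c', d) \<and> \<kappa>' a' = Some (d, c)"
      if ne: "ent (F l) c' O ent (M' (l + 1)) a' \<noteq> {}" for c' a'
    proof -
      obtain i j where "(i, j) \<in> ent (M' (l + 1)) a'" using ne by blast
      then obtain d c where dc: "\<kappa>' a' = Some (d, c)" using dom' by blast
      \<comment> \<open>Moving \<open>y\<close> across \<open>q\<close> uncovers \<open>p q\<close>
        at level \<open>2 * l\<close>, that is, an edge of \<open>M l\<close>, and so the letter
        \<open>a\<close>.\<close>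
      have "p (2 * l) c' O (y (2 * l + 1) O q (2 * l + 1 + 1) d) O p (2 * l + 3) c \<noteq> {}"
        using ne unfolding square'[OF dc] by (auto simp: eval_nat_numeral)
      then have "p (2 * l) c' O q (2 * l + 1) d \<noteq> {}" unfolding yq by blast
      then obtain a where "\<kappa> a = Some (c', d)" unfolding pq by blast
      then show ?thesis using dc by blast
    qed
  qed
qed

section \<open>Chains of steps\<close>

text \<open>Every step of the chain climbs one level, so consecutive factors of the product sit at
  consecutive levels.\<close>

fun levels :: "(nat \<Rightarrow> 'a smat) list \<Rightarrow> nat \<Rightarrow> 'a smat list" where
  "levels [] l = []"
| "levels (F # Fs) l = F l # levels Fs (Suc l)"

text \<open>The letter relations of \<open>word_prod (levels Fs l)\<close>, extended by the identity
  for the empty list. This lets inductions start with no factor at all, for which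
  \<open>word_prod\<close> has no value.\<close>

fun word_rel :: "(nat \<Rightarrow> 'a smat) list \<Rightarrow> nat \<Rightarrow> 'a list \<Rightarrow> (nat \<times> nat) set" where
  "word_rel [] l [] = Id"
| "word_rel (F # Fs) l (a # w) = ent (F l) a O word_rel Fs (Suc l) w"
| "word_rel _ l _ = {}"

lemma levels_map_upt:
  "levels (map F [a..<a + n]) l = map (\<lambda>j. F j (l + (j - a))) [a..<a + n]"
proof (induction n arbitrary: a l)
  case (Suc n)
  have "levels (map F [a..<a + Suc n]) l = F a l # levels (map F [Suc a..<Suc a + n]) (Suc l)"
    by (simp add: upt_conv_Cons del: upt_Suc)
  also have "levels (map F [Suc a..<Suc a + n]) (Suc l) = map (\<lambda>j. F j (Suc l + (j - Suc a))) [Suc a..<Suc a + n]"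
    by (rule Suc.IH)
  also have "\<dots> = map (\<lambda>j. F j (l + (j - a))) [Suc a..<Suc a + n]"
  proof (rule map_cong[OF refl])
    fix x assume "x \<in> set [Suc a..<Suc a + n]"
    then have "Suc l + (x - Suc a) = l + (x - a)" by auto
    then show "F x (Suc l + (x - Suc a)) = F x (l + (x - a))" by (rule arg_cong)
  qed
  finally show ?case by (simp add: upt_conv_Cons del: upt_Suc)
qed simp

lemma ent_map_mat_inj:
  assumes "inj f"
  shows "ent (map_mat (image_mset f) A) (f a) = ent A a"
    and "b \<notin> range f \<Longrightarrow> ent (map_mat (image_mset f) A) b = {}"
proof -
  have *: "(i, j) \<in> ent (map_mat (image_mset f) A) b \<longleftrightarrow> (\<exists>a. f a = b \<and> (i, j) \<in> ent A a)" for b i j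
  proof (cases "i < dim_row A \<and> j < dim_col A")
    case True
    then show ?thesis using ent_map_mat[of i A j f b] by simp
  qed (auto dest!: ent_bounds)
  show "ent (map_mat (image_mset f) A) (f a) = ent A a"
    using * assms by (auto dest: injD)
  show "ent (map_mat (image_mset f) A) b = {}" if "b \<notin> range f"
    using * that by auto
qed

text \<open>\<open>d i l\<close> is the number of vertices at level \<open>l\<close> before the
  factor number \<open>i\<close>; the tail of the list is treated with the shifted family
  \<open>d (Suc i)\<close>.\<close>

lemma word_prod_levels:
  assumes "Fs \<noteq> []"
    and "\<And>i l. i < length Fs \<Longrightarrow> (Fs ! i) l \<in> carrier_mat (d i l) (d (Suc i) (Suc l)) \<and> resolving ((Fs ! i) l)"
  shows "word_prod (levels Fs l) \<in> carrier_mat (d 0 l) (d (length Fs) (l + length Fs)) \<and>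
    resolving (word_prod (levels Fs l)) \<and> (\<forall>w. ent (word_prod (levels Fs l)) w = word_rel Fs l w)"
  using assms
proof (induction Fs arbitrary: d l)
  case (Cons F Fs)
  have F: "F l \<in> carrier_mat (d 0 l) (d (Suc 0) (Suc l))" "resolving (F l)"
    using Cons.prems(2)[of 0 l] by auto
  show ?case
  proof (cases "Fs = []")
    case True
    let ?f = "\<lambda>a :: 'a. [a]"
    have inj: "inj ?f" by (simp add: inj_def)
    have e: "word_prod (levels (F # Fs) l) = map_mat (image_mset ?f) (F l)" using True by simp
    have "ent (map_mat (image_mset ?f) (F l)) w = word_rel (F # Fs) l w" for w
    proof (cases "w \<in> range ?f")
      case t: True
      then obtain a where "w = [a]" by auto
      then show ?thesis using ent_map_mat_inj(1)[OF inj, of "F l" a] True by simp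
    next
      case False
      \<comment> \<open>A word of length other than 1 is not read by a single factor, so both sides
        are empty.\<close>
      then have "word_rel (F # Fs) l w = {}" using True by (cases w rule: remdups_adj.cases) auto
      then show ?thesis using ent_map_mat_inj(2)[OF inj False] by simp
    qed
    moreover have "resolving (map_mat (image_mset ?f) (F l))"
      by (rule resolving_map_mat[OF F(2)]) (simp add: inj_on_def)
    ultimately show ?thesis unfolding e using F(1) True by simp
  next
    case False
    then obtain G Gs where Fs: "Fs = G # Gs" by (cases Fs) auto
    let ?f = "\<lambda>(a :: 'a, w). a # w"
    let ?W = "word_prod (levels Fs (Suc l))"
    have inj: "inj ?f" by (auto simp: inj_def)
    have IH: "?W \<in> carrier_mat (d (Suc 0) (Suc l)) (d (Suc (length Fs)) (Suc l + length Fs))"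
      "resolving ?W" "\<And>w. ent ?W w = word_rel Fs (Suc l) w"
      using Cons.IH[OF False, of "\<lambda>i. d (Suc i)" "Suc l"] Cons.prems(2)[of "Suc _"] by auto
    have e: "word_prod (levels (F # Fs) l) = map_mat (image_mset ?f) (F l \<odot> ?W)" by (simp add: Fs)
    have dims: "dim_col (F l) = dim_row ?W" using F(1) IH(1) by auto
    have "ent (map_mat (image_mset ?f) (F l \<odot> ?W)) w = word_rel (F # Fs) l w" for w
    proof (cases w)
      case Nil
      then have "w \<notin> range ?f" by auto
      then show ?thesis using ent_map_mat_inj(2)[OF inj] Nil by simp
    next
      case (Cons a v)
      then show ?thesis using ent_map_mat_inj(1)[OF inj, of "F l \<odot> ?W" "(a, v)"] ent_smat_mult[OF dims] IH(3)
        by simp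
    qed
    moreover have "resolving (map_mat (image_mset ?f) (F l \<odot> ?W))"
      by (rule resolving_map_mat[OF resolving_smat_mult[OF F(2) IH(2) dims]]) (use inj in \<open>auto simp: inj_on_def\<close>)
    moreover have "map_mat (image_mset ?f) (F l \<odot> ?W) \<in> carrier_mat (d 0 l) (d (length (F # Fs)) (l + length (F # Fs)))"
      using F(1) IH(1) by (intro carrier_matI) auto
    ultimately show ?thesis unfolding e by blast
  qed
qed simp

section \<open>Passing a letter through the steps of a chain\<close>

lemma spec_inv_iff:
  assumes "inj_on \<kappa> (dom \<kappa>)"
  shows "spec_inv \<kappa> b = Some a \<longleftrightarrow> \<kappa> a = Some b"
proof -
  have "(THE a. \<kappa> a = Some b) = a'" if "\<kappa> a' = Some b" for a'
    using that by (rule the_equality) (metis assms domI inj_onD that)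
  then show ?thesis unfolding spec_inv_def ran_def by auto
qed

text \<open>Reading the inverse of \<open>\<kappa>\<^sub>1\<close> backwards gives a relational form
  that can be used in both directions.\<close>

lemma kappa_P_list_Cons:
  assumes "inj_on \<kappa>\<^sub>1 (dom \<kappa>\<^sub>1)"
  shows "kappa_P_list ((\<kappa>\<^sub>0, \<kappa>\<^sub>1) # \<kappa>s) (a, cs) = Some (cs', b) \<longleftrightarrow>
    (\<exists>c c' d a' cs0 cs0'. cs = c # cs0 \<and> cs' = c' # cs0' \<and> \<kappa>\<^sub>0 a = Some (c', d) \<and> \<kappa>\<^sub>1 a' = Some (d, c) \<and>
      kappa_P_list \<kappa>s (a', cs0) = Some (cs0', b))"
  by (cases cs) (auto simp: Option.bind_eq_Some_conv spec_inv_iff[OF assms])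

lemma kappa_P_list_Nil: "kappa_P_list [] (a, cs) = Some (cs', b) \<longleftrightarrow> cs = [] \<and> cs' = [] \<and> a = b"
  by (cases cs) auto

text \<open>Step \<open>Suc j\<close> leads from system \<open>j\<close> to system
  \<open>Suc j\<close>. The results concern segments of \<open>n\<close> steps after system
  \<open>j\<close>, because the inductions cut off the first step.\<close>

locale textile_chain =
  fixes N :: nat and m :: "nat \<Rightarrow> nat \<Rightarrow> nat" and Ss :: "nat \<Rightarrow> 'a set"
    and Ms :: "nat \<Rightarrow> nat \<Rightarrow> 'a smat" and Is :: "nat \<Rightarrow> nat \<Rightarrow> nat mat" and C :: "nat \<Rightarrow> 'c set"
    and D :: "nat \<Rightarrow> 'd set"
    and \<kappa>\<^sub>0 :: "nat \<Rightarrow> 'a \<rightharpoonup> 'c \<times> 'd" and \<kappa>\<^sub>1 :: "nat \<Rightarrow> 'a \<rightharpoonup> 'd \<times> 'c" and F :: "nat \<Rightarrow> nat \<Rightarrow> 'c smat"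
  assumes step: "\<And>j. j < N \<Longrightarrow>
      textile_step (m j) (Ms j) (Is j) (m (Suc j)) (Ms (Suc j)) (Is (Suc j)) (C (Suc j)) (\<kappa>\<^sub>0 (Suc j)) (\<kappa>\<^sub>1 (Suc j)) (F (Suc j))"
    and spec0: "\<And>j. j < N \<Longrightarrow> specification_map (Ss j) (C (Suc j) \<times> D (Suc j)) (\<kappa>\<^sub>0 (Suc j))"
    and spec1: "\<And>j. j < N \<Longrightarrow> specification_map (Ss (Suc j)) (D (Suc j) \<times> C (Suc j)) (\<kappa>\<^sub>1 (Suc j))"
begin

abbreviation \<kappa>s :: "nat \<Rightarrow> nat \<Rightarrow> (('a \<rightharpoonup> 'c \<times> 'd) \<times> ('a \<rightharpoonup> 'd \<times> 'c)) list" where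
  "\<kappa>s j n \<equiv> map (\<lambda>j. (\<kappa>\<^sub>0 j, \<kappa>\<^sub>1 j)) [Suc j..<Suc j + n]"

abbreviation Fs :: "nat \<Rightarrow> nat \<Rightarrow> (nat \<Rightarrow> 'c smat) list" where
  "Fs j n \<equiv> map F [Suc j..<Suc j + n]"

lemma Cons_eqs:
  "\<kappa>s j (Suc n) = (\<kappa>\<^sub>0 (Suc j), \<kappa>\<^sub>1 (Suc j)) # \<kappa>s (Suc j) n"
  "Fs j (Suc n) = F (Suc j) # Fs (Suc j) n"
  "map C [Suc j..<Suc j + Suc n] = C (Suc j) # map C [Suc (Suc j)..<Suc (Suc j) + n]"
  by (simp_all add: upt_conv_Cons del: upt_Suc)

lemma inj0: "j < N \<Longrightarrow> inj_on (\<kappa>\<^sub>0 (Suc j)) (dom (\<kappa>\<^sub>0 (Suc j)))"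
  using spec0 by (simp add: specification_map_def)

lemma inj1: "j < N \<Longrightarrow> inj_on (\<kappa>\<^sub>1 (Suc j)) (dom (\<kappa>\<^sub>1 (Suc j)))"
  using spec1 by (simp add: specification_map_def)

lemma stepD:
  assumes "j < N"
  shows "F (Suc j) l \<in> carrier_mat (m j l) (m (Suc j) (Suc l))"
    "symbols (F (Suc j) l) \<subseteq> C (Suc j)" "resolving (F (Suc j) l)"
    "full (ent (F (Suc j) l)) (m j l) (m (Suc j) (Suc l))"
    "supp (Is j l) O ent (F (Suc j) (Suc l)) c = ent (F (Suc j) l) c O supp (Is (Suc j) (Suc l))"
    "\<kappa>\<^sub>0 (Suc j) a = Some (c', d) \<Longrightarrow> \<kappa>\<^sub>1 (Suc j) a' = Some (d, c) \<Longrightarrow>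
      ent (Ms j l) a O ent (F (Suc j) (Suc l)) c = ent (F (Suc j) l) c' O ent (Ms (Suc j) (Suc l)) a'"
    "ent (Ms j l) a O ent (F (Suc j) (Suc l)) c \<noteq> {} \<Longrightarrow>
      \<exists>c' d a'. \<kappa>\<^sub>0 (Suc j) a = Some (c', d) \<and> \<kappa>\<^sub>1 (Suc j) a' = Some (d, c)"
    "ent (F (Suc j) l) c' O ent (Ms (Suc j) (Suc l)) a' \<noteq> {} \<Longrightarrow>
      \<exists>a c d. \<kappa>\<^sub>0 (Suc j) a = Some (c', d) \<and> \<kappa>\<^sub>1 (Suc j) a' = Some (d, c)"
  using step[OF assms] unfolding textile_step_def Suc_eq_plus1[symmetric]
  by - ((elim allE conjE, assumption) | (elim allE[of _ l] conjE, blast))+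

lemma word_rel_subset:
  "j + n \<le> N \<Longrightarrow> word_rel (Fs j n) l w \<noteq> {} \<Longrightarrow> w \<in> listset (map C [Suc j..<Suc j + n])"
proof (induction n arbitrary: j l w)
  case 0
  then show ?case by (cases w) auto
next
  case (Suc n)
  from Suc.prems obtain c v where w: "w = c # v" unfolding Cons_eqs by (cases w) auto
  have "ent (F (Suc j) l) c \<noteq> {}" "word_rel (Fs (Suc j) n) (Suc l) v \<noteq> {}"
    using Suc.prems(2) unfolding Cons_eqs w by (auto simp del: upt_Suc)
  then have "c \<in> C (Suc j)" "v \<in> listset (map C [Suc (Suc j)..<Suc (Suc j) + n])"
    using stepD(2)[of j l] Suc.IH[of "Suc j" "Suc l" v] Suc.prems(1)
    by (simp_all del: upt_Suc add: subset_eq symbols_iff)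
  then show ?case unfolding Cons_eqs w by (auto simp: set_Cons_def simp del: upt_Suc)
qed

text \<open>The segment has at least one step, as the identity relation of the empty segment is
  unbounded.\<close>

lemma word_rel_bounds:
  "j + Suc n \<le> N \<Longrightarrow> word_rel (Fs j (Suc n)) l w \<subseteq> {..<m j l} \<times> {..<m (j + Suc n) (l + Suc n)}"
proof (induction n arbitrary: j l w)
  case 0
  have "ent (F (Suc j) l) c \<subseteq> {..<m j l} \<times> {..<m (Suc j) (Suc l)}" for c
    using stepD(1)[of j l] 0 by (auto dest!: ent_bounds)
  then show ?case by (cases w rule: remdups_adj.cases) auto
next
  case (Suc n)
  have F: "ent (F (Suc j) l) c \<subseteq> {..<m j l} \<times> {..<m (Suc j) (Suc l)}" for c
    using stepD(1)[of j l] Suc.prems by (auto dest!: ent_bounds)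
  have IH: "word_rel (Fs (Suc j) (Suc n)) (Suc l) v \<subseteq> {..<m (Suc j) (Suc l)} \<times> {..<m (Suc j + Suc n) (Suc l + Suc n)}" for v
    using Suc.IH[of "Suc j" "Suc l" v] Suc.prems by (simp del: upt_Suc)
  show ?case
  proof (cases w)
    case Nil
    then show ?thesis unfolding Cons_eqs(2)[of j "Suc n"] by (simp del: upt_Suc)
  next
    case (Cons c v)
    have "word_rel (Fs j (Suc (Suc n))) l w = ent (F (Suc j) l) c O word_rel (Fs (Suc j) (Suc n)) (Suc l) v"
      unfolding Cons_eqs(2)[of j "Suc n"] Cons by (simp del: upt_Suc)
    then show ?thesis using F[of c] IH[of v] by auto
  qed
qed

lemma word_rel_full:
  "j + Suc n \<le> N \<Longrightarrow> full (word_rel (Fs j (Suc n)) l) (m j l) (m (j + Suc n) (l + Suc n))"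
proof (induction n arbitrary: j l)
  case 0
  have e: "word_rel (Fs j (Suc 0)) l [c] = ent (F (Suc j) l) c" for c by simp
  have "full (ent (F (Suc j) l)) (m j l) (m (Suc j) (Suc l))" using stepD(4)[of j l] 0 by simp
  then show ?case unfolding full_def e[symmetric] by (simp del: upt_Suc) blast
next
  case (Suc n)
  have F: "ent (F (Suc j) l) c \<subseteq> {..<m j l} \<times> {..<m (Suc j) (Suc l)}" for c
    using stepD(1)[of j l] Suc.prems by (auto dest!: ent_bounds)
  have F': "full (ent (F (Suc j) l)) (m j l) (m (Suc j) (Suc l))" using stepD(4)[of j l] Suc.prems by simp
  have IH: "word_rel (Fs (Suc j) (Suc n)) (Suc l) v \<subseteq> {..<m (Suc j) (Suc l)} \<times> {..<m (Suc j + Suc n) (Suc l + Suc n)}" for v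
    using word_rel_bounds[of "Suc j" n "Suc l" v] Suc.prems by (simp del: upt_Suc)
  have IH': "full (word_rel (Fs (Suc j) (Suc n)) (Suc l)) (m (Suc j) (Suc l)) (m (Suc j + Suc n) (Suc l + Suc n))"
    using Suc.IH[of "Suc j" "Suc l"] Suc.prems by (simp del: upt_Suc)
  have "full (\<lambda>(c, v). ent (F (Suc j) l) c O word_rel (Fs (Suc j) (Suc n)) (Suc l) v)
      (m j l) (m (Suc j + Suc n) (Suc l + Suc n))"
    by (rule full_comp[OF F' IH' F IH])
  moreover have "word_rel (Fs j (Suc (Suc n))) l (c # v) =
      ent (F (Suc j) l) c O word_rel (Fs (Suc j) (Suc n)) (Suc l) v" for c v
    unfolding Cons_eqs(2)[of j "Suc n"] by (simp del: upt_Suc)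
  ultimately have "full (\<lambda>(c, v). word_rel (Fs j (Suc (Suc n))) l (c # v))
      (m j l) (m (j + Suc (Suc n)) (l + Suc (Suc n)))" by (simp del: upt_Suc)
  then show ?case unfolding full_def by (simp del: upt_Suc) blast
qed

lemma word_rel_intertwine:
  "j + n \<le> N \<Longrightarrow> supp (Is j l) O word_rel (Fs j n) (Suc l) w = word_rel (Fs j n) l w O supp (Is (j + n) (l + n))"
proof (induction n arbitrary: j l w)
  case 0
  then show ?case by (cases w) auto
next
  case (Suc n)
  show ?case
  proof (cases w)
    case Nil
    then show ?thesis unfolding Cons_eqs by (simp del: upt_Suc)
  next
    case (Cons c v)
    have "supp (Is j l) O word_rel (Fs j (Suc n)) (Suc l) w =
        (supp (Is j l) O ent (F (Suc j) (Suc l)) c) O word_rel (Fs (Suc j) n) (Suc (Suc l)) v"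
      unfolding Cons_eqs Cons by (simp add: O_assoc del: upt_Suc)
    also have "\<dots> = ent (F (Suc j) l) c O (supp (Is (Suc j) (Suc l)) O word_rel (Fs (Suc j) n) (Suc (Suc l)) v)"
      using stepD(5)[of j] Suc.prems by (simp add: O_assoc del: upt_Suc)
    also have "\<dots> = word_rel (Fs j (Suc n)) l w O supp (Is (j + Suc n) (l + Suc n))"
      using Suc.IH[of "Suc j" "Suc l" v] Suc.prems unfolding Cons_eqs Cons by (simp add: O_assoc del: upt_Suc)
    finally show ?thesis .
  qed
qed

text \<open>The letter \<open>a\<close> is moved to the right through one factor at a time, turning
  into the letter of the next system; \<open>kappa_P_list\<close> records the letters that change on
  the way.\<close>

lemma word_rel_square:
  "j + n \<le> N \<Longrightarrow> kappa_P_list (\<kappa>s j n) (a, cs) = Some (cs', b) \<Longrightarrow>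
    ent (Ms j l) a O word_rel (Fs j n) (Suc l) cs = word_rel (Fs j n) l cs' O ent (Ms (j + n) (l + n)) b"
proof (induction n arbitrary: j l a cs cs')
  case 0
  then have "cs = []" "cs' = []" "a = b" by (simp_all add: kappa_P_list_Nil)
  then show ?case by simp
next
  case (Suc n)
  have j: "j < N" using Suc.prems by simp
  obtain c c' d a' cs0 cs0' where *: "cs = c # cs0" "cs' = c' # cs0'" "\<kappa>\<^sub>0 (Suc j) a = Some (c', d)"
    "\<kappa>\<^sub>1 (Suc j) a' = Some (d, c)" "kappa_P_list (\<kappa>s (Suc j) n) (a', cs0) = Some (cs0', b)"
    using Suc.prems(2) unfolding Cons_eqs kappa_P_list_Cons[OF inj1[OF j]] by blast
  have "ent (Ms j l) a O word_rel (Fs j (Suc n)) (Suc l) cs =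
      (ent (Ms j l) a O ent (F (Suc j) (Suc l)) c) O word_rel (Fs (Suc j) n) (Suc (Suc l)) cs0"
    unfolding Cons_eqs *(1) by (simp add: O_assoc del: upt_Suc)
  also have "\<dots> = ent (F (Suc j) l) c' O (ent (Ms (Suc j) (Suc l)) a' O word_rel (Fs (Suc j) n) (Suc (Suc l)) cs0)"
    unfolding stepD(6)[OF j *(3,4)] by (simp add: O_assoc)
  also have "\<dots> = word_rel (Fs j (Suc n)) l cs' O ent (Ms (j + Suc n) (l + Suc n)) b"
    using Suc.IH[OF _ *(5), of "Suc l"] Suc.prems unfolding Cons_eqs *(2) by (simp add: O_assoc del: upt_Suc)
  finally show ?case .
qed

lemma word_rel_square_ex1:
  "j + n \<le> N \<Longrightarrow> ent (Ms j l) a O word_rel (Fs j n) (Suc l) cs \<noteq> {} \<Longrightarrow>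
    \<exists>cs' b. kappa_P_list (\<kappa>s j n) (a, cs) = Some (cs', b)"
proof (induction n arbitrary: j l a cs)
  case 0
  then show ?case by (cases cs) auto
next
  case (Suc n)
  have j: "j < N" using Suc.prems by simp
  obtain c cs0 where cs: "cs = c # cs0" using Suc.prems(2) unfolding Cons_eqs by (cases cs) auto
  have ne: "(ent (Ms j l) a O ent (F (Suc j) (Suc l)) c) O word_rel (Fs (Suc j) n) (Suc (Suc l)) cs0 \<noteq> {}"
    using Suc.prems(2) unfolding Cons_eqs cs by (simp add: O_assoc del: upt_Suc)
  then have "ent (Ms j l) a O ent (F (Suc j) (Suc l)) c \<noteq> {}" by blast
  then obtain c' d a' where *: "\<kappa>\<^sub>0 (Suc j) a = Some (c', d)" "\<kappa>\<^sub>1 (Suc j) a' = Some (d, c)"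
    using stepD(7)[OF j] by blast
  have "ent (Ms (Suc j) (Suc l)) a' O word_rel (Fs (Suc j) n) (Suc (Suc l)) cs0 \<noteq> {}"
    using ne unfolding stepD(6)[OF j *] by blast
  then have "\<exists>cs0' b. kappa_P_list (\<kappa>s (Suc j) n) (a', cs0) = Some (cs0', b)"
    by (rule Suc.IH[rotated]) (use Suc.prems(1) in simp)
  then obtain cs0' b where "kappa_P_list (\<kappa>s (Suc j) n) (a', cs0) = Some (cs0', b)" by blast
  then show ?case using * unfolding Cons_eqs kappa_P_list_Cons[OF inj1[OF j]] cs by blast
qed

text \<open>The known letter \<open>b\<close> stands at the far end, so the tail of the chain is
  resolved before its first step.\<close>

lemma word_rel_square_ex2:
  "j + n \<le> N \<Longrightarrow> word_rel (Fs j n) l cs' O ent (Ms (j + n) (l + n)) b \<noteq> {} \<Longrightarrow>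
    \<exists>a cs. kappa_P_list (\<kappa>s j n) (a, cs) = Some (cs', b)"
proof (induction n arbitrary: j l cs')
  case 0
  then have "cs' = []" by (cases cs') auto
  then have "kappa_P_list (\<kappa>s j 0) (b, []) = Some (cs', b)" by simp
  then show ?case by blast
next
  case (Suc n)
  have j: "j < N" using Suc.prems by simp
  obtain c' cs0' where cs': "cs' = c' # cs0'" using Suc.prems(2) unfolding Cons_eqs by (cases cs') auto
  have ne: "ent (F (Suc j) l) c' O (word_rel (Fs (Suc j) n) (Suc l) cs0' O ent (Ms (Suc j + n) (Suc l + n)) b) \<noteq> {}"
    using Suc.prems(2) unfolding Cons_eqs cs' by (simp add: O_assoc del: upt_Suc)
  then have "word_rel (Fs (Suc j) n) (Suc l) cs0' O ent (Ms (Suc j + n) (Suc l + n)) b \<noteq> {}" by blast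
  then have "\<exists>a' cs0. kappa_P_list (\<kappa>s (Suc j) n) (a', cs0) = Some (cs0', b)"
    by (rule Suc.IH[rotated]) (use Suc.prems(1) in simp)
  then obtain a' cs0 where *: "kappa_P_list (\<kappa>s (Suc j) n) (a', cs0) = Some (cs0', b)" by blast
  have "ent (F (Suc j) l) c' O ent (Ms (Suc j) (Suc l)) a' \<noteq> {}"
  proof -
    have "Suc j + n \<le> N" using Suc.prems(1) by simp
    then have "ent (F (Suc j) l) c' O (ent (Ms (Suc j) (Suc l)) a' O word_rel (Fs (Suc j) n) (Suc (Suc l)) cs0) \<noteq> {}"
      using ne word_rel_square[OF _ *, of "Suc l"] by simp
    then show ?thesis by blast
  qed
  then obtain a c d where "\<kappa>\<^sub>0 (Suc j) a = Some (c', d)" "\<kappa>\<^sub>1 (Suc j) a' = Some (d, c)"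
    using stepD(8)[OF j] by blast
  then show ?case using * unfolding Cons_eqs kappa_P_list_Cons[OF inj1[OF j]] cs' by blast
qed

text \<open>At least one step is required: with none, \<open>kappa_P_list\<close> fixes every
  letter, also those outside the alphabet.\<close>

lemma kappa_P_list_carrier:
  "j + n \<le> N \<Longrightarrow> 0 < n \<Longrightarrow> kappa_P_list (\<kappa>s j n) (a, cs) = Some (cs', b) \<Longrightarrow>
    a \<in> Ss j \<and> b \<in> Ss (j + n) \<and> cs \<in> listset (map C [Suc j..<Suc j + n]) \<and> cs' \<in> listset (map C [Suc j..<Suc j + n])"
proof (induction n arbitrary: j a cs cs')
  case (Suc n)
  have j: "j < N" using Suc.prems by simp
  obtain c c' d a' cs0 cs0' where *: "cs = c # cs0" "cs' = c' # cs0'" "\<kappa>\<^sub>0 (Suc j) a = Some (c', d)"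
    "\<kappa>\<^sub>1 (Suc j) a' = Some (d, c)" "kappa_P_list (\<kappa>s (Suc j) n) (a', cs0) = Some (cs0', b)"
    using Suc.prems(3) unfolding Cons_eqs kappa_P_list_Cons[OF inj1[OF j]] by blast
  have 0: "a \<in> Ss j" "c' \<in> C (Suc j)" "a' \<in> Ss (Suc j)" "c \<in> C (Suc j)"
    using spec0[OF j] spec1[OF j] *(3,4) unfolding specification_map_def by (auto simp: ranI)
      (meson SigmaD1 SigmaD2 domI ranI subsetD)+
  have "b \<in> Ss (Suc j + n) \<and> cs0 \<in> listset (map C [Suc (Suc j)..<Suc (Suc j) + n]) \<and>
    cs0' \<in> listset (map C [Suc (Suc j)..<Suc (Suc j) + n])"
  proof (cases "n = 0")
    case True
    then show ?thesis using *(5) 0 by (simp add: kappa_P_list_Nil)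
  next
    case False
    then show ?thesis using Suc.IH[OF _ _ *(5)] Suc.prems(1) by simp
  qed
  then show ?case using 0 * unfolding Cons_eqs by (auto simp: set_Cons_def simp del: upt_Suc)
qed simp

text \<open>Read from the end: the tail determines \<open>a'\<close>, then
  \<open>\<kappa>\<^sub>1 a'\<close> gives \<open>d\<close> and \<open>c\<close>, and injectivity of
  \<open>\<kappa>\<^sub>0\<close> recovers \<open>a\<close> from \<open>c'\<close> and
  \<open>d\<close>.\<close>

lemma kappa_P_list_inj:
  "j + n \<le> N \<Longrightarrow> kappa_P_list (\<kappa>s j n) (a, cs) = Some (cs', b) \<Longrightarrow>
    kappa_P_list (\<kappa>s j n) (a2, cs2) = Some (cs', b) \<Longrightarrow> a = a2 \<and> cs = cs2"
proof (induction n arbitrary: j a cs cs' a2 cs2)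
  case 0
  then show ?case by (simp add: kappa_P_list_Nil)
next
  case (Suc n)
  have j: "j < N" using Suc.prems by simp
  obtain c c' d a' cs0 cs0' where *: "cs = c # cs0" "cs' = c' # cs0'" "\<kappa>\<^sub>0 (Suc j) a = Some (c', d)"
    "\<kappa>\<^sub>1 (Suc j) a' = Some (d, c)" "kappa_P_list (\<kappa>s (Suc j) n) (a', cs0) = Some (cs0', b)"
    using Suc.prems(2) unfolding Cons_eqs kappa_P_list_Cons[OF inj1[OF j]] by blast
  obtain c2 d2 a2' cs02 where **: "cs2 = c2 # cs02" "\<kappa>\<^sub>0 (Suc j) a2 = Some (c', d2)"
    "\<kappa>\<^sub>1 (Suc j) a2' = Some (d2, c2)" "kappa_P_list (\<kappa>s (Suc j) n) (a2', cs02) = Some (cs0', b)"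
    using Suc.prems(3) *(2) unfolding Cons_eqs kappa_P_list_Cons[OF inj1[OF j]] by blast
  have "a' = a2' \<and> cs0 = cs02" using Suc.IH[OF _ *(5) **(4)] Suc.prems(1) by simp
  then have e: "a' = a2'" "cs0 = cs02" by simp_all
  then have "d = d2" "c = c2" using *(4) **(3) by simp_all
  moreover have "a = a2" using *(3) **(2) \<open>d = d2\<close> inj0[OF j] by (metis domI inj_onD)
  ultimately show ?case using e * ** by simp
qed

end

section \<open>Powers of a symbolic matrix system\<close>

fun path_rel :: "(nat \<Rightarrow> 'a smat) \<Rightarrow> nat \<Rightarrow> 'a list \<Rightarrow> (nat \<times> nat) set" where
  "path_rel M l [] = Id"
| "path_rel M l (a # w) = ent (M l) a O path_rel M (Suc l) w"

text \<open>The graph of the \<open>t\<close>-fold map \<iota> from level \<open>s + t\<close> down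
  to level \<open>s\<close>, with the lower vertex as first component.\<close>

primrec iota_rel :: "(nat \<Rightarrow> nat mat) \<Rightarrow> nat \<Rightarrow> nat \<Rightarrow> (nat \<times> nat) set" where
  "iota_rel I s 0 = Id"
| "iota_rel I s (Suc t) = iota_rel I s t O supp (I (s + t))"


lemma iota_rel_add: "iota_rel I s (t + u) = iota_rel I s t O iota_rel I (s + t) u"
  by (induction u) (auto simp: O_assoc add.assoc)

lemma iota_rel_Suc_left: "supp (I s) O iota_rel I (Suc s) t = iota_rel I s (Suc t)"
  using iota_rel_add[of I s 1 t] by simp

text \<open>\<open>p\<close> is the number of levels that \<open>E\<close> climbs: 1 for
  \<open>M\<close>, the word length for paths, \<open>N\<close> for a turn of the chain.\<close>

lemma iota_rel_commute:
  assumes "\<And>l. supp (I l) O E (Suc l) = E l O supp (I (l + p))"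
  shows "iota_rel I s t O E (s + t) = E s O iota_rel I (s + p) t"
proof (induction t)
  case (Suc t)
  have "iota_rel I s (Suc t) O E (s + Suc t) = (iota_rel I s t O E (s + t)) O supp (I (s + p + t))"
    using assms[of "s + t"] by (simp add: O_assoc ac_simps)
  also have "\<dots> = E s O iota_rel I (s + p) (Suc t)" unfolding Suc by (simp add: O_assoc)
  finally show ?case .
qed simp

lemma path_rel_append: "path_rel M l (u @ v) = path_rel M l u O path_rel M (l + length u) v"
  by (induction u arbitrary: l) (auto simp: O_assoc)

lemma sms_unique: "sms m S M I \<Longrightarrow> m = (\<lambda>l. dim_row (M l))"
  by (rule ext) (metis smsD(2) carrier_matD(1))

context
  fixes m S and M :: "nat \<Rightarrow> 'a smat" and I
  assumes sms: "sms m S M I"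
begin

lemma ent_bounds_sms: "(i, j) \<in> ent (M l) a \<Longrightarrow> i < m l \<and> j < m (Suc l)"
  using smsD(2)[OF sms, of l] by (auto dest!: ent_bounds)

lemma supp_bounds_sms: "(i, j) \<in> supp (I l) \<Longrightarrow> i < m l \<and> j < m (Suc l)"
  using smsD(4)[OF sms, of l] by (auto simp: in_supp_iff)

lemma supp_ex_right: "i < m l \<Longrightarrow> \<exists>j. (i, j) \<in> supp (I l)"
  using smsD(6)[OF sms] .

lemma supp_ex_left: "j < m (Suc l) \<Longrightarrow> \<exists>i. (i, j) \<in> supp (I l)"
  using col_one_ex[OF smsD(5)[OF sms], of j l] smsD(4)[OF sms, of l] by auto

lemma supp_ent_commute: "supp (I l) O ent (M (Suc l)) a = ent (M l) a O supp (I (l + 1))"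
  using smsD(9)[OF sms, of l a] by simp

lemma iota_rel_right: "(i, j) \<in> iota_rel I s t \<Longrightarrow> i < m s \<Longrightarrow> j < m (s + t)"
  by (induction t arbitrary: j) (auto dest: supp_bounds_sms)

lemma iota_rel_left: "(i, j) \<in> iota_rel I s t \<Longrightarrow> j < m (s + t) \<Longrightarrow> i < m s"
proof (induction t arbitrary: j)
  case (Suc t)
  then obtain k where "(i, k) \<in> iota_rel I s t" "(k, j) \<in> supp (I (s + t))" by auto
  then show ?case using Suc.IH supp_bounds_sms by blast
qed simp

lemma iota_rel_ex_right: "i < m s \<Longrightarrow> \<exists>j. (i, j) \<in> iota_rel I s t"
proof (induction t)
  case (Suc t)
  then obtain k where k: "(i, k) \<in> iota_rel I s t" by blast
  then have "k < m (s + t)" using iota_rel_right Suc.prems by blast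
  then obtain j where "(k, j) \<in> supp (I (s + t))" using supp_ex_right by blast
  then show ?case using k by auto
qed auto

lemma iota_rel_ex_left: "j < m (s + t) \<Longrightarrow> \<exists>i. (i, j) \<in> iota_rel I s t"
proof (induction t arbitrary: j)
  case (Suc t)
  then obtain k where k: "(k, j) \<in> supp (I (s + t))" using supp_ex_left[of j "s + t"] by auto
  then have "k < m (s + t)" using supp_bounds_sms by blast
  then obtain i where "(i, k) \<in> iota_rel I s t" using Suc.IH by blast
  then show ?case using k by auto
qed auto

lemma foldl_iota:
  assumes "A \<in> carrier_mat d (m s)" "col_one A"
  shows "foldl (*) A (map I [s..<s + t]) \<in> carrier_mat d (m (s + t)) \<and>
    col_one (foldl (*) A (map I [s..<s + t])) \<and>
    supp (foldl (*) A (map I [s..<s + t])) = supp A O iota_rel I s t"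
proof (induction t)
  case (Suc t)
  let ?B = "foldl (*) A (map I [s..<s + t])"
  have e: "foldl (*) A (map I [s..<s + Suc t]) = ?B * I (s + t)" by simp
  have I: "I (s + t) \<in> carrier_mat (m (s + t)) (m (s + Suc t))" "col_one (I (s + t))"
    using smsD(4,5)[OF sms, of "s + t"] by simp_all
  then have d: "dim_col ?B = dim_row (I (s + t))"
    using conjunct1[OF Suc.IH] by (metis carrier_matD)
  show ?case unfolding e supp_mult[OF d]
    using Suc I col_one_mult[OF _ I(2) d] by (auto simp: O_assoc)
qed (use assms in simp)

lemma foldl_smat_iota:
  assumes "A \<in> carrier_mat d (m s)" "resolving A"
  shows "foldl (\<odot>\<^sub>r) A (map I [s..<s + t]) \<in> carrier_mat d (m (s + t)) \<and>
    resolving (foldl (\<odot>\<^sub>r) A (map I [s..<s + t])) \<and>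
    (\<forall>a. ent (foldl (\<odot>\<^sub>r) A (map I [s..<s + t])) a = ent A a O iota_rel I s t)"
proof (induction t)
  case (Suc t)
  let ?B = "foldl (\<odot>\<^sub>r) A (map I [s..<s + t])"
  have e: "foldl (\<odot>\<^sub>r) A (map I [s..<s + Suc t]) = ?B \<odot>\<^sub>r I (s + t)" by simp
  have I: "I (s + t) \<in> carrier_mat (m (s + t)) (m (s + Suc t))" "col_one (I (s + t))"
    using smsD(4,5)[OF sms, of "s + t"] by simp_all
  then have d: "dim_col ?B = dim_row (I (s + t))"
    using conjunct1[OF Suc.IH] by (metis carrier_matD)
  have "?B \<odot>\<^sub>r I (s + t) \<in> carrier_mat d (m (s + Suc t))"
    using Suc I by (intro carrier_matI) auto
  then show ?case unfolding e ent_smat_nat_mult[OF d]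
    using Suc resolving_smat_nat_mult[OF _ I(2) d] by (auto simp: O_assoc)
qed (use assms in simp)

lemma path_rel_commute:
  "supp (I l) O path_rel M (Suc l) w = path_rel M l w O supp (I (l + length w))"
proof (induction w arbitrary: l)
  case (Cons a w)
  have "supp (I l) O path_rel M (Suc l) (a # w) = (supp (I l) O ent (M (Suc l)) a) O path_rel M (Suc (Suc l)) w"
    by (simp add: O_assoc)
  also have "\<dots> = ent (M l) a O (supp (I (Suc l)) O path_rel M (Suc (Suc l)) w)"
    unfolding supp_ent_commute by (simp add: O_assoc)
  also have "\<dots> = path_rel M l (a # w) O supp (I (l + length (a # w)))"
    unfolding Cons by (simp add: O_assoc)
  finally show ?case .
qed simp

lemma path_rel_bounds: "(i, j) \<in> path_rel M l w \<Longrightarrow> w \<noteq> [] \<Longrightarrow> i < m l \<and> j < m (l + length w)"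
proof (induction w arbitrary: i l)
  case (Cons a w)
  then obtain k where k: "(i, k) \<in> ent (M l) a" "(k, j) \<in> path_rel M (Suc l) w" by auto
  show ?case
  proof (cases "w = []")
    case True
    then show ?thesis using k ent_bounds_sms by auto
  next
    case False
    then show ?thesis using Cons.IH[OF k(2)] ent_bounds_sms[OF k(1)] by auto
  qed
qed simp

text \<open>Applying \<iota> to all vertices of a path yields a path with the same labels one level
  lower.\<close>

lemma path_rel_descend:
  assumes "path_rel M (l + n) w \<noteq> {}"
  shows "path_rel M l w \<noteq> {}"
  using assms
proof (induction n)
  case (Suc n)
  show ?case
  proof (cases "w = []")
    case False
    obtain i j where ij: "(i, j) \<in> path_rel M (Suc (l + n)) w" using Suc.prems by auto
    then obtain i' where "(i', i) \<in> supp (I (l + n))"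
      using path_rel_bounds[OF ij False] supp_ex_left by blast
    then have "supp (I (l + n)) O path_rel M (Suc (l + n)) w \<noteq> {}" using ij by blast
    then have "path_rel M (l + n) w \<noteq> {}" unfolding path_rel_commute by blast
    then show ?thesis by (rule Suc.IH)
  qed auto
qed simp

text \<open>An edge of the power is an edge of \<open>M\<close> at level \<open>N * l\<close> whose
  terminal is lifted \<open>N - 1\<close> further levels. Every condition follows by moving lifts
  across one edge.\<close>

lemma sms_pow:
  assumes N: "N \<ge> 1"
  shows "supp (I_pow N I l) = iota_rel I (N * l) N" (is ?a)
    and "ent (M_pow N M I l) a = ent (M (N * l)) a O iota_rel I (Suc (N * l)) (N - 1)" (is ?b)
    and "sms (\<lambda>l. m (N * l)) S (M_pow N M I) (I_pow N I)" (is ?c)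
proof -
  have up: "[N * l + 1..<N * (l + 1)] = [Suc (N * l)..<Suc (N * l) + (N - 1)]" for l
    using N by (simp add: add.commute)
  have lN: "Suc (N * l) + (N - 1) = N * Suc l" for l using N by simp
  have I0: "I (N * l) \<in> carrier_mat (m (N * l)) (m (Suc (N * l)))" for l
    using smsD(4)[OF sms] by simp
  have M0: "M (N * l) \<in> carrier_mat (m (N * l)) (m (Suc (N * l)))" for l
    using smsD(2)[OF sms] by simp
  have I1: "I_pow N I l \<in> carrier_mat (m (N * l)) (m (N * Suc l))" "col_one (I_pow N I l)"
    "supp (I_pow N I l) = supp (I (N * l)) O iota_rel I (Suc (N * l)) (N - 1)" for l
    using foldl_iota[OF I0 smsD(5)[OF sms], of l "N - 1"] unfolding I_pow_def up lN by simp_all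
  have M1: "M_pow N M I l \<in> carrier_mat (m (N * l)) (m (N * Suc l))" "resolving (M_pow N M I l)"
    "\<And>a. ent (M_pow N M I l) a = ent (M (N * l)) a O iota_rel I (Suc (N * l)) (N - 1)" for l
    using foldl_smat_iota[OF M0 smsD(8)[OF sms], of l "N - 1"] unfolding M_pow_def up lN by simp_all
  show ?b by (rule M1(3))
  have sI: "supp (I_pow N I l) = iota_rel I (N * l) N" for l
    unfolding I1 iota_rel_Suc_left using N by simp
  then show ?a .
  have "full (ent (M_pow N M I l)) (m (N * l)) (m (N * (l + 1)))" for l
    unfolding full_def
  proof (intro conjI allI impI)
    fix i assume "i < m (N * l)"
    then obtain a k where ak: "(i, k) \<in> ent (M (N * l)) a"
      using smsD(7)[OF sms, of "N * l"] by (auto simp: full_def)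
    then have "k < m (Suc (N * l))" using ent_bounds_sms by blast
    then obtain j where "(k, j) \<in> iota_rel I (Suc (N * l)) (N - 1)" using iota_rel_ex_right by blast
    then show "\<exists>a j. (i, j) \<in> ent (M_pow N M I l) a" unfolding M1(3) using ak by blast
  next
    fix j assume "j < m (N * (l + 1))"
    then have j: "j < m (Suc (N * l) + (N - 1))" unfolding lN by simp
    then obtain k where k: "(k, j) \<in> iota_rel I (Suc (N * l)) (N - 1)" using iota_rel_ex_left by blast
    then have "k < m (N * l + 1)" using iota_rel_left[OF k j] by simp
    then obtain a i where "(i, k) \<in> ent (M (N * l)) a"
      using smsD(7)[OF sms, of "N * l"] by (auto simp: full_def)
    then show "\<exists>a i. (i, j) \<in> ent (M_pow N M I l) a" unfolding M1(3) using k by blast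
  qed
  moreover have "symbols (M_pow N M I l) \<subseteq> S" for l
  proof
    fix a assume "a \<in> symbols (M_pow N M I l)"
    then have "a \<in> symbols (M (N * l))" unfolding symbols_iff M1(3) by blast
    then show "a \<in> S" using smsD(3)[OF sms] by blast
  qed
  moreover have "\<exists>j. (i, j) \<in> supp (I_pow N I l)" if "i < m (N * l)" for i l
    unfolding sI using iota_rel_ex_right[OF that] .
  moreover have "supp (I_pow N I l) O ent (M_pow N M I (l + 1)) a = ent (M_pow N M I l) a O supp (I_pow N I (l + 1))" for l a
  proof -
    have lN': "Suc (N * l) + N = Suc (N * (l + 1))" by simp
    have "supp (I_pow N I l) O ent (M_pow N M I (l + 1)) a =
        (iota_rel I (N * l) N O ent (M (N * l + N)) a) O iota_rel I (Suc (N * (l + 1))) (N - 1)"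
      by (simp add: sI M1(3) O_assoc add.commute)
    also have "iota_rel I (N * l) N O ent (M (N * l + N)) a = ent (M (N * l)) a O iota_rel I (N * l + 1) N"
      by (rule iota_rel_commute) (rule supp_ent_commute)
    also have "\<dots> O iota_rel I (Suc (N * (l + 1))) (N - 1) = ent (M (N * l)) a O iota_rel I (Suc (N * l)) (N + (N - 1))"
      unfolding iota_rel_add lN' by (simp add: O_assoc)
    \<comment> \<open>The \<open>2 N - 1\<close> lifts are regrouped so that the last
      \<open>N\<close> of them form \<open>I_pow\<close> at level \<open>l + 1\<close>.\<close>
    also have "N + (N - 1) = N - 1 + N" by simp
    also have "ent (M (N * l)) a O iota_rel I (Suc (N * l)) (N - 1 + N) = ent (M_pow N M I l) a O supp (I_pow N I (l + 1))"
      unfolding iota_rel_add lN M1(3) sI by (simp add: O_assoc)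
    finally show ?thesis .
  qed
  ultimately show ?c
    unfolding sms_def using I1(1,2) M1(1,2) smsD(1)[OF sms] by simp
qed

text \<open>All lifts between consecutive edges are collected at the end of the path,
  \<open>N - 1\<close> for each letter.\<close>

lemma path_rel_pow:
  assumes N: "N \<ge> 1"
  shows "path_rel (M_pow N M I) l w =
    path_rel M (N * l) w O iota_rel I (N * l + length w) (length w * (N - 1))"
proof (induction w arbitrary: l)
  case (Cons a w)
  let ?E = "\<lambda>l. path_rel M l w"
  have e1: "Suc (N * l) + (N - 1) = N * Suc l" using N by simp
  have e2: "Suc (N * l) + length w + (N - 1) = N * Suc l + length w" using N by simp
  have "path_rel (M_pow N M I) l (a # w) = ent (M (N * l)) a O
      (iota_rel I (Suc (N * l)) (N - 1) O path_rel M (Suc (N * l) + (N - 1)) w) O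
      iota_rel I (N * Suc l + length w) (length w * (N - 1))"
    unfolding path_rel.simps sms_pow(2)[OF N] Cons e1 by (simp add: O_assoc)
  also have "iota_rel I (Suc (N * l)) (N - 1) O path_rel M (Suc (N * l) + (N - 1)) w =
      path_rel M (Suc (N * l)) w O iota_rel I (Suc (N * l) + length w) (N - 1)"
    by (rule iota_rel_commute[where E = ?E]) (rule path_rel_commute)
  also have "ent (M (N * l)) a O (path_rel M (Suc (N * l)) w O iota_rel I (Suc (N * l) + length w) (N - 1)) O
      iota_rel I (N * Suc l + length w) (length w * (N - 1)) =
      path_rel M (N * l) (a # w) O iota_rel I (Suc (N * l) + length w) ((N - 1) + length w * (N - 1))"
    unfolding iota_rel_add e2 by (simp add: O_assoc)
  finally show ?case by simp
qed simp

end

section \<open>Paths, label words and presented subshifts\<close>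

lemma is_path_Nil [simp]: "is_path G l []"
  by (simp add: is_path_def)

lemma is_path_Cons:
  "is_path G l (e # es) \<longleftrightarrow>
     e \<in> edges G l \<and> is_path G (Suc l) es \<and> (es \<noteq> [] \<longrightarrow> tgt G e = src G (hd es))"
proof -
  have "(\<forall>i. i + 1 < length (e # es) \<longrightarrow> tgt G ((e # es) ! i) = src G ((e # es) ! (i + 1))) \<longleftrightarrow>
    (es \<noteq> [] \<longrightarrow> tgt G e = src G (hd es)) \<and> (\<forall>i. i + 1 < length es \<longrightarrow> tgt G (es ! i) = src G (es ! (i + 1)))"
  proof (cases es)
    case (Cons e' es')
    show ?thesis
    proof (intro iffI conjI allI impI)
      fix i assume *: "\<forall>i. i + 1 < length (e # es) \<longrightarrow> tgt G ((e # es) ! i) = src G ((e # es) ! (i + 1))"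
      show "tgt G e = src G (hd es)" using *[rule_format, of 0] Cons by simp
      show "tgt G (es ! i) = src G (es ! (i + 1))" if "i + 1 < length es"
        using *[rule_format, of "Suc i"] that by simp
    next
      fix i assume "(es \<noteq> [] \<longrightarrow> tgt G e = src G (hd es)) \<and> (\<forall>i. i + 1 < length es \<longrightarrow> tgt G (es ! i) = src G (es ! (i + 1)))"
        "i + 1 < length (e # es)"
      then show "tgt G ((e # es) ! i) = src G ((e # es) ! (i + 1))" using Cons by (cases i) auto
    qed
  qed simp
  moreover have "(\<forall>i<length (e # es). (e # es) ! i \<in> edges G (l + i)) \<longleftrightarrow>
    e \<in> edges G l \<and> (\<forall>i<length es. es ! i \<in> edges G (Suc l + i))"
    by (simp add: All_less_Suc2)
  ultimately show ?thesis unfolding is_path_def by blast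
qed

lemma lambda_graph_simps:
  "edges (lambda_graph M I) l = {(i, a, j). (i, j) \<in> ent (M l) a}"
  "src (lambda_graph M I) (i, a, j) = i" "tgt (lambda_graph M I) (i, a, j) = j"
  "lab (lambda_graph M I) (i, a, j) = a"
  by (auto simp: lambda_graph_def ent_def)

lemma lambda_graph_path_iff:
  "(\<exists>es. is_path (lambda_graph M I) l es \<and> map (lab (lambda_graph M I)) es = w) \<longleftrightarrow> path_rel M l w \<noteq> {}"
proof -
  let ?G = "lambda_graph M I"
  \<comment> \<open>The induction glues an edge to a path and has to know where the path starts; the
    empty word has no first edge and is treated apart.\<close>
  have "(\<exists>es. is_path ?G l es \<and> map (lab ?G) es = w \<and> src ?G (hd es) = i) \<longleftrightarrow> (\<exists>j. (i, j) \<in> path_rel M l w)"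
    if "w \<noteq> []" for w i l
    using that
  proof (induction w arbitrary: l i)
    case (Cons a w)
    show ?case
    proof (intro iffI)
      assume "\<exists>es. is_path ?G l es \<and> map (lab ?G) es = a # w \<and> src ?G (hd es) = i"
      then obtain e es where es: "is_path ?G l (e # es)" "lab ?G e = a" "map (lab ?G) es = w" "src ?G e = i"
        by (auto simp: map_eq_Cons_conv)
      then obtain k where e: "e = (i, a, k)" "(i, k) \<in> ent (M l) a"
        by (cases e) (auto simp: is_path_Cons lambda_graph_simps)
      show "\<exists>j. (i, j) \<in> path_rel M l (a # w)"
      proof (cases "w = []")
        case False
        then have "es \<noteq> []" using es by auto
        then have "\<exists>es. is_path ?G (Suc l) es \<and> map (lab ?G) es = w \<and> src ?G (hd es) = k"
          using es e by (auto simp: is_path_Cons lambda_graph_simps)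
        then obtain j where "(k, j) \<in> path_rel M (Suc l) w" using Cons.IH[OF False] by blast
        then show ?thesis using e by auto
      qed (use e in auto)
    next
      assume "\<exists>j. (i, j) \<in> path_rel M l (a # w)"
      then obtain k j where k: "(i, k) \<in> ent (M l) a" "(k, j) \<in> path_rel M (Suc l) w" by auto
      show "\<exists>es. is_path ?G l es \<and> map (lab ?G) es = a # w \<and> src ?G (hd es) = i"
      proof (cases "w = []")
        case True
        then show ?thesis using k by (intro exI[of _ "[(i, a, k)]"]) (simp add: is_path_Cons lambda_graph_simps)
      next
        case False
        then obtain es where "is_path ?G (Suc l) es" "map (lab ?G) es = w" "src ?G (hd es) = k"
          using Cons.IH k(2) by blast
        then show ?thesis using k
          by (intro exI[of _ "(i, a, k) # es"]) (simp add: is_path_Cons lambda_graph_simps)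
      qed
    qed
  qed simp
  then show ?thesis by (cases "w = []") (auto, blast+)
qed

definition window :: "(int \<Rightarrow> 'a) \<Rightarrow> int \<Rightarrow> nat \<Rightarrow> 'a list" where
  "window x i n = map (\<lambda>j. x (i + int j)) [0..<n]"

lemma window_add: "window x i (L + n) = window x i L @ window x (i + int L) n"
proof (rule nth_equalityI)
  show "length (window x i (L + n)) = length (window x i L @ window x (i + int L) n)"
    by (simp add: window_def)
  show "window x i (L + n) ! j = (window x i L @ window x (i + int L) n) ! j"
    if "j < length (window x i (L + n))" for j
    using that by (auto simp: window_def nth_append algebra_simps of_nat_diff)
qed

lemma presented_subshift_lambda_graph_iff:
  "x \<in> presented_subshift (lambda_graph M I) \<longleftrightarrow> (\<forall>i n. \<exists>l. path_rel M l (window x i n) \<noteq> {})"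
  unfolding presented_subshift_def window_def[symmetric] mem_Collect_eq lambda_graph_path_iff ..

text \<open>Reading \<open>l\<close> additional letters on the left pushes the given window to a
  level at least \<open>l\<close>, from which \<open>path_rel_descend\<close> brings it down to
  \<open>l\<close> itself.\<close>

lemma presented_subshift_iff_all_levels:
  assumes "sms m S M I"
  shows "x \<in> presented_subshift (lambda_graph M I) \<longleftrightarrow> (\<forall>i n l. path_rel M l (window x i n) \<noteq> {})"
proof
  assume x: "x \<in> presented_subshift (lambda_graph M I)"
  show "\<forall>i n l. path_rel M l (window x i n) \<noteq> {}"
  proof (intro allI)
    fix i n l
    obtain l0 where "path_rel M l0 (window x (i - int l) (l + n)) \<noteq> {}"
      using x unfolding presented_subshift_lambda_graph_iff by blast
    then have "path_rel M (l + l0) (window x i n) \<noteq> {}"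
      unfolding window_add path_rel_append by (auto simp: window_def add.commute)
    then show "path_rel M l (window x i n) \<noteq> {}" by (rule path_rel_descend[OF assms])
  qed
qed (auto simp: presented_subshift_lambda_graph_iff)

lemma presented_subshift_pow:
  assumes sms: "sms m S M I" and N: "N \<ge> 1"
  shows "presented_subshift (lambda_graph (M_pow N M I) (I_pow N I)) = presented_subshift (lambda_graph M I)"
proof -
  \<comment> \<open>The lifts at the end of a path always exist, so they do not affect which words
    are read.\<close>
  have "path_rel (M_pow N M I) l w \<noteq> {} \<longleftrightarrow> path_rel M (N * l) w \<noteq> {}" for l w
  proof
    assume "path_rel M (N * l) w \<noteq> {}"
    then obtain i j where ij: "(i, j) \<in> path_rel M (N * l) w" by auto
    show "path_rel (M_pow N M I) l w \<noteq> {}"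
    proof (cases "w = []")
      case False
      then have "j < m (N * l + length w)" using path_rel_bounds[OF sms ij] by blast
      then obtain k where "(j, k) \<in> iota_rel I (N * l + length w) (length w * (N - 1))"
        using iota_rel_ex_right[OF sms] by blast
      then show ?thesis unfolding path_rel_pow[OF sms N] using ij by blast
    qed auto
  qed (auto simp: path_rel_pow[OF sms N])
  then have a: "x \<in> presented_subshift (lambda_graph (M_pow N M I) (I_pow N I)) \<longleftrightarrow>
      (\<forall>i n. \<exists>l. path_rel M (N * l) (window x i n) \<noteq> {})" for x
    unfolding presented_subshift_lambda_graph_iff by (simp only:)
  \<comment> \<open>Restricting to multiples of \<open>N\<close> is harmless: a word of a point of
    the subshift is read at every level.\<close>
  have b: "(\<forall>i n. \<exists>l. path_rel M (N * l) (window x i n) \<noteq> {}) \<longleftrightarrow>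
      x \<in> presented_subshift (lambda_graph M I)" for x
    using presented_subshift_iff_all_levels[OF sms, of x] presented_subshift_lambda_graph_iff[of x M I]
    by iprover
  show ?thesis by (rule Set.set_eqI) (rule trans[OF a b])
qed

section \<open>Chains that return to their first system\<close>

lemma finite_listset: "(\<And>A. A \<in> set As \<Longrightarrow> finite A) \<Longrightarrow> finite (listset As)"
proof (induction As)
  case (Cons A As)
  have "set_Cons A (listset As) = (\<lambda>(a, w). a # w) ` (A \<times> listset As)"
    by (auto simp: set_Cons_def)
  then show ?case using Cons by simp
qed simp

text \<open>With equal ends, a word of the whole chain leads from level \<open>l\<close> to level
  \<open>l + N\<close> of the same system. This makes \<iota> and the words of the chain commute in
  the form required by \<open>iota_rel_commute\<close>.\<close>

locale closed_textile_chain = textile_chain N m Ss Ms Is C D \<kappa>\<^sub>0 \<kappa>\<^sub>1 F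
  for N :: nat and m Ss and Ms :: "nat \<Rightarrow> nat \<Rightarrow> 'a smat" and Is
    and C :: "nat \<Rightarrow> 'c set" and D :: "nat \<Rightarrow> 'd set" and \<kappa>\<^sub>0 \<kappa>\<^sub>1 F +
  fixes S :: "'a set" and M :: "nat \<Rightarrow> 'a smat" and I m0
  assumes N: "N \<ge> 1" and sms: "sms m0 S M I"
    and ends: "Ms 0 = M" "Ms N = M" "Is 0 = I" "Is N = I" "Ss 0 = S" "Ss N = S" "m 0 = m0" "m N = m0"
    and fin: "\<And>j. j < N \<Longrightarrow> finite (C (Suc j))"
begin

abbreviation T :: "'c list set" where "T \<equiv> listset (map C [Suc 0..<Suc 0 + N])"
abbreviation W :: "nat \<Rightarrow> 'c list \<Rightarrow> (nat \<times> nat) set" where "W \<equiv> word_rel (Fs 0 N)"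
abbreviation K :: "'a \<times> 'c list \<rightharpoonup> 'c list \<times> 'a" where "K \<equiv> kappa_P_list (\<kappa>s 0 N)"
abbreviation B :: "nat \<Rightarrow> 'c list smat" where "B l \<equiv> word_prod (levels (Fs 0 N) (N * l))"

lemma B_props:
  "B l \<in> carrier_mat (m0 (N * l)) (m0 (N * (l + 1)))" "resolving (B l)" "ent (B l) w = W (N * l) w"
proof -
  have "(Fs 0 N ! i) l \<in> carrier_mat (m i l) (m (Suc i) (Suc l)) \<and> resolving ((Fs 0 N ! i) l)"
    if "i < length (Fs 0 N)" for i l
    using that stepD(1,3)[of i l] by (simp del: upt_Suc)
  then have "B l \<in> carrier_mat (m 0 (N * l)) (m (length (Fs 0 N)) (N * l + length (Fs 0 N))) \<and>
      resolving (B l) \<and> (\<forall>w. ent (B l) w = word_rel (Fs 0 N) (N * l) w)"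
    using N by (intro word_prod_levels) (simp_all del: upt_Suc)
  then show "B l \<in> carrier_mat (m0 (N * l)) (m0 (N * (l + 1)))" "resolving (B l)" "ent (B l) w = W (N * l) w"
    by (simp_all add: ends add.commute del: upt_Suc)
qed

lemma W_commute: "supp (I l) O W (Suc l) w = W l w O supp (I (l + N))"
  using word_rel_intertwine[of 0 N l w] by (simp add: ends del: upt_Suc)

lemma sms_A: "sms (\<lambda>l. m0 (N * l)) S (M_pow N M I) (I_pow N I)"
  by (rule sms_pow(3)[OF sms N])

lemma sms_B: "sms (\<lambda>l. m0 (N * l)) T B (I_pow N I)"
proof -
  have "finite T"
  proof (rule finite_listset)
    fix A assume "A \<in> set (map C [Suc 0..<Suc 0 + N])"
    then obtain j where "A = C j" "1 \<le> j" "j \<le> N" by auto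
    then show "finite A" using fin[of "j - 1"] by simp
  qed
  moreover have "symbols (B l) \<subseteq> T" for l
    by (rule subsetI) (simp only: symbols_iff B_props(3) word_rel_subset[of 0 N] add_0 order_refl)
  moreover have "full (ent (B l)) (m0 (N * l)) (m0 (N * (l + 1)))" for l
  proof -
    have "ent (B l) = W (N * l)" by (rule ext) (rule B_props(3))
    then show ?thesis using word_rel_full[of 0 "N - 1" "N * l"] N by (simp add: ends add.commute del: upt_Suc)
  qed
  moreover have "supp (I_pow N I l) O ent (B (l + 1)) w = ent (B l) w O supp (I_pow N I (l + 1))" for l w
  proof -
    have "supp (I_pow N I l) O ent (B (l + 1)) w = iota_rel I (N * l) N O W (N * l + N) w"
      by (simp only: sms_pow(1)[OF sms N] B_props(3)) (simp add: add.commute del: upt_Suc)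
    also have "\<dots> = W (N * l) w O iota_rel I (N * l + N) N"
      by (rule iota_rel_commute[where E = "\<lambda>l. W l w"]) (rule W_commute)
    also have "\<dots> = ent (B l) w O supp (I_pow N I (l + 1))"
      by (simp only: sms_pow(1)[OF sms N] B_props(3)) (simp add: add.commute del: upt_Suc)
    finally show ?thesis .
  qed
  ultimately show ?thesis
    unfolding sms_def using B_props(1,2) smsD(4,5,6)[OF sms_A] by (simp del: upt_Suc)
qed

lemma specification_map_K: "specification_map (S \<times> T) (T \<times> S) K"
proof -
  have "K (a, cs) = Some (cs', b) \<Longrightarrow> a \<in> S \<and> b \<in> S \<and> cs \<in> T \<and> cs' \<in> T" for a b cs cs'
    using kappa_P_list_carrier[of 0 N a cs cs' b] N by (simp add: ends del: upt_Suc)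
  then have "dom K \<subseteq> S \<times> T" "ran K \<subseteq> T \<times> S"
    unfolding dom_def ran_def by auto
  moreover have "inj_on K (dom K)"
  proof (rule inj_onI)
    fix x y assume *: "x \<in> dom K" "y \<in> dom K" "K x = K y"
    obtain a cs a' cs' where xy: "x = (a, cs)" "y = (a', cs')" by (cases x, cases y)
    obtain z where "K x = Some z" using *(1) by blast
    moreover obtain ds b where "z = (ds, b)" by (cases z)
    ultimately show "x = y" using kappa_P_list_inj[of 0 N a cs ds b a' cs'] * xy by simp
  qed
  ultimately show ?thesis unfolding specification_map_def by blast
qed

text \<open>When the lifts inside \<open>M_pow\<close> are moved to the right end, both products
  finish with the same \<open>N - 1\<close> lifts \<open>?J\<close>. What precedes them is the
  square of the whole chain at level \<open>N * l\<close>.\<close>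

lemma K_equiv: "smat_equiv K (M_pow N M I l \<odot> B (l + 1)) (B l \<odot> M_pow N M I (l + 1))"
proof -
  let ?J = "iota_rel I (Suc (N * l) + N) (N - 1)"
  have dims: "dim_col (M_pow N M I l) = dim_row (B (l + 1))" "dim_col (B l) = dim_row (M_pow N M I (l + 1))"
    using smsD(2)[OF sms_A, of l] smsD(2)[OF sms_A, of "l + 1"] B_props(1)[of l] B_props(1)[of "l + 1"]
    by (metis carrier_matD)+
  have "Suc (N * l) + (N - 1) = N * (l + 1)" using N by simp
  moreover have "iota_rel I (Suc (N * l)) (N - 1) O W (Suc (N * l) + (N - 1)) cs = W (Suc (N * l)) cs O ?J" for cs
    by (rule iota_rel_commute[where E = "\<lambda>l. W l cs"]) (rule W_commute)
  ultimately have AB: "ent (M_pow N M I l \<odot> B (l + 1)) (a, cs) =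
      (ent (Ms 0 (N * l)) a O W (Suc (N * l)) cs) O ?J" for a cs
    by (simp only: ent_smat_mult[OF dims(1)] sms_pow(2)[OF sms N] B_props(3) O_assoc ends)
  have BA: "ent (B l \<odot> M_pow N M I (l + 1)) (cs, b) = (W (N * l) cs O ent (Ms (0 + N) (N * l + N)) b) O ?J" for b cs
  proof -
    have e: "N * (l + 1) = N * l + N" "Suc (N * l + N) = Suc (N * l) + N" by simp_all
    show ?thesis
      by (simp only: ent_smat_mult[OF dims(2)] sms_pow(2)[OF sms N] B_props(3) O_assoc ends add_0 e)
  qed
  show ?thesis
  proof (rule smat_equivI)
    show "resolving (M_pow N M I l \<odot> B (l + 1))" "resolving (B l \<odot> M_pow N M I (l + 1))"
      by (rule resolving_smat_mult smsD(8)[OF sms_A] B_props(2) dims)+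
    show "dim_row (M_pow N M I l \<odot> B (l + 1)) = dim_row (B l \<odot> M_pow N M I (l + 1))"
      using smsD(2)[OF sms_A, of l] B_props(1)[of l] by (simp only: smat_mult_dims) (metis carrier_matD(1))
    show "dim_col (M_pow N M I l \<odot> B (l + 1)) = dim_col (B l \<odot> M_pow N M I (l + 1))"
      using smsD(2)[OF sms_A, of "l + 1"] B_props(1)[of "l + 1"] by (simp only: smat_mult_dims) (metis carrier_matD(2))
    show "inj_on K (dom K)" using specification_map_K unfolding specification_map_def by blast
    show "x \<in> dom K" if ne: "ent (M_pow N M I l \<odot> B (l + 1)) x \<noteq> {}" for x
    proof -
      obtain a cs where x: "x = (a, cs)" by (cases x)
      have "ent (Ms 0 (N * l)) a O W (Suc (N * l)) cs \<noteq> {}" using ne unfolding x AB by blast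
      then have "\<exists>cs' b. K (a, cs) = Some (cs', b)" using word_rel_square_ex1[of 0 N] by simp
      then show ?thesis unfolding x by blast
    qed
    show "ent (B l \<odot> M_pow N M I (l + 1)) y = (\<Union>x\<in>{x. K x = Some y}. ent (M_pow N M I l \<odot> B (l + 1)) x)" for y
    proof -
      obtain cs' b where y: "y = (cs', b)" by (cases y)
      have sq: "ent (M_pow N M I l \<odot> B (l + 1)) x = ent (B l \<odot> M_pow N M I (l + 1)) y" if K: "K x = Some y" for x
      proof -
        obtain a cs where x: "x = (a, cs)" by (cases x)
        have "ent (Ms 0 (N * l)) a O W (Suc (N * l)) cs = W (N * l) cs' O ent (Ms (0 + N) (N * l + N)) b"
          by (rule word_rel_square) (use K x y in simp_all)
        then show ?thesis unfolding x y AB BA by simp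
      qed
      show ?thesis
      proof (cases "ent (B l \<odot> M_pow N M I (l + 1)) y = {}")
        case True
        then show ?thesis using sq by blast
      next
        case False
        then have "W (N * l) cs' O ent (Ms (0 + N) (N * l + N)) b \<noteq> {}" unfolding y BA by blast
        then obtain a cs where "K (a, cs) = Some (cs', b)"
          using word_rel_square_ex2[of 0 N "N * l" cs' b] by auto
        then show ?thesis using sq y by blast
      qed
    qed
  qed
qed

theorem specified_equivalence_K: "specified_equivalence S T (M_pow N M I) B (I_pow N I) K"
  unfolding specified_equivalence_def symbolic_matrix_system_sms
  using sms_A sms_B specification_map_K K_equiv by blast

end

section \<open>Patches of squares\<close>

text \<open>A patch with \<open>m\<close> rows and \<open>n\<close> columns: \<open>e r i\<close> is the horizontal edge from position \<open>(r, i)\<close>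
  to \<open>(r, i + 1)\<close> and \<open>f r i\<close> the vertical edge from \<open>(r, i)\<close> to \<open>(r + 1, i)\<close>; position \<open>(r, i)\<close>
  has level \<open>l + r + i\<close>.\<close>

definition patch :: "(nat \<Rightarrow> ('e, 'f) square set) \<Rightarrow> nat \<Rightarrow> nat \<Rightarrow> nat \<Rightarrow> (nat \<Rightarrow> nat \<Rightarrow> 'e) \<Rightarrow> (nat \<Rightarrow> nat \<Rightarrow> 'f) \<Rightarrow> bool" where
  "patch Sq l m n e f \<longleftrightarrow> (\<forall>r<m. \<forall>i<n. (f r i, f r (Suc i), e r i, e (Suc r) i) \<in> Sq (l + r + i))"

text \<open>Reflection in the diagonal: the left, right, top and bottom edges \<open>f'\<close>,
  \<open>f\<close>, \<open>e\<close>, \<open>e'\<close> become the top, bottom, left and right ones.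
  Statements about rows thereby yield those about columns.\<close>

definition transpose_squares :: "(nat \<Rightarrow> ('e, 'f) square set) \<Rightarrow> nat \<Rightarrow> ('f, 'e) square set" where
  "transpose_squares Sq l = {(e, e', f', f). (f', f, e, e') \<in> Sq l}"

lemma patch_transpose:
  "patch (transpose_squares Sq) l n m (\<lambda>i r. f r i) (\<lambda>i r. e r i) \<longleftrightarrow> patch Sq l m n e f"
proof
  assume p: "patch (transpose_squares Sq) l n m (\<lambda>i r. f r i) (\<lambda>i r. e r i)"
  show "patch Sq l m n e f"
    unfolding patch_def
  proof (intro allI impI)
    fix r i assume "r < m" "i < n"
    then show "(f r i, f r (Suc i), e r i, e (Suc r) i) \<in> Sq (l + r + i)"
      using p[unfolded patch_def transpose_squares_def, rule_format, of i r] by (simp add: ac_simps)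
  qed
next
  assume p: "patch Sq l m n e f"
  show "patch (transpose_squares Sq) l n m (\<lambda>i r. f r i) (\<lambda>i r. e r i)"
    unfolding patch_def transpose_squares_def
  proof (intro allI impI)
    fix i r assume "i < n" "r < m"
    then show "(e r i, e (Suc r) i, f r i, f r (Suc i)) \<in> {(e, e', f', f). (f', f, e, e') \<in> Sq (l + i + r)}"
      using p[unfolded patch_def, rule_format, of r i] by (simp add: ac_simps)
  qed
qed

lemma patch_shift:
  assumes "patch Sq l m n e f" "a + m' \<le> m" "b + n' \<le> n"
  shows "patch Sq (l + a + b) m' n' (\<lambda>r i. e (a + r) (b + i)) (\<lambda>r i. f (a + r) (b + i))"
  unfolding patch_def
proof (intro allI impI)
  fix r i assume "r < m'" "i < n'"
  then show "(f (a + r) (b + i), f (a + r) (b + Suc i), e (a + r) (b + i), e (a + Suc r) (b + i)) \<in> Sq (l + a + b + r + i)"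
    using assms(1)[unfolded patch_def, rule_format, of "a + r" "b + i"] assms(2,3) by (simp add: ac_simps)
qed

text \<open>The sides of a square form two paths with common ends, \<open>e f\<close> over the top
  right corner and \<open>f' e'\<close> over the bottom left one. Either path can be completed;
  uniqueness is not asked for. Reception is demanded from level 1 on only.\<close>

locale textile_net =
  fixes EA :: "nat \<Rightarrow> 'e set" and EB :: "nat \<Rightarrow> 'f set" and sA tA :: "'e \<Rightarrow> 'v" and sB tB :: "'f \<Rightarrow> 'v"
    and Sq :: "nat \<Rightarrow> ('e, 'f) square set"
  assumes square: "(f', f, e, e') \<in> Sq l \<Longrightarrow> f' \<in> EB l \<and> f \<in> EB (Suc l) \<and> e \<in> EA l \<and> e' \<in> EA (Suc l) \<and>
      sA e = sB f' \<and> tA e = sB f \<and> tB f' = sA e' \<and> tA e' = tB f"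
    and complete_down: "e \<in> EA l \<Longrightarrow> f \<in> EB (Suc l) \<Longrightarrow> tA e = sB f \<Longrightarrow> \<exists>f' e'. (f', f, e, e') \<in> Sq l"
    and complete_up: "f' \<in> EB l \<Longrightarrow> e' \<in> EA (Suc l) \<Longrightarrow> tB f' = sA e' \<Longrightarrow> \<exists>f e. (f', f, e, e') \<in> Sq l"
    and emit_B: "e \<in> EA l \<Longrightarrow> \<exists>f\<in>EB (Suc l). sB f = tA e"
    and emit_A: "f \<in> EB l \<Longrightarrow> \<exists>e\<in>EA (Suc l). sA e = tB f"
    and receive_B: "e \<in> EA (Suc l) \<Longrightarrow> \<exists>f\<in>EB l. tB f = sA e"
    and receive_A: "f \<in> EB (Suc l) \<Longrightarrow> \<exists>e\<in>EA l. tA e = sB f"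
begin

lemma transpose: "textile_net EB EA sB tB sA tA (transpose_squares Sq)"
  unfolding transpose_squares_def
  by unfold_locales
    (use square complete_down complete_up emit_A emit_B receive_A receive_B in \<open>(auto; metis)+\<close>)

text \<open>A top edge is completed together with the right edge, so the row is filled from right to
  left, beginning with any \<open>B\<close>-edge that leaves its last vertex.\<close>

lemma sweep_down:
  "(\<And>i. i < n \<Longrightarrow> e i \<in> EA (l + i)) \<Longrightarrow> (\<And>i. Suc i < n \<Longrightarrow> tA (e i) = sA (e (Suc i))) \<Longrightarrow>
    0 < n \<Longrightarrow> \<exists>f e'. \<forall>i<n. (f i, f (Suc i), e i, e' i) \<in> Sq (l + i)"
proof (induction n arbitrary: l e)
  case (Suc n)
  have step: "\<exists>f e'. \<forall>i<Suc n. (f i, f (Suc i), e i, e' i) \<in> Sq (l + i)"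
    if f: "f 0 \<in> EB (Suc l)" "sB (f 0) = tA (e 0)" "\<forall>i<n. (f i, f (Suc i), e (Suc i), e' i) \<in> Sq (Suc l + i)" for f e'
  proof -
    obtain g d where "(g, f 0, e 0, d) \<in> Sq l" using complete_down[of "e 0" l "f 0"] f(1,2) Suc.prems(1)[of 0] by auto
    then have "\<forall>i<Suc n. (case_nat g f i, case_nat g f (Suc i), e i, case_nat d e' i) \<in> Sq (l + i)"
      using f(3) by (auto simp: less_Suc_eq_0_disj)
    then show ?thesis by blast
  qed
  show ?case
  proof (cases "n = 0")
    case True
    obtain f where "f \<in> EB (Suc l)" "sB f = tA (e 0)" using emit_B[of "e 0" l] Suc.prems(1)[of 0] by auto
    then show ?thesis using step[of "\<lambda>_. f"] True by simp
  next
    case False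
    then obtain f e' where fe: "\<forall>i<n. (f i, f (Suc i), e (Suc i), e' i) \<in> Sq (Suc l + i)"
      using Suc.IH[of "\<lambda>i. e (Suc i)" "Suc l"] Suc.prems(1)[of "Suc _"] Suc.prems(2) by auto
    have "f 0 \<in> EB (Suc l)" "sB (f 0) = tA (e 0)"
      using square[OF fe[rule_format, of 0]] False Suc.prems(2)[of 0] by simp_all
    then show ?thesis using step fe by blast
  qed
qed simp

text \<open>A bottom edge is completed together with the left edge, so the row is filled from left
  to right, beginning with any \<open>B\<close>-edge that enters its first vertex. The induction
  appends at the end.\<close>

lemma sweep_up:
  "(\<And>i. i < n \<Longrightarrow> e' i \<in> EA (Suc l + i)) \<Longrightarrow> (\<And>i. Suc i < n \<Longrightarrow> tA (e' i) = sA (e' (Suc i))) \<Longrightarrow>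
    0 < n \<Longrightarrow> \<exists>f e. \<forall>i<n. (f i, f (Suc i), e i, e' i) \<in> Sq (l + i)"
proof (induction n)
  case (Suc n)
  have step: "\<exists>f e. \<forall>i<Suc n. (f i, f (Suc i), e i, e' i) \<in> Sq (l + i)"
    if f: "f n \<in> EB (l + n)" "tB (f n) = sA (e' n)" "\<forall>i<n. (f i, f (Suc i), e i, e' i) \<in> Sq (l + i)" for f e
  proof -
    obtain g d where "(f n, g, d, e' n) \<in> Sq (l + n)"
      using complete_up[of "f n" "l + n" "e' n"] f(1,2) Suc.prems(1)[of n] by auto
    then have "\<forall>i<Suc n. ((f(Suc n := g)) i, (f(Suc n := g)) (Suc i), (e(n := d)) i, e' i) \<in> Sq (l + i)"
      using f(3) by (auto simp: less_Suc_eq)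
    then show ?thesis by blast
  qed
  show ?case
  proof (cases "n = 0")
    case True
    obtain f where "f \<in> EB l" "tB f = sA (e' 0)" using receive_B[of "e' 0" l] Suc.prems(1)[of 0] by auto
    then show ?thesis using step[of "\<lambda>_. f"] True by simp
  next
    case False
    then obtain f e where fe: "\<forall>i<n. (f i, f (Suc i), e i, e' i) \<in> Sq (l + i)"
      using Suc.IH Suc.prems by auto
    obtain k where k: "n = Suc k" using False by (cases n) auto
    have "f n \<in> EB (l + n)" "tB (f n) = sA (e' n)"
      using square[OF fe[rule_format, of k]] Suc.prems(2)[of k] by (simp_all add: k)
    then show ?thesis using step fe by blast
  qed
qed simp

lemma patch_down:
  assumes p: "patch Sq l m n e f" and pos: "0 < m" "0 < n"
  shows "\<exists>e' f'. patch Sq l (Suc m) n e' f' \<and> (\<forall>r\<le>m. \<forall>i<n. e' r i = e r i) \<and> (\<forall>r<m. \<forall>i\<le>n. f' r i = f r i)"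
proof -
  obtain k where k: "m = Suc k" using pos by (cases m) auto
  have sq: "(f k i, f k (Suc i), e k i, e m i) \<in> Sq (l + k + i)" if "i < n" for i
    using p that unfolding patch_def k by simp
  have "e m i \<in> EA (l + m + i)" if "i < n" for i
    using square[OF sq[OF that]] by (simp add: k)
  \<comment> \<open>Neighbouring squares share a vertical edge, whose terminal is the common vertex;
    the bottom row of a patch is thus a path.\<close>
  moreover have "tA (e m i) = sA (e m (Suc i))" if "Suc i < n" for i
    using square[OF sq[of i]] square[OF sq[of "Suc i"]] that by simp
  ultimately obtain g d where gd: "\<forall>i<n. (g i, g (Suc i), e m i, d i) \<in> Sq (l + m + i)"
    using sweep_down[of n "e m" "l + m"] pos(2) by blast
  have "patch Sq l (Suc m) n (e(Suc m := d)) (f(m := g))"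
    using p gd unfolding patch_def by (auto simp: less_Suc_eq)
  then show ?thesis by (intro exI[of _ "e(Suc m := d)"] exI[of _ "f(m := g)"]) auto
qed

lemma patch_up:
  assumes p: "patch Sq (Suc l) m n e f" and pos: "0 < m" "0 < n"
  shows "\<exists>e' f'. patch Sq l (Suc m) n e' f' \<and> (\<forall>r\<le>m. \<forall>i<n. e' (Suc r) i = e r i) \<and> (\<forall>r<m. \<forall>i\<le>n. f' (Suc r) i = f r i)"
proof -
  have sq: "(f 0 i, f 0 (Suc i), e 0 i, e (Suc 0) i) \<in> Sq (Suc l + i)" if "i < n" for i
    using p that pos unfolding patch_def by force
  have "e 0 i \<in> EA (Suc l + i)" if "i < n" for i
    using square[OF sq[OF that]] by simp
  moreover have "tA (e 0 i) = sA (e 0 (Suc i))" if "Suc i < n" for i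
    using square[OF sq[of i]] square[OF sq[of "Suc i"]] that by simp
  ultimately obtain g d where gd: "\<forall>i<n. (g i, g (Suc i), d i, e 0 i) \<in> Sq (l + i)"
    using sweep_up[of n "e 0" "l"] pos(2) by blast
  have "patch Sq l (Suc m) n (case_nat d e) (case_nat g f)"
    unfolding patch_def
  proof (intro allI impI)
    fix r i assume "r < Suc m" "i < n"
    then show "(case_nat g f r i, case_nat g f r (Suc i), case_nat d e r i, case_nat d e (Suc r) i) \<in> Sq (l + r + i)"
      using p gd unfolding patch_def by (cases r) auto
  qed
  then show ?thesis by (intro exI[of _ "case_nat d e"] exI[of _ "case_nat g f"]) auto
qed

text \<open>Each row above uses up one level, hence the start at \<open>l + h\<close>; rows below
  can be added at any level.\<close>

lemma patch_rows:
  assumes "patch Sq (l + h) m n e f" and pos: "0 < m" "0 < n"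
  shows "\<exists>e' f'. patch Sq l (h + m + h') n e' f' \<and>
    (\<forall>r\<le>m. \<forall>i<n. e' (h + r) i = e r i) \<and> (\<forall>r<m. \<forall>i\<le>n. f' (h + r) i = f r i)"
proof -
  have "\<exists>e' f'. patch Sq (l + h) (m + h') n e' f' \<and>
      (\<forall>r\<le>m. \<forall>i<n. e' r i = e r i) \<and> (\<forall>r<m. \<forall>i\<le>n. f' r i = f r i)"
  proof (induction h')
    case (Suc h')
    then obtain e' f' where 1: "patch Sq (l + h) (m + h') n e' f'"
      "\<forall>r\<le>m. \<forall>i<n. e' r i = e r i" "\<forall>r<m. \<forall>i\<le>n. f' r i = f r i" by blast
    obtain e2 f2 where 2: "patch Sq (l + h) (Suc (m + h')) n e2 f2"
      "\<forall>r\<le>m + h'. \<forall>i<n. e2 r i = e' r i" "\<forall>r<m + h'. \<forall>i\<le>n. f2 r i = f' r i"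
      using patch_down[OF 1(1)] pos by auto
    show ?case
      by (intro exI[of _ e2] exI[of _ f2]) (use 1 2 in auto)
  qed (use assms in auto)
  then obtain e' f' where 1: "patch Sq (l + h) (m + h') n e' f'"
    "\<forall>r\<le>m. \<forall>i<n. e' r i = e r i" "\<forall>r<m. \<forall>i\<le>n. f' r i = f r i" by blast
  have "\<exists>e2 f2. patch Sq l (h + (m + h')) n e2 f2 \<and>
      (\<forall>r\<le>m + h'. \<forall>i<n. e2 (h + r) i = e' r i) \<and> (\<forall>r<m + h'. \<forall>i\<le>n. f2 (h + r) i = f' r i)"
    using 1(1)
  proof (induction h arbitrary: l)
    case 0
    then show ?case by auto
  next
    case (Suc h)
    then have "patch Sq (Suc l + h) (m + h') n e' f'" by simp
    from Suc.IH[OF this] obtain e2 f2 where 2: "patch Sq (Suc l) (h + (m + h')) n e2 f2"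
      "\<forall>r\<le>m + h'. \<forall>i<n. e2 (h + r) i = e' r i" "\<forall>r<m + h'. \<forall>i\<le>n. f2 (h + r) i = f' r i"
      by blast
    obtain e3 f3 where 3: "patch Sq l (Suc (h + (m + h'))) n e3 f3"
      "\<forall>r\<le>h + (m + h'). \<forall>i<n. e3 (Suc r) i = e2 r i" "\<forall>r<h + (m + h'). \<forall>i\<le>n. f3 (Suc r) i = f2 r i"
      using patch_up[OF 2(1)] pos by auto
    show ?case
      by (intro exI[of _ e3] exI[of _ f3]) (use 2 3 in auto)
  qed
  then obtain e2 f2 where 2: "patch Sq l (h + (m + h')) n e2 f2"
    "\<forall>r\<le>m + h'. \<forall>i<n. e2 (h + r) i = e' r i" "\<forall>r<m + h'. \<forall>i\<le>n. f2 (h + r) i = f' r i" by blast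
  show ?thesis
    by (intro exI[of _ e2] exI[of _ f2]) (use 1 2 in \<open>auto simp: add.assoc\<close>)
qed

lemma patch_columns:
  assumes "patch Sq (l + h) m n e f" and pos: "0 < m" "0 < n"
  shows "\<exists>e' f'. patch Sq l m (h + n + h') e' f' \<and>
    (\<forall>r\<le>m. \<forall>i<n. e' r (h + i) = e r i) \<and> (\<forall>r<m. \<forall>i\<le>n. f' r (h + i) = f r i)"
proof -
  have "patch (transpose_squares Sq) (l + h) n m (\<lambda>i r. f r i) (\<lambda>i r. e r i)"
    using assms(1) by (simp only: patch_transpose)
  from textile_net.patch_rows[OF transpose this pos(2,1), of h']
  obtain f' e' where *: "patch (transpose_squares Sq) l (h + n + h') m f' e'"
    "\<forall>i\<le>n. \<forall>r<m. f' (h + i) r = f r i" "\<forall>i<n. \<forall>r\<le>m. e' (h + i) r = e r i" by blast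
  have "patch Sq l m (h + n + h') (\<lambda>r i. e' i r) (\<lambda>r i. f' i r)"
    using *(1) patch_transpose[of Sq l "h + n + h'" m "\<lambda>r i. f' i r" "\<lambda>r i. e' i r"] by simp
  then show ?thesis
    by (intro exI[of _ "\<lambda>r i. e' i r"] exI[of _ "\<lambda>r i. f' i r"]) (use * in auto)
qed

text \<open>One downward sweep makes the path the top of a one-row patch, which then grows by
  \<open>h\<close> rows above and \<open>h'\<close> below.\<close>

lemma path_patch:
  assumes "\<And>i. i < n \<Longrightarrow> e i \<in> EA (l + h + i)" "\<And>i. Suc i < n \<Longrightarrow> tA (e i) = sA (e (Suc i))" "0 < n"
  shows "\<exists>e' f'. patch Sq l (h + Suc h') n e' f' \<and> (\<forall>i<n. e' h i = e i)"
proof -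
  obtain g d where gd: "\<forall>i<n. (g i, g (Suc i), e i, d i) \<in> Sq (l + h + i)"
    using sweep_down[of n e "l + h"] assms by blast
  then have "patch Sq (l + h) 1 n (case_nat e (\<lambda>_. d)) (\<lambda>_. g)" by (simp add: patch_def)
  from patch_rows[OF this _ assms(3), of h'] obtain e' f' where
    *: "patch Sq l (h + 1 + h') n e' f'" "\<forall>r\<le>1. \<forall>i<n. e' (h + r) i = case_nat e (\<lambda>_. d) r i"
    by auto
  have "\<forall>i<n. e' h i = e i" using *(2)[rule_format, of 0] by simp
  then show ?thesis using *(1) by auto
qed

end

section \<open>Cylinder sets and compactness\<close>

text \<open>Dependence on one finite set of coordinates that is the same for all arguments. It makes
  every preimage clopen, without reference to a finite alphabet.\<close>

definition finitely_determined :: "(('i \<Rightarrow> 'u) \<Rightarrow> 'z) \<Rightarrow> bool" where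
  "finitely_determined g \<longleftrightarrow> (\<exists>F. finite F \<and> (\<forall>x y. (\<forall>p\<in>F. x p = y p) \<longrightarrow> g x = g y))"

abbreviation full_shift_topology :: "('i \<Rightarrow> 'u) topology" where
  "full_shift_topology \<equiv> product_topology (\<lambda>_. discrete_topology UNIV) UNIV"

lemma finitely_determinedI: "finite F \<Longrightarrow> (\<And>x y. (\<forall>p\<in>F. x p = y p) \<Longrightarrow> g x = g y) \<Longrightarrow> finitely_determined g"
  unfolding finitely_determined_def by blast

lemma finitely_determined_comp: "finitely_determined g \<Longrightarrow> finitely_determined (\<lambda>x. h (g x))"
  unfolding finitely_determined_def by metis

lemma finitely_determined_conj:
  assumes "finitely_determined P" "finitely_determined Q"
  shows "finitely_determined (\<lambda>x. P x \<and> Q x)"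
proof -
  obtain F G where "finite F" "\<And>x y. (\<forall>p\<in>F. x p = y p) \<Longrightarrow> P x = P y"
    "finite G" "\<And>x y. (\<forall>p\<in>G. x p = y p) \<Longrightarrow> Q x = Q y"
    using assms unfolding finitely_determined_def by blast
  then have *: "finite (F \<union> G)" "\<And>x y. (\<forall>p\<in>F \<union> G. x p = y p) \<Longrightarrow> P x = P y \<and> Q x = Q y" by simp_all
  show ?thesis by (rule finitely_determinedI[OF *(1)]) (use *(2) in blast)
qed

lemma finitely_determined_ball:
  assumes "finite J" "\<And>j. j \<in> J \<Longrightarrow> finitely_determined (P j)"
  shows "finitely_determined (\<lambda>x. \<forall>j\<in>J. P j x)"
  using assms
proof (induction J rule: finite_induct)
  case empty
  show ?case by (rule finitely_determinedI[of "{}"]) auto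
next
  case (insert j J)
  then have "finitely_determined (\<lambda>x. P j x \<and> (\<forall>j\<in>J. P j x))"
    by (intro finitely_determined_conj) auto
  then show ?case by simp
qed

lemma openin_finitely_determined:
  assumes "finitely_determined Q"
  shows "openin full_shift_topology {x. Q x}"
proof (subst openin_subopen, intro ballI)
  fix x assume x: "x \<in> {x. Q x}"
  obtain F where F: "finite F" "\<And>y. (\<forall>p\<in>F. x p = y p) \<Longrightarrow> Q x = Q y"
    using assms unfolding finitely_determined_def by blast
  let ?V = "\<Pi>\<^sub>E p\<in>UNIV. if p \<in> F then {x p} else UNIV"
  have "openin full_shift_topology ?V"
  proof (rule product_topology_basis)
    show "finite {p. (if p \<in> F then {x p} else UNIV) \<noteq> topspace (discrete_topology UNIV)}"
      by (rule finite_subset[OF _ F(1)]) auto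
  qed simp
  moreover have "?V \<subseteq> {x. Q x}"
  proof
    fix y assume "y \<in> ?V"
    then have "y p \<in> (if p \<in> F then {x p} else UNIV)" for p by (rule PiE_mem) simp
    then have "\<forall>p\<in>F. x p = y p" by (metis singletonD)
    then show "y \<in> {x. Q x}" using F(2) x by auto
  qed
  moreover have "x \<in> ?V" by (simp add: PiE_iff)
  ultimately show "\<exists>V. openin full_shift_topology V \<and> x \<in> V \<and> V \<subseteq> {x. Q x}" by blast
qed

lemma closedin_finitely_determined:
  assumes "finitely_determined Q"
  shows "closedin full_shift_topology {x. Q x}"
proof -
  have "UNIV - {x. Q x} = {x. \<not> Q x}" by auto
  moreover have "openin full_shift_topology {x. \<not> Q x}"
    by (rule openin_finitely_determined) (rule finitely_determined_comp[OF assms])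
  ultimately show ?thesis unfolding closedin_def by simp
qed

lemma compactin_full_shift: "finite U \<Longrightarrow> compactin full_shift_topology (PiE UNIV (\<lambda>_. U))"
  unfolding compactin_PiE by (auto simp: compactin_discrete_topology)

text \<open>Nested nonempty closed sets in a compact product. The values are confined to the finite
  set \<open>U\<close>, because the symbol type may be infinite.\<close>

lemma finitely_determined_limit:
  fixes Q :: "nat \<Rightarrow> ('i \<Rightarrow> 'u) \<Rightarrow> bool"
  assumes "finite U" "\<And>n. finitely_determined (Q n)" "\<And>n x. Q (Suc n) x \<Longrightarrow> Q n x"
    and ex: "\<And>n. \<exists>x. range x \<subseteq> U \<and> Q n x"
  shows "\<exists>x. range x \<subseteq> U \<and> (\<forall>n. Q n x)"
proof -
  let ?K = "PiE UNIV (\<lambda>_. U) :: ('i \<Rightarrow> 'u) set"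
  let ?X = "subtopology full_shift_topology ?K"
  have K: "x \<in> ?K \<longleftrightarrow> range x \<subseteq> U" for x by (auto simp: PiE_iff)
  have "compact_space ?X" using compactin_full_shift[OF assms(1)] by (simp add: compactin_subspace)
  moreover have "closedin ?X (?K \<inter> {x. Q n x})" for n
    using closedin_finitely_determined[OF assms(2)] by (auto simp: closedin_subtopology)
  moreover have "?K \<inter> {x. Q n x} \<noteq> {}" for n using ex[of n] K by blast
  moreover have "decseq (\<lambda>n. ?K \<inter> {x. Q n x})" by (rule decseq_SucI) (use assms(3) in auto)
  ultimately have "(\<Inter>n. ?K \<inter> {x. Q n x}) \<noteq> {}" by (rule compact_space_imp_nest)
  then obtain x where "x \<in> (\<Inter>n. ?K \<inter> {x. Q n x})" by blast
  then show ?thesis using K by blast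
qed

lemma Hausdorff_seq_topology: "Hausdorff_space (seq_topology L)"
  unfolding seq_topology_def
  by (rule Hausdorff_space_subtopology) (simp add: Hausdorff_space_product_topology)

lemma topspace_seq_topology [simp]: "topspace (seq_topology L) = L"
  by (simp add: seq_topology_def)

text \<open>A continuous bijection from a compact onto a Hausdorff space has a continuous
  inverse.\<close>

lemma homeomorphic_map_finitely_determined:
  fixes g :: "('i \<Rightarrow> 'u) \<Rightarrow> (int \<Rightarrow> 'z)"
  assumes "compactin full_shift_topology Om" "\<And>k. finitely_determined (\<lambda>x. g x k)"
    and "g ` Om = L" "inj_on g Om"
  shows "homeomorphic_map (subtopology full_shift_topology Om) (seq_topology L) g"
proof (rule continuous_imp_homeomorphic_map)
  have "continuous_map full_shift_topology (discrete_topology UNIV) (\<lambda>x. g x k)" for k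
  proof -
    have "openin full_shift_topology {x. g x k \<in> V}" for V
      by (rule openin_finitely_determined) (rule finitely_determined_comp[OF assms(2), where h = "\<lambda>v. v \<in> V"])
    then show ?thesis unfolding continuous_map_def by simp
  qed
  then have "continuous_map full_shift_topology full_shift_topology g"
    unfolding continuous_map_componentwise_UNIV by blast
  then show "continuous_map (subtopology full_shift_topology Om) (seq_topology L) g"
    unfolding seq_topology_def continuous_map_in_subtopology
    using assms(3) by (auto intro: continuous_map_from_subtopology)
  show "compact_space (subtopology full_shift_topology Om)"
    using assms(1) by (simp add: compactin_subspace)
qed (use assms in \<open>simp_all add: Hausdorff_seq_topology\<close>)

text \<open>Each position shows the labels of the two edges leaving it to the right and downwards,
  so the last row of \<open>e\<close> and the last column of \<open>f\<close> stay unread. The level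
  is chosen for each window separately.\<close>

definition realizes :: "(nat \<Rightarrow> ('e, 'f) square set) \<Rightarrow> ('e \<Rightarrow> 'a) \<Rightarrow> ('f \<Rightarrow> 'b) \<Rightarrow>
  (int \<times> int \<Rightarrow> 'a \<times> 'b) \<Rightarrow> int \<Rightarrow> int \<Rightarrow> nat \<Rightarrow> nat \<Rightarrow> bool" where
  "realizes Sq la lb w R J m n \<longleftrightarrow> (\<exists>l e f. patch Sq l m n e f \<and>
     (\<forall>r<m. \<forall>i<n. w (R + int r, J + int i) = (la (e r i), lb (f r i))))"

definition textile_configs :: "(nat \<Rightarrow> ('e, 'f) square set) \<Rightarrow> ('e \<Rightarrow> 'a) \<Rightarrow> ('f \<Rightarrow> 'b) \<Rightarrow>
  (int \<times> int \<Rightarrow> 'a \<times> 'b) set" where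
  "textile_configs Sq la lb = {w. \<forall>R J m n. realizes Sq la lb w R J m n}"

lemma realizes_sub:
  assumes "realizes Sq la lb w R J m n" "R \<le> R'" "R' + int m' \<le> R + int m" "J \<le> J'" "J' + int n' \<le> J + int n"
  shows "realizes Sq la lb w R' J' m' n'"
proof -
  obtain l e f where *: "patch Sq l m n e f"
    "\<And>r i. r < m \<Longrightarrow> i < n \<Longrightarrow> w (R + int r, J + int i) = (la (e r i), lb (f r i))"
    using assms(1) unfolding realizes_def by blast
  define a b where "a = nat (R' - R)" and "b = nat (J' - J)"
  have ab: "a + m' \<le> m" "b + n' \<le> n" "R' = R + int a" "J' = J + int b"
    using assms by (auto simp: a_def b_def)
  have "w (R' + int r, J' + int i) = (la (e (a + r) (b + i)), lb (f (a + r) (b + i)))" if "r < m'" "i < n'" for r i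
    using *(2)[of "a + r" "b + i"] ab that by (simp add: add.assoc)
  then show ?thesis unfolding realizes_def using patch_shift[OF *(1) ab(1,2)] by blast
qed

lemma finitely_determined_realizes: "finitely_determined (\<lambda>w. realizes Sq la lb w R J m n)"
proof (rule finitely_determinedI)
  let ?F = "(\<lambda>(r, i). (R + int r, J + int i)) ` ({..<m} \<times> {..<n})"
  show "finite ?F" by simp
  fix x y :: "int \<times> int \<Rightarrow> 'a \<times> 'b" assume "\<forall>p\<in>?F. x p = y p"
  then have "\<forall>r<m. \<forall>i<n. x (R + int r, J + int i) = y (R + int r, J + int i)" by auto
  then show "realizes Sq la lb x R J m n = realizes Sq la lb y R J m n"
    unfolding realizes_def by simp
qed

lemma textile_configs_shift:
  assumes "w \<in> textile_configs Sq la lb"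
  shows "(\<lambda>(r, i). w (r + s, i)) \<in> textile_configs Sq la lb"
  unfolding textile_configs_def
proof (intro CollectI allI)
  fix R J m n
  have "realizes Sq la lb w (R + s) J m n" using assms by (simp add: textile_configs_def)
  then show "realizes Sq la lb (\<lambda>(r, i). w (r + s, i)) R J m n"
    unfolding realizes_def by (simp add: ac_simps)
qed

locale labelled_textile_net = textile_net EA EB sA tA sB tB Sq
  for EA :: "nat \<Rightarrow> 'e set" and EB :: "nat \<Rightarrow> 'f set" and sA tA :: "'e \<Rightarrow> 'v" and sB tB :: "'f \<Rightarrow> 'v"
    and Sq :: "nat \<Rightarrow> ('e, 'f) square set" +
  fixes la :: "'e \<Rightarrow> 'a" and lb :: "'f \<Rightarrow> 'b" and S :: "'a set" and T :: "'b set"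
  assumes labels: "e \<in> EA l \<Longrightarrow> la e \<in> S" "f \<in> EB l \<Longrightarrow> lb f \<in> T" and fin: "finite S" "finite T"
begin

abbreviation configs where "configs \<equiv> textile_configs Sq la lb"

lemma patch_edges:
  assumes "patch Sq l m n e f" "r < m" "i < n"
  shows "e r i \<in> EA (l + r + i)" "f r i \<in> EB (l + r + i)" "e (Suc r) i \<in> EA (l + Suc r + i)"
    "f r (Suc i) \<in> EB (l + r + Suc i)"
  using square[OF assms(1)[unfolded patch_def, rule_format, OF assms(2,3)]] by simp_all

lemma config_of_patch:
  assumes "patch Sq l m n e f" "0 < m" "0 < n"
  shows "\<exists>w. range w \<subseteq> S \<times> T \<and> realizes Sq la lb w R J m n \<and>
    (\<forall>r<m. \<forall>i<n. w (R + int r, J + int i) = (la (e r i), lb (f r i)))"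
proof -
  \<comment> \<open>Outside the window the nearest label of the patch is repeated, which keeps all
    values in \<open>S \<times> T\<close>.\<close>
  define w where "w = (\<lambda>(r, i). let r' = min (nat (r - R)) (m - 1); i' = min (nat (i - J)) (n - 1) in
    (la (e r' i'), lb (f r' i')))"
  have "w (R + int r, J + int i) = (la (e r i), lb (f r i))" if "r < m" "i < n" for r i
  proof -
    have "min r (m - 1) = r" "min i (n - 1) = i" using that by auto
    then show ?thesis by (simp add: w_def)
  qed
  moreover have "range w \<subseteq> S \<times> T"
  proof (rule image_subsetI)
    fix p :: "int \<times> int" obtain r i where p: "p = (r, i)" by (cases p)
    have "min (nat (r - R)) (m - 1) < m" "min (nat (i - J)) (n - 1) < n" using assms(2,3) by auto
    from patch_edges[OF assms(1) this] show "w p \<in> S \<times> T"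
      using labels by (simp add: w_def p Let_def)
  qed
  ultimately show ?thesis using assms(1) unfolding realizes_def by blast
qed

lemma configs_range:
  assumes "w \<in> configs"
  shows "range w \<subseteq> S \<times> T"
proof (rule image_subsetI)
  fix p :: "int \<times> int" obtain r i where p: "p = (r, i)" by (cases p)
  have "realizes Sq la lb w r i 1 1" using assms by (simp add: textile_configs_def)
  then obtain l e f where "patch Sq l 1 1 e f" "w (r, i) = (la (e 0 0), lb (f 0 0))"
    unfolding realizes_def by auto
  then show "w p \<in> S \<times> T" using patch_edges[of l 1 1 e f 0 0] labels p by simp
qed

lemma compactin_configs: "compactin full_shift_topology configs"
proof (rule closed_compactin)
  show "compactin full_shift_topology (PiE UNIV (\<lambda>_ :: int \<times> int. S \<times> T))"
    by (rule compactin_full_shift) (simp add: fin)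
  show "configs \<subseteq> PiE UNIV (\<lambda>_ :: int \<times> int. S \<times> T)"
    using configs_range by (auto simp: PiE_iff)
  have "configs = (\<Inter>(R, J, m, n)\<in>UNIV. {w. realizes Sq la lb w R J m n})"
    by (auto simp: textile_configs_def)
  moreover have "closedin full_shift_topology (\<Inter>(R, J, m, n)\<in>UNIV. {w. realizes Sq la lb w R J m n})"
    by (rule closedin_INT) (auto intro!: closedin_finitely_determined finitely_determined_realizes)
  ultimately show "closedin full_shift_topology configs" by simp
qed

text \<open>Stage \<open>L\<close> asks for a realized square of side \<open>2L + 1\<close> around
  the origin and for the conditions with \<open>\<bar>j\<bar> \<le> L\<close>. The stages are
  decreasing, so compactness satisfies all of them together.\<close>

lemma config_limit:
  fixes P :: "int \<Rightarrow> (int \<times> int \<Rightarrow> 'a \<times> 'b) \<Rightarrow> bool"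
  assumes "\<And>j. finitely_determined (P j)"
    and ex: "\<And>L. \<exists>w. range w \<subseteq> S \<times> T \<and> realizes Sq la lb w (- int L) (- int L) (2 * L + 1) (2 * L + 1) \<and>
      (\<forall>j\<in>{- int L..int L}. P j w)"
  shows "\<exists>w\<in>configs. \<forall>j. P j w"
proof -
  let ?Q = "\<lambda>L w. realizes Sq la lb w (- int L) (- int L) (2 * L + 1) (2 * L + 1) \<and> (\<forall>j\<in>{- int L..int L}. P j w)"
  have "\<exists>w. range w \<subseteq> S \<times> T \<and> (\<forall>L. ?Q L w)"
  proof (rule finitely_determined_limit)
    show "finitely_determined (?Q L)" for L
      by (intro finitely_determined_conj finitely_determined_realizes finitely_determined_ball assms(1)) simp
    show "?Q L w" if "?Q (Suc L) w" for L w
      using that by (auto elim: realizes_sub)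
  qed (use fin ex in auto)
  then obtain w where w: "\<And>L. ?Q L w" by blast
  have "P j w" for j
  proof -
    have "j \<in> {- int (nat \<bar>j\<bar>)..int (nat \<bar>j\<bar>)}"
      using abs_ge_minus_self[of j] abs_ge_self[of j] by auto
    then show ?thesis using w by blast
  qed
  moreover have "realizes Sq la lb w R J m n" for R J m n
  proof (rule realizes_sub)
    let ?L = "nat \<bar>R\<bar> + nat \<bar>J\<bar> + m + n"
    show "realizes Sq la lb w (- int ?L) (- int ?L) (2 * ?L + 1) (2 * ?L + 1)" using w by blast
  qed auto
  ultimately show ?thesis by (auto simp: textile_configs_def)
qed

end

section \<open>Configurations of a textile system\<close>

definition config_row :: "(int \<times> int \<Rightarrow> 'a \<times> 'b) \<Rightarrow> int \<Rightarrow> int \<Rightarrow> 'a" where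
  "config_row w r = (\<lambda>i. fst (w (r, i)))"

text \<open>The labels of the vertical edges between the rows \<open>r\<close> and
  \<open>r + 1\<close>, listed along row \<open>r\<close>.\<close>

definition config_col :: "(int \<times> int \<Rightarrow> 'a \<times> 'b) \<Rightarrow> int \<Rightarrow> int \<Rightarrow> 'b" where
  "config_col w r = (\<lambda>i. snd (w (r, i)))"

text \<open>The squares in the columns \<open>1 - k, ..., k - 1\<close>, the positions with absolute
  value below \<open>k\<close>. Their right edges also show the vertical labels of column
  \<open>k\<close>.\<close>

definition config_strip :: "nat \<Rightarrow> (int \<times> int \<Rightarrow> 'a \<times> 'b) \<Rightarrow> int \<Rightarrow> ('a, 'b) square list" where
  "config_strip k w r = map (\<lambda>i. let j = 1 - int k + int i in
     (snd (w (r, j)), snd (w (r, j + 1)), fst (w (r, j)), fst (w (r + 1, j)))) [0..<2 * k - 1]"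

definition square_rule :: "('a \<times> 'b \<rightharpoonup> 'b \<times> 'a) \<Rightarrow> (int \<Rightarrow> 'a) \<Rightarrow> (int \<Rightarrow> 'b) \<Rightarrow> (int \<Rightarrow> 'a) \<Rightarrow> bool" where
  "square_rule \<kappa> x c x' \<longleftrightarrow> (\<forall>i. \<kappa> (x i, c (i + 1)) = Some (c i, x' i))"

text \<open>With \<open>r\<close> the least absolute value of a position of disagreement,
  \<open>1/(r+1) \<ge> 1/k\<close> gives \<open>r < k\<close>.\<close>

lemma seq_dist_ge:
  assumes "x \<noteq> y" "seq_dist x y \<ge> 1 / real k" "k \<ge> 1"
  shows "\<exists>i. x i \<noteq> y i \<and> \<bar>i\<bar> < int k"
proof -
  let ?P = "\<lambda>r. \<exists>i. x i \<noteq> y i \<and> r = nat \<bar>i\<bar>"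
  have "\<exists>r. ?P r" using assms(1) by auto
  then have "?P (LEAST r. ?P r)" by (rule LeastI_ex)
  then obtain i where i: "x i \<noteq> y i" "(LEAST r. ?P r) = nat \<bar>i\<bar>" by blast
  have "1 / real k \<le> 1 / (real (nat \<bar>i\<bar>) + 1)" using assms(1,2) i(2) by (simp add: seq_dist_def)
  then have "real (nat \<bar>i\<bar>) + 1 \<le> real k" using assms(3) by (simp add: field_simps)
  then show ?thesis using i(1) by (intro exI[of _ i]) linarith
qed

locale lgraph_textile =
  labelled_textile_net "edges A" "edges B" "src A" "tgt A" "src B" "tgt B" "textile_squares A B \<kappa>" "lab A" "lab B" S T
  for A :: "('v, 'e, 'a) lgraph" and B :: "('v, 'f, 'b) lgraph" and \<kappa> S T
begin

abbreviation sqs where "sqs \<equiv> textile_squares A B \<kappa>"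
abbreviation H where "H k \<equiv> relative_higher_block (2 * k) (lr_textile A B \<kappa>)"

lemma config_row_presented:
  assumes "w \<in> configs"
  shows "config_row w r \<in> presented_subshift A"
  unfolding presented_subshift_def
proof (intro CollectI allI)
  fix i n
  have "realizes sqs (lab A) (lab B) w r i 1 n" using assms by (simp add: textile_configs_def)
  then obtain l e f where *: "patch sqs l 1 n e f"
    "\<And>j. j < n \<Longrightarrow> w (r, i + int j) = (lab A (e 0 j), lab B (f 0 j))"
    unfolding realizes_def by auto
  have sq: "(f 0 j, f 0 (Suc j), e 0 j, e (Suc 0) j) \<in> sqs (l + j)" if "j < n" for j
    using *(1) that by (simp add: patch_def)
  have "is_path A l (map (e 0) [0..<n])"
    unfolding is_path_def
  proof (intro conjI allI impI)
    fix j assume "j < length (map (e 0) [0..<n])"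
    then show "map (e 0) [0..<n] ! j \<in> edges A (l + j)" using square[OF sq[of j]] by simp
  next
    fix j assume "j + 1 < length (map (e 0) [0..<n])"
    then show "tgt A (map (e 0) [0..<n] ! j) = src A (map (e 0) [0..<n] ! (j + 1))"
      using square[OF sq[of j]] square[OF sq[of "Suc j"]] by simp
  qed
  moreover have "map (lab A) (map (e 0) [0..<n]) = map (\<lambda>j. config_row w r (i + int j)) [0..<n]"
    using *(2) by (simp add: config_row_def)
  ultimately show "\<exists>l es. is_path A l es \<and> map (lab A) es = map (\<lambda>j. config_row w r (i + int j)) [0..<n]"
    by blast
qed

lemma config_square_rule:
  assumes "w \<in> configs"
  shows "square_rule \<kappa> (config_row w r) (config_col w r) (config_row w (r + 1))"
  unfolding square_rule_def
proof
  fix i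
  have "realizes sqs (lab A) (lab B) w r i 2 2" using assms by (simp add: textile_configs_def)
  then obtain l e f where *: "patch sqs l 2 2 e f"
    "\<And>j s. s < 2 \<Longrightarrow> j < 2 \<Longrightarrow> w (r + int s, i + int j) = (lab A (e s j), lab B (f s j))"
    unfolding realizes_def by auto
  have "(f 0 0, f 0 1, e 0 0, e 1 0) \<in> sqs l"
    using *(1)[unfolded patch_def, rule_format, of 0 0] by simp
  then show "\<kappa> (config_row w r i, config_col w r (i + 1)) = Some (config_col w r i, config_row w (r + 1) i)"
    using *(2)[of 0 0] *(2)[of 0 1] *(2)[of 1 0]
    by (simp add: textile_squares_def config_row_def config_col_def)
qed

lemma ex_config_row:
  assumes x: "x \<in> presented_subshift A"
  shows "\<exists>w\<in>configs. config_row w 0 = x"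
proof -
  have "\<exists>w\<in>configs. \<forall>j. config_row w 0 j = x j"
  proof (rule config_limit)
    show "finitely_determined (\<lambda>w :: int \<times> int \<Rightarrow> 'a \<times> 'b. config_row w 0 j = x j)" for j
      by (rule finitely_determinedI[of "{(0, j)}"]) (auto simp: config_row_def)
  next
    fix L :: nat
    let ?n = "2 * L + 1"
    \<comment> \<open>The first \<open>L\<close> edges only raise the level, which pays for the
      \<open>L\<close> rows above row 0; the remaining \<open>2 L + 1\<close> edges cover the
      positions from \<open>-L\<close> to \<open>L\<close>.\<close>
    obtain l es where es: "is_path A l es" "map (lab A) es = map (\<lambda>j. x (- int (2 * L) + int j)) [0..<3 * L + 1]"
      using x unfolding presented_subshift_def by blast
    have len: "length es = 3 * L + 1" using arg_cong[OF es(2), of length] by simp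
    have lab: "lab A (es ! j) = x (- int (2 * L) + int j)" if "j < 3 * L + 1" for j
      using arg_cong[OF es(2), of "\<lambda>zs. zs ! j"] that len by (simp del: upt_Suc)
    have "\<exists>e f. patch sqs l (L + Suc L) ?n e f \<and> (\<forall>i<?n. e L i = es ! (L + i))"
    proof (rule path_patch)
      show "es ! (L + i) \<in> edges A (l + L + i)" if "i < ?n" for i
        using es(1) that len by (simp add: is_path_def add.assoc)
      show "tgt A (es ! (L + i)) = src A (es ! (L + Suc i))" if "Suc i < ?n" for i
        using es(1) that len by (simp add: is_path_def)
    qed simp
    then obtain e f where ef: "patch sqs l ?n ?n e f" "\<And>i. i < ?n \<Longrightarrow> e L i = es ! (L + i)"
      by (auto simp: mult_2)
    obtain w where w: "range w \<subseteq> S \<times> T" "realizes sqs (lab A) (lab B) w (- int L) (- int L) ?n ?n"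
      "\<And>r i. r < ?n \<Longrightarrow> i < ?n \<Longrightarrow> w (- int L + int r, - int L + int i) = (lab A (e r i), lab B (f r i))"
      using config_of_patch[OF ef(1), of "- int L" "- int L"] by auto
    have "config_row w 0 j = x j" if "j \<in> {- int L..int L}" for j
    proof -
      define i where "i = nat (j + int L)"
      have i: "j = - int L + int i" "i < ?n" using that by (auto simp: i_def)
      have "config_row w 0 j = lab A (e L i)" using w(3)[of L i] i by (simp add: config_row_def)
      also have "\<dots> = x j"
      proof -
        have e: "- int (2 * L) + int (L + i) = j" using i by simp
        show ?thesis using ef(2)[OF i(2)] lab[of "L + i", unfolded e] i(2) by simp
      qed
      finally show ?thesis .
    qed
    then show "\<exists>w. range w \<subseteq> S \<times> T \<and> realizes sqs (lab A) (lab B) w (- int L) (- int L) ?n ?n \<and>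
        (\<forall>j\<in>{- int L..int L}. config_row w 0 j = x j)" using w by blast
  qed
  then show ?thesis by (auto simp: fun_eq_iff)
qed

lemma higher_block_simps:
  "edges (H k) l = {gs. length gs = 2 * k - 1 \<and> is_path (textile_K A B \<kappa>) l gs}"
  "src (H k) = map (\<lambda>(f', f, e, e'). e)" "tgt (H k) = map (\<lambda>(f', f, e, e'). e')"
  "lab (H k) = map (\<lambda>(f', f, e, e'). (lab B f', lab B f, lab A e, lab A e'))"
  by (simp_all add: relative_higher_block_def lr_textile_def textile_K_def)

lemma textile_K_simps:
  "edges (textile_K A B \<kappa>) = sqs" "src (textile_K A B \<kappa>) (f', f, e, e') = f'" "tgt (textile_K A B \<kappa>) (f', f, e, e') = f"
  by (simp_all add: textile_K_def)

lemma config_strip_presented: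
  assumes "w \<in> configs"
  shows "config_strip k w \<in> presented_subshift (H k)"
  unfolding presented_subshift_def
proof (intro CollectI allI)
  fix i :: int and n :: nat
  let ?m = "2 * k - 1" and ?J = "1 - int k"
  \<comment> \<open>One more row and column than there are squares: the labels of right and bottom
    edges are read at the next column and row.\<close>
  have "realizes sqs (lab A) (lab B) w i ?J (Suc n) (Suc ?m)" using assms by (simp add: textile_configs_def)
  then obtain l e f where *: "patch sqs l (Suc n) (Suc ?m) e f"
    "\<And>r j. r < Suc n \<Longrightarrow> j < Suc ?m \<Longrightarrow> w (i + int r, ?J + int j) = (lab A (e r j), lab B (f r j))"
    unfolding realizes_def by blast
  define g where "g r j = (f r j, f r (Suc j), e r j, e (Suc r) j)" for r j
  have g: "g r j \<in> sqs (l + r + j)" if "r < Suc n" "j < Suc ?m" for r j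
    using *(1) that unfolding patch_def g_def by blast
  define es where "es = map (\<lambda>r. map (g r) [0..<?m]) [0..<n]"
  have "is_path (textile_K A B \<kappa>) (l + r) (map (g r) [0..<?m])" if "r < n" for r
    unfolding is_path_def using g that by (auto simp: textile_K_simps g_def)
  then have "is_path (H k) l es"
    by (subst is_path_def) (auto simp: es_def higher_block_simps g_def)
  moreover have "map (lab (H k)) es = map (\<lambda>j. config_strip k w (i + int j)) [0..<n]"
    unfolding es_def list.map_comp
  proof (rule map_cong[OF refl])
    fix r assume "r \<in> set [0..<n]"
    then have r: "r < n" by simp
    have "lab (H k) (map (g r) [0..<?m]) ! j = config_strip k w (i + int r) ! j" if j: "j < ?m" for j
    proof -
      have e: "?J + int (Suc j) = ?J + int j + 1" "i + int (Suc r) = i + int r + 1" by simp_all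
      have "w (i + int r, ?J + int j) = (lab A (e r j), lab B (f r j))"
        by (rule *(2)) (use j r in auto)
      moreover have "w (i + int r, ?J + int j + 1) = (lab A (e r (Suc j)), lab B (f r (Suc j)))"
        unfolding e(1)[symmetric] by (rule *(2)) (use j r in auto)
      moreover have "w (i + int r + 1, ?J + int j) = (lab A (e (Suc r) j), lab B (f (Suc r) j))"
        unfolding e(2)[symmetric] by (rule *(2)) (use j r in auto)
      ultimately show ?thesis using j by (simp add: higher_block_simps g_def config_strip_def Let_def)
    qed
    then show "(lab (H k) \<circ> (\<lambda>r. map (g r) [0..<?m])) r = config_strip k w (i + int r)"
      by (intro nth_equalityI) (auto simp: higher_block_simps config_strip_def)
  qed
  ultimately show "\<exists>l es. is_path (H k) l es \<and> map (lab (H k)) es = map (\<lambda>j. config_strip k w (i + int j)) [0..<n]"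
    by blast
qed

text \<open>Squares inside one edge of \<open>H k\<close> share vertical edges because they form a
  path in \<K>, and consecutive edges of \<open>H k\<close> share horizontal ones because terminal
  meets source. So the squares fit together.\<close>

lemma higher_block_path_patch:
  assumes p: "is_path (H k) l es" and len: "length es = m" and m: "0 < m" and k: "k \<ge> 1"
  shows "\<exists>e f. patch sqs l m (2 * k - 1) e f \<and> (\<forall>r<m. lab (H k) (es ! r) =
    map (\<lambda>i. (lab B (f r i), lab B (f r (Suc i)), lab A (e r i), lab A (e (Suc r) i))) [0..<2 * k - 1])"
proof -
  let ?n = "2 * k - 1"
  define g where "g r i = es ! r ! i" for r i
  \<comment> \<open>Beyond the last column, and for \<open>e\<close> beyond the last row, no square
    starts; the missing edges are the right and bottom edges of the last squares.\<close>
  define f where "f r i = (if i < ?n then fst (g r i) else fst (snd (g r (?n - 1))))" for r i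
  define e where "e r i = (if r < m then fst (snd (snd (g r i))) else snd (snd (snd (g (m - 1) i))))" for r i
  have row: "length (es ! r) = ?n" "is_path (textile_K A B \<kappa>) (l + r) (es ! r)" if "r < m" for r
    using p that len by (auto simp: is_path_def higher_block_simps)
  have g_sq: "g r i \<in> sqs (l + r + i)" if "r < m" "i < ?n" for r i
    using row[OF that(1)] that(2) by (auto simp: is_path_def textile_K_simps g_def)
  have g_row: "fst (snd (g r i)) = fst (g r (Suc i))" if "r < m" "Suc i < ?n" for r i
    using row[OF that(1)] that(2) by (simp add: is_path_def g_def textile_K_def case_prod_beta)
  have g_col: "snd (snd (snd (g r i))) = fst (snd (snd (g (Suc r) i)))" if "Suc r < m" "i < ?n" for r i
  proof -
    have "map (\<lambda>(f', f, e, e'). e') (es ! r) = map (\<lambda>(f', f, e, e'). e) (es ! Suc r)"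
      using p that len by (simp add: is_path_def higher_block_simps)
    from arg_cong[OF this, of "\<lambda>zs. zs ! i"] show ?thesis
      using row(1)[of r] row(1)[of "Suc r"] that by (simp add: g_def case_prod_beta)
  qed
  have fe: "(f r i, f r (Suc i), e r i, e (Suc r) i) = g r i" if "r < m" "i < ?n" for r i
  proof -
    have "f r (Suc i) = fst (snd (g r i))"
    proof (cases "Suc i < ?n")
      case False
      then have "f r (Suc i) = fst (snd (g r (?n - 1)))" by (simp add: f_def)
      also have "?n - 1 = i" using False that by simp
      finally show ?thesis .
    qed (use that g_row in \<open>simp add: f_def\<close>)
    moreover have "e (Suc r) i = snd (snd (snd (g r i)))"
    proof (cases "Suc r < m")
      case False
      then have "r = m - 1" using that by simp
      then show ?thesis using that by (simp add: e_def)
    qed (use that g_col in \<open>simp add: e_def\<close>)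
    ultimately show ?thesis using that by (simp add: f_def e_def)
  qed
  have "patch sqs l m ?n e f" unfolding patch_def using fe g_sq by simp
  moreover have "lab (H k) (es ! r) =
    map (\<lambda>i. (lab B (f r i), lab B (f r (Suc i)), lab A (e r i), lab A (e (Suc r) i))) [0..<?n]" if "r < m" for r
  proof (rule nth_equalityI)
    fix i assume "i < length (lab (H k) (es ! r))"
    then have i: "i < ?n" using row(1)[OF that] by (simp add: higher_block_simps)
    have "es ! r ! i = (f r i, f r (Suc i), e r i, e (Suc r) i)" using fe[OF that i] by (simp add: g_def)
    then show "lab (H k) (es ! r) ! i =
        map (\<lambda>i. (lab B (f r i), lab B (f r (Suc i)), lab A (e r i), lab A (e (Suc r) i))) [0..<?n] ! i"
      using i row(1)[OF that] by (simp add: higher_block_simps)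
  qed (use row(1)[OF that] in \<open>simp add: higher_block_simps\<close>)
  ultimately show ?thesis by blast
qed

lemma ex_config_strip:
  assumes y: "y \<in> presented_subshift (H k)" and k: "k \<ge> 1"
  shows "\<exists>w\<in>configs. config_strip k w = y"
proof -
  have "\<exists>w\<in>configs. \<forall>j. config_strip k w j = y j"
  proof (rule config_limit)
    show "finitely_determined (\<lambda>w :: int \<times> int \<Rightarrow> 'a \<times> 'b. config_strip k w j = y j)" for j
    proof (rule finitely_determinedI)
      let ?F = "{j..j + 1} \<times> {1 - int k..int k}"
      show "finite ?F" by simp
      fix v w :: "int \<times> int \<Rightarrow> 'a \<times> 'b" assume "\<forall>p\<in>?F. v p = w p"
      then have "config_strip k v j = config_strip k w j"
        unfolding config_strip_def Let_def by (intro map_cong) auto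
      then show "(config_strip k v j = y j) = (config_strip k w j = y j)" by simp
    qed
  next
    fix L0 :: nat
    \<comment> \<open>With \<open>h = L0 + 2\<close> columns added on either side, the width
      \<open>2 h + 2 k - 1\<close> equals the height \<open>2 L + 1\<close>. The \<open>L\<close>
      dropped edges raise the level by \<open>L = h + (k - 1)\<close>, enough for the
      \<open>h\<close> columns on the left.\<close>
    define L where "L = L0 + k + 1"
    let ?m = "2 * L + 1" and ?n = "2 * k - 1"
    obtain l es where es: "is_path (H k) l es" "map (lab (H k)) es = map (\<lambda>j. y (- int (2 * L) + int j)) [0..<3 * L + 1]"
      using y unfolding presented_subshift_def by blast
    have len: "length es = 3 * L + 1" using arg_cong[OF es(2), of length] by simp
    have lab: "lab (H k) (es ! j) = y (- int (2 * L) + int j)" if "j < 3 * L + 1" for j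
      using arg_cong[OF es(2), of "\<lambda>zs. zs ! j"] that len by (simp del: upt_Suc)
    have "is_path (H k) (l + L) (drop L es)"
      using es(1) len unfolding is_path_def by (simp add: add.assoc)
    from higher_block_path_patch[OF this _ _ k, of ?m] obtain e f where
      ef: "patch sqs (l + L) ?m ?n e f" "\<And>r. r < ?m \<Longrightarrow> lab (H k) (drop L es ! r) =
        map (\<lambda>i. (lab B (f r i), lab B (f r (Suc i)), lab A (e r i), lab A (e (Suc r) i))) [0..<?n]"
      using len by auto
    define h where "h = L0 + 2"
    have "l + L = (l + (k - 1)) + h" using k by (simp add: L_def h_def)
    then have "patch sqs ((l + (k - 1)) + h) ?m ?n e f" using ef(1) by (simp only:)
    from patch_columns[OF this, of h] k obtain e' f' where
      ef': "patch sqs (l + (k - 1)) ?m (h + ?n + h) e' f'"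
      "\<And>r i. r \<le> ?m \<Longrightarrow> i < ?n \<Longrightarrow> e' r (h + i) = e r i" "\<And>r i. r < ?m \<Longrightarrow> i \<le> ?n \<Longrightarrow> f' r (h + i) = f r i"
      by auto
    have hn: "h + ?n + h = ?m" using k by (simp add: h_def L_def)
    obtain w where w: "range w \<subseteq> S \<times> T" "realizes sqs (lab A) (lab B) w (- int L) (- int L) ?m ?m"
      "\<And>r i. r < ?m \<Longrightarrow> i < ?m \<Longrightarrow> w (- int L + int r, - int L + int i) = (lab A (e' r i), lab B (f' r i))"
      using config_of_patch[OF ef'(1)[unfolded hn], of "- int L" "- int L"] by auto
    have "config_strip k w j = y j" if j: "j \<in> {- int L0..int L0}" for j
    proof -
      define r where "r = nat (j + int L)"
      have r: "j = - int L + int r" "Suc r < ?m" using j by (auto simp: r_def L_def)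
      have J: "1 - int k = - int L + int h" by (simp add: h_def L_def)
      have "config_strip k w j = map (\<lambda>i. (lab B (f r i), lab B (f r (Suc i)), lab A (e r i), lab A (e (Suc r) i))) [0..<?n]"
        unfolding config_strip_def Let_def
      proof (rule map_cong[OF refl])
        fix i assume "i \<in> set [0..<?n]"
        then have i: "i < ?n" "h + Suc i < ?m" using hn by (auto simp: h_def)
        have e: "- int L + int (h + i) = 1 - int k + int i" "- int L + int (h + Suc i) = 1 - int k + int i + 1"
          "- int L + int r = j" "- int L + int (Suc r) = j + 1"
          using J r(1) by simp_all
        have "w (j, 1 - int k + int i) = (lab A (e r i), lab B (f r i))"
          using w(3)[of r "h + i", unfolded e] ef'(2)[of r i] ef'(3)[of r i] i r(2) by simp
        moreover have "w (j, 1 - int k + int i + 1) = (lab A (e' r (h + Suc i)), lab B (f r (Suc i)))"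
          using w(3)[of r "h + Suc i", unfolded e] ef'(3)[of r "Suc i"] i r(2) by simp
        moreover have "w (j + 1, 1 - int k + int i) = (lab A (e (Suc r) i), lab B (f' (Suc r) (h + i)))"
          using w(3)[of "Suc r" "h + i", unfolded e] ef'(2)[of "Suc r" i] i r(2) by simp
        ultimately show "(snd (w (j, 1 - int k + int i)), snd (w (j, 1 - int k + int i + 1)),
            fst (w (j, 1 - int k + int i)), fst (w (j + 1, 1 - int k + int i))) =
          (lab B (f r i), lab B (f r (Suc i)), lab A (e r i), lab A (e (Suc r) i))" by simp
      qed
      also have "\<dots> = lab (H k) (es ! (L + r))" using ef(2)[of r] r len by simp
      also have "\<dots> = y j"
      proof -
        have e: "- int (2 * L) + int (L + r) = j" using r by simp
        show ?thesis using lab[of "L + r", unfolded e] r(2) by simp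
      qed
      finally show ?thesis .
    qed
    moreover have "realizes sqs (lab A) (lab B) w (- int L0) (- int L0) (2 * L0 + 1) (2 * L0 + 1)"
      by (rule realizes_sub[OF w(2)]) (auto simp: L_def)
    ultimately show "\<exists>w. range w \<subseteq> S \<times> T \<and> realizes sqs (lab A) (lab B) w (- int L0) (- int L0) (2 * L0 + 1) (2 * L0 + 1) \<and>
        (\<forall>j\<in>{- int L0..int L0}. config_strip k w j = y j)" using w(1) by blast
  qed
  then show ?thesis by (auto simp: fun_eq_iff)
qed

end

section \<open>The conjugacy\<close>

context lgraph_textile
begin

text \<open>\<open>rule\<close> identifies \<phi> with the passage to the next row, while
  \<open>down\<close> and \<open>up\<close> express determinism of rows in both directions.
  \<open>up\<close> also makes \<phi> injective, as negative iterates require. The conjugacy is the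
  strip map after the inverse of reading row 0.\<close>

theorem topologically_conjugate_higher_block:
  assumes k: "k \<ge> 1"
    and expansive: "expansive_constant (presented_subshift A) \<phi> (1 / real k)"
    and rule: "\<And>x c x'. x \<in> presented_subshift A \<Longrightarrow> square_rule \<kappa> x c x' \<Longrightarrow> \<phi> x = x'"
    and down: "\<And>x c x' d y'. square_rule \<kappa> x c x' \<Longrightarrow> square_rule \<kappa> x d y' \<Longrightarrow> c = d \<and> x' = y'"
    and up: "\<And>x c x' y d. square_rule \<kappa> x c x' \<Longrightarrow> square_rule \<kappa> y d x' \<Longrightarrow> x = y"
  shows "topologically_conjugate (seq_topology (presented_subshift A)) \<phi>
    (seq_topology (presented_subshift (H k))) shift_map"
proof -
  let ?L = "presented_subshift A"
  let ?Om = "subtopology full_shift_topology configs :: (int \<times> int \<Rightarrow> 'a \<times> 'b) topology"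
  let ?row = "\<lambda>w :: int \<times> int \<Rightarrow> 'a \<times> 'b. config_row w 0"
  have step: "\<phi> (config_row w r) = config_row w (r + 1)" if "w \<in> configs" for w r
    using rule[OF config_row_presented config_square_rule] that by blast
  have rows: "v = w" if vw: "v \<in> configs" "w \<in> configs" "config_row v 0 = config_row w 0" for v w
  proof -
    have eq: "config_row v r = config_row w r" for r
    proof (induction r rule: int_induct[where k = 0])
      case (step1 r)
      then show ?case using step[OF vw(1), of r] step[OF vw(2), of r] by simp
    next
      case (step2 r)
      then show ?case
        using up config_square_rule[OF vw(1), of "r - 1"] config_square_rule[OF vw(2), of "r - 1"] by simp
    qed (rule vw(3))
    have "config_col v r = config_col w r" for r
      using down config_square_rule[OF vw(1), of r] config_square_rule[OF vw(2), of r] eq by metis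
    then show ?thesis using eq
      by (auto simp: fun_eq_iff config_row_def config_col_def prod_eq_iff)
  qed
  \<comment> \<open>Both points are extended to configurations, whose rows 1 are their images;
    \<open>up\<close> then leads back to rows 0.\<close>
  have inj: "inj_on \<phi> ?L"
  proof (rule inj_onI)
    fix x y assume xy: "x \<in> ?L" "y \<in> ?L" "\<phi> x = \<phi> y"
    obtain v w where vw: "v \<in> configs" "?row v = x" "w \<in> configs" "?row w = y"
      using ex_config_row xy by blast
    then show "x = y"
      using up config_square_rule[OF vw(1), of 0] config_square_rule[OF vw(3), of 0]
        step[OF vw(1), of 0] step[OF vw(3), of 0] xy(3) by simp
  qed
  have iterate: "int_iterate ?L \<phi> i (?row w) = config_row w i" if w: "w \<in> configs" for w i
  proof -
    have "(\<phi> ^^ n) (?row w) = config_row w (int n)" for n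
      by (induction n) (simp_all add: step[OF w] add.commute)
    \<comment> \<open>By injectivity \<open>inv_into\<close> picks exactly the row above.\<close>
    moreover have "(inv_into ?L \<phi> ^^ n) (?row w) = config_row w (- int n)" for n
    proof (induction n)
      case (Suc n)
      have "inv_into ?L \<phi> (\<phi> (config_row w (- int (Suc n)))) = config_row w (- int (Suc n))"
        by (rule inv_into_f_f[OF inj config_row_presented[OF w]])
      then show ?case using Suc step[OF w, of "- int (Suc n)"] by simp
    qed simp
    ultimately show ?thesis by (auto simp: int_iterate_def)
  qed
  have row_homeo: "homeomorphic_map ?Om (seq_topology ?L) ?row"
  proof (rule homeomorphic_map_finitely_determined[OF compactin_configs])
    show "finitely_determined (\<lambda>w. config_row w 0 j)" for j
      by (rule finitely_determinedI[of "{(0, j)}"]) (auto simp: config_row_def)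
    show "?row ` configs = ?L" using ex_config_row config_row_presented by blast
    show "inj_on ?row configs" using rows by (auto intro!: inj_onI)
  qed
  have strip_inj: "inj_on (config_strip k) configs"
  proof (rule inj_onI, rule ccontr)
    fix v w assume vw: "v \<in> configs" "w \<in> configs" "config_strip k v = config_strip k w" "v \<noteq> w"
    then have "?row v \<noteq> ?row w" using rows by blast
    then obtain i where i: "seq_dist (config_row v i) (config_row w i) \<ge> 1 / real k"
      using expansive config_row_presented vw(1,2) iterate unfolding expansive_constant_def by metis
    \<comment> \<open>Equal rows would have distance 0, below the positive bound
      \<open>1/k\<close>.\<close>
    have "config_row v i \<noteq> config_row w i"
    proof
      assume "config_row v i = config_row w i"
      then show False using i k by (simp add: seq_dist_def)
    qed
    then obtain j where j: "config_row v i j \<noteq> config_row w i j" "\<bar>j\<bar> < int k"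
      using seq_dist_ge[OF _ i k] by blast
    \<comment> \<open>The strip begins at column \<open>1 - k\<close>, so column \<open>j\<close>
      has list position \<open>j - 1 + k\<close>.\<close>
    define n where "n = nat (j - 1 + int k)"
    have n: "n < 2 * k - 1" "1 - int k + int n = j" using j(2) by (auto simp: n_def)
    have "config_strip k v i ! n = config_strip k w i ! n" using vw(3) by simp
    then show False using n j(1) by (simp add: config_strip_def Let_def config_row_def)
  qed
  have strip_homeo: "homeomorphic_map ?Om (seq_topology (presented_subshift (H k))) (config_strip k)"
  proof (rule homeomorphic_map_finitely_determined[OF compactin_configs _ _ strip_inj])
    show "finitely_determined (\<lambda>w :: int \<times> int \<Rightarrow> 'a \<times> 'b. config_strip k w j)" for j
    proof (rule finitely_determinedI)
      let ?F = "{j..j + 1} \<times> {1 - int k..int k}"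
      show "finite ?F" by simp
      fix v w :: "int \<times> int \<Rightarrow> 'a \<times> 'b" assume "\<forall>p\<in>?F. v p = w p"
      then show "config_strip k v j = config_strip k w j"
        unfolding config_strip_def Let_def by (intro map_cong) auto
    qed
    show "config_strip k ` configs = presented_subshift (H k)"
      using ex_config_strip[OF _ k] config_strip_presented by blast
  qed
  obtain g where g: "homeomorphic_maps ?Om (seq_topology ?L) ?row g"
    using row_homeo homeomorphic_map_maps by blast
  then have g_homeo: "homeomorphic_map (seq_topology ?L) ?Om g"
    and g_row: "\<And>x. x \<in> ?L \<Longrightarrow> ?row (g x) = x" and row_g: "\<And>w. w \<in> configs \<Longrightarrow> g (?row w) = w"
    unfolding homeomorphic_maps_map by simp_all
  have g_in: "g x \<in> configs" if x: "x \<in> ?L" for x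
    using ex_config_row[OF x] row_g by auto
  \<comment> \<open>\<open>g x\<close> is the configuration through \<open>x\<close>. Moved by one
    row it has row 0 equal to \<open>\<phi> x\<close>, hence is \<open>g (\<phi> x)\<close>; on
    strips the same move is the shift.\<close>
  have "config_strip k (g (\<phi> x)) = shift_map (config_strip k (g x))" if x: "x \<in> ?L" for x
  proof -
    let ?w = "\<lambda>(r, i). g x (r + 1, i)"
    have w: "?w \<in> configs" by (rule textile_configs_shift[OF g_in[OF x]])
    have "?row ?w = config_row (g x) (0 + 1)" by (simp add: config_row_def)
    also have "\<dots> = \<phi> x" using step[OF g_in[OF x], of 0] g_row[OF x] by simp
    finally have "g (\<phi> x) = ?w" using row_g[OF w] by simp
    then show ?thesis by (simp add: config_strip_def shift_map_def fun_eq_iff Let_def)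
  qed
  then show ?thesis
    unfolding topologically_conjugate_def
    using homeomorphic_map_compose[OF g_homeo strip_homeo] by (intro exI[of _ "config_strip k \<circ> g"]) simp
qed

end

text \<open>The ends of a path \<open>e f\<close> lie in the relation of \<open>(a, b)\<close> for
  the product of \<open>A\<close> and \<open>B\<close>. The specified equivalence puts them into the
  relation of the image word for the product in the other order, which supplies the missing corner;
  the converse is alike.\<close>

lemma lambda_graph_textile:
  assumes eq: "specified_equivalence S T A B I \<kappa>"
  shows "lgraph_textile (lambda_graph A I) (lambda_graph B I) \<kappa> S T"
proof -
  obtain m where smsA: "sms m S A I" using eq unfolding specified_equivalence_def symbolic_matrix_system_sms by blast
  obtain m' where smsB: "sms m' T B I" using eq unfolding specified_equivalence_def symbolic_matrix_system_sms by blast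
  \<comment> \<open>Both systems have the same \<open>I\<close>, whose row numbers are the level
    sizes.\<close>
  have "m' = m"
    by (rule ext) (metis smsD(4)[OF smsA] smsD(4)[OF smsB] carrier_matD(1))
  note smsB = smsB[unfolded this]
  have inj: "inj_on \<kappa> (dom \<kappa>)" using eq unfolding specified_equivalence_def specification_map_def by blast
  have equiv: "smat_equiv \<kappa> (A l \<odot> B (l + 1)) (B l \<odot> A (l + 1))" for l
    using eq unfolding specified_equivalence_def by blast
  have dims: "dim_col (A l) = dim_row (B (l + 1))" "dim_col (B l) = dim_row (A (l + 1))" for l
    using smsD(2)[OF smsA, of l] smsD(2)[OF smsA, of "l + 1"] smsD(2)[OF smsB, of l] smsD(2)[OF smsB, of "l + 1"]
    by (metis carrier_matD)+
  let ?A = "lambda_graph A I" and ?B = "lambda_graph B I"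
  have sqs: "((i1, b', j1), (i2, b, j2), (i3, a, j3), (i4, a', j4)) \<in> textile_squares ?A ?B \<kappa> l \<longleftrightarrow>
     (i1, j1) \<in> ent (B l) b' \<and> (i2, j2) \<in> ent (B (Suc l)) b \<and> (i3, j3) \<in> ent (A l) a \<and> (i4, j4) \<in> ent (A (Suc l)) a' \<and>
     i3 = i1 \<and> j3 = i2 \<and> j1 = i4 \<and> j4 = j2 \<and> \<kappa> (a, b) = Some (b', a')"
    for i1 b' j1 i2 b j2 i3 a j3 i4 a' j4 l
    by (simp add: textile_squares_def lambda_graph_simps)
  have ents: "ent (B l \<odot> A (l + 1)) y = (\<Union>x\<in>{x. \<kappa> x = Some y}. ent (A l \<odot> B (l + 1)) x)" for y l
    by (rule ent_smat_equiv[OF equiv])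
  show ?thesis
    unfolding lgraph_textile_def
  proof (unfold_locales, goal_cases)
    case (1 f' f e e' l)
    then show ?case by (auto simp: textile_squares_def)
  next
    case (2 e l f)
    obtain i a j j' b h where ef: "e = (i, a, j)" "f = (j', b, h)" by (cases e, cases f)
    with 2 have *: "(i, j) \<in> ent (A l) a" "(j, h) \<in> ent (B (l + 1)) b" "j' = j" by (auto simp: lambda_graph_simps)
    then have AB: "(i, h) \<in> ent (A l \<odot> B (l + 1)) (a, b)" using ent_smat_mult[OF dims(1)] by blast
    then have "(a, b) \<in> symbols (A l \<odot> B (l + 1))" unfolding symbols_iff by blast
    then have "(a, b) \<in> dom \<kappa>" using equiv[of l] unfolding smat_equiv_def by (elim conjE) (rule subsetD)
    then obtain b' a' where \<kappa>: "\<kappa> (a, b) = Some (b', a')" by auto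
    then have "(i, h) \<in> ent (B l \<odot> A (l + 1)) (b', a')" unfolding ents using AB by blast
    then obtain g where "(i, g) \<in> ent (B l) b'" "(g, h) \<in> ent (A (l + 1)) a'"
      unfolding ent_smat_mult[OF dims(2)] by blast
    then have "((i, b', g), f, e, (g, a', h)) \<in> textile_squares ?A ?B \<kappa> l"
      using * \<kappa> by (simp add: ef sqs)
    then show ?case by blast
  next
    case (3 f' l e')
    obtain i b' j j' a' h where ef: "f' = (i, b', j)" "e' = (j', a', h)" by (cases f', cases e')
    with 3 have *: "(i, j) \<in> ent (B l) b'" "(j, h) \<in> ent (A (l + 1)) a'" "j' = j" by (auto simp: lambda_graph_simps)
    then have "(i, h) \<in> ent (B l \<odot> A (l + 1)) (b', a')" using ent_smat_mult[OF dims(2)] by blast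
    then obtain a b where \<kappa>: "\<kappa> (a, b) = Some (b', a')" and "(i, h) \<in> ent (A l \<odot> B (l + 1)) (a, b)"
      unfolding ents by auto
    then obtain g where "(i, g) \<in> ent (A l) a" "(g, h) \<in> ent (B (l + 1)) b"
      unfolding ent_smat_mult[OF dims(1)] by blast
    then have "(f', (g, b, h), (i, a, g), e') \<in> textile_squares ?A ?B \<kappa> l"
      using * \<kappa> by (simp add: ef sqs)
    then show ?case by blast
  next
    case (4 e l)
    obtain i a j where e: "e = (i, a, j)" by (cases e)
    with 4 have "j < m (l + 1)" using ent_bounds_sms[OF smsA, of i j l a] by (simp add: lambda_graph_simps)
    then obtain b h where "(j, h) \<in> ent (B (l + 1)) b" using smsD(7)[OF smsB, of "l + 1"] by (auto simp: full_def)
    then show ?case by (intro bexI[of _ "(j, b, h)"]) (simp_all add: e lambda_graph_simps)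
  next
    case (5 e l)
    obtain i a j where e: "e = (i, a, j)" by (cases e)
    with 5 have "j < m (l + 1)" using ent_bounds_sms[OF smsB, of i j l a] by (simp add: lambda_graph_simps)
    then obtain b h where "(j, h) \<in> ent (A (l + 1)) b" using smsD(7)[OF smsA, of "l + 1"] by (auto simp: full_def)
    then show ?case by (intro bexI[of _ "(j, b, h)"]) (simp_all add: e lambda_graph_simps)
  next
    case (6 e l)
    obtain i a j where e: "e = (i, a, j)" by (cases e)
    with 6 have "i < m (l + 1)" using ent_bounds_sms[OF smsA, of i j "l + 1" a] by (simp add: lambda_graph_simps)
    then obtain b h where "(h, i) \<in> ent (B l) b" using smsD(7)[OF smsB, of l] by (auto simp: full_def)
    then show ?case by (intro bexI[of _ "(h, b, i)"]) (simp_all add: e lambda_graph_simps)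
  next
    case (7 e l)
    obtain i a j where e: "e = (i, a, j)" by (cases e)
    with 7 have "i < m (l + 1)" using ent_bounds_sms[OF smsB, of i j "l + 1" a] by (simp add: lambda_graph_simps)
    then obtain b h where "(h, i) \<in> ent (A l) b" using smsD(7)[OF smsA, of l] by (auto simp: full_def)
    then show ?case by (intro bexI[of _ "(h, b, i)"]) (simp_all add: e lambda_graph_simps)
  next
    case (8 e l)
    then show ?case using smsD(3)[OF smsA, of l] by (cases e) (auto simp: lambda_graph_simps subset_eq symbols_iff)
  next
    case (9 f l)
    then show ?case using smsD(3)[OF smsB, of l] by (cases f) (auto simp: lambda_graph_simps subset_eq symbols_iff)
  qed (rule smsD(1)[OF smsA] smsD(1)[OF smsB])+
qed

section \<open>Rows related by the composed specification and the forward automorphism\<close>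

definition sse_step_map :: "('a \<rightharpoonup> 'c \<times> 'd) \<Rightarrow> ('a \<rightharpoonup> 'd \<times> 'c) \<Rightarrow> (int \<Rightarrow> 'a) \<Rightarrow> (int \<Rightarrow> 'a)" where
  "sse_step_map \<kappa>\<^sub>0 \<kappa>\<^sub>1 = spec_act (spec_inv \<kappa>\<^sub>1) \<circ> zeta_plus \<circ> spec_act \<kappa>\<^sub>0"

lemma forward_automorphism_fold:
  "forward_automorphism n \<kappa>\<^sub>0 \<kappa>\<^sub>1 = fold (\<lambda>(\<kappa>, \<kappa>'). sse_step_map \<kappa> \<kappa>') (map (\<lambda>j. (\<kappa>\<^sub>0 j, \<kappa>\<^sub>1 j)) [Suc 0..<Suc 0 + n])"
  by (induction n) (simp_all add: sse_step_map_def)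

text \<open>Splits off the first step: \<open>z\<close> is the intermediate row after it, and
  \<open>c0\<close> consists of the first letters of the words in \<open>c\<close>. The rule at
  \<open>i\<close> takes the letter \<open>c0 (i + 1)\<close> and returns
  \<open>c0 i\<close>.\<close>

lemma square_rule_Cons:
  assumes "square_rule (kappa_P_list ((\<kappa>\<^sub>0, \<kappa>\<^sub>1) # \<kappa>s)) x c x'" "inj_on \<kappa>\<^sub>1 (dom \<kappa>\<^sub>1)"
  obtains c0 d z c' where "\<And>i. c i = c0 i # c' i" "\<And>i. \<kappa>\<^sub>0 (x i) = Some (c0 i, d i)"
    "\<And>i. \<kappa>\<^sub>1 (z i) = Some (d i, c0 (i + 1))" "square_rule (kappa_P_list \<kappa>s) z c' x'"
proof -
  have "\<forall>i. \<exists>e e' d a' cs0 cs0'. c (i + 1) = e # cs0 \<and> c i = e' # cs0' \<and> \<kappa>\<^sub>0 (x i) = Some (e', d) \<and>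
      \<kappa>\<^sub>1 a' = Some (d, e) \<and> kappa_P_list \<kappa>s (a', cs0) = Some (cs0', x' i)"
    using assms(1) unfolding square_rule_def kappa_P_list_Cons[OF assms(2)] .
  then have "\<forall>i. \<exists>d z. c i = hd (c i) # tl (c i) \<and> \<kappa>\<^sub>0 (x i) = Some (hd (c i), d) \<and>
      \<kappa>\<^sub>1 z = Some (d, hd (c (i + 1))) \<and> kappa_P_list \<kappa>s (z, tl (c (i + 1))) = Some (tl (c i), x' i)"
    by (metis list.sel(1,3))
  then obtain d z where "\<And>i. c i = hd (c i) # tl (c i)" "\<And>i. \<kappa>\<^sub>0 (x i) = Some (hd (c i), d i)"
      "\<And>i. \<kappa>\<^sub>1 (z i) = Some (d i, hd (c (i + 1)))"
      "\<And>i. kappa_P_list \<kappa>s (z i, tl (c (i + 1))) = Some (tl (c i), x' i)"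
    by metis
  then show thesis
    by (intro that[of "\<lambda>i. hd (c i)" "\<lambda>i. tl (c i)" d z]) (auto simp: square_rule_def)
qed

text \<open>\<open>\<kappa>\<^sub>0 (x i)\<close> shows \<open>c0 i\<close> and \<open>d i\<close>,
  so the first letters of \<open>c\<close> depend on \<open>x\<close> alone. The intermediate row is
  then forced by the pairs \<open>(d i, c0 (i + 1))\<close>, which are those of
  \<open>zeta_plus\<close>; the tail of the list is treated in the same way.\<close>

lemma square_rule_kappa_P_list_down:
  assumes "\<And>\<kappa>\<^sub>0 \<kappa>\<^sub>1. (\<kappa>\<^sub>0, \<kappa>\<^sub>1) \<in> set \<kappa>s \<Longrightarrow> inj_on \<kappa>\<^sub>1 (dom \<kappa>\<^sub>1)"
    and "square_rule (kappa_P_list \<kappa>s) x c x'"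
  shows "x' = fold (\<lambda>(\<kappa>, \<kappa>'). sse_step_map \<kappa> \<kappa>') \<kappa>s x"
    and "square_rule (kappa_P_list \<kappa>s) x d y' \<Longrightarrow> c = d"
proof -
  have "x' = fold (\<lambda>(\<kappa>, \<kappa>'). sse_step_map \<kappa> \<kappa>') \<kappa>s x \<and> (\<forall>d y'. square_rule (kappa_P_list \<kappa>s) x d y' \<longrightarrow> c = d)"
    using assms
  proof (induction \<kappa>s arbitrary: x c)
    case Nil
    then show ?case by (auto simp: square_rule_def kappa_P_list_Nil fun_eq_iff)
  next
    case (Cons p \<kappa>s)
    obtain \<kappa>\<^sub>0 \<kappa>\<^sub>1 where p: "p = (\<kappa>\<^sub>0, \<kappa>\<^sub>1)" by (cases p)
    have inj: "inj_on \<kappa>\<^sub>1 (dom \<kappa>\<^sub>1)" using Cons.prems(1) p by auto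
    have z: "z = sse_step_map \<kappa>\<^sub>0 \<kappa>\<^sub>1 x"
      if "\<And>i. \<kappa>\<^sub>0 (x i) = Some (c0 i, d0 i)" "\<And>i. \<kappa>\<^sub>1 (z i) = Some (d0 i, c0 (i + 1))" for c0 d0 z
    proof
      fix i
      have "spec_inv \<kappa>\<^sub>1 (d0 i, c0 (i + 1)) = Some (z i)" using that(2) spec_inv_iff[OF inj] by blast
      then show "z i = sse_step_map \<kappa>\<^sub>0 \<kappa>\<^sub>1 x i"
        using that(1) by (simp add: sse_step_map_def spec_act_def zeta_plus_def)
    qed
    obtain c0 d0 z c' where 1: "\<And>i. c i = c0 i # c' i" "\<And>i. \<kappa>\<^sub>0 (x i) = Some (c0 i, d0 i)"
      "\<And>i. \<kappa>\<^sub>1 (z i) = Some (d0 i, c0 (i + 1))" "square_rule (kappa_P_list \<kappa>s) z c' x'"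
      using square_rule_Cons[OF Cons.prems(2)[unfolded p] inj] by metis
    have IH: "x' = fold (\<lambda>(\<kappa>, \<kappa>'). sse_step_map \<kappa> \<kappa>') \<kappa>s z"
      "\<And>d y'. square_rule (kappa_P_list \<kappa>s) z d y' \<Longrightarrow> c' = d"
    proof -
      have tl: "\<And>\<kappa>\<^sub>0 \<kappa>\<^sub>1. (\<kappa>\<^sub>0, \<kappa>\<^sub>1) \<in> set \<kappa>s \<Longrightarrow> inj_on \<kappa>\<^sub>1 (dom \<kappa>\<^sub>1)"
        using Cons.prems(1) by (meson list.set_intros(2))
      have "x' = fold (\<lambda>(\<kappa>, \<kappa>'). sse_step_map \<kappa> \<kappa>') \<kappa>s z \<and>
          (\<forall>d y'. square_rule (kappa_P_list \<kappa>s) z d y' \<longrightarrow> c' = d)"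
        by (rule Cons.IH[OF _ 1(4)]) (rule tl)
      then show "x' = fold (\<lambda>(\<kappa>, \<kappa>'). sse_step_map \<kappa> \<kappa>') \<kappa>s z"
        "\<And>d y'. square_rule (kappa_P_list \<kappa>s) z d y' \<Longrightarrow> c' = d" by blast+
    qed
    have "c = d" if sq: "square_rule (kappa_P_list (p # \<kappa>s)) x d y'" for d y'
    proof -
      obtain c2 d2 z2 c2' where 2: "\<And>i. d i = c2 i # c2' i" "\<And>i. \<kappa>\<^sub>0 (x i) = Some (c2 i, d2 i)"
        "\<And>i. \<kappa>\<^sub>1 (z2 i) = Some (d2 i, c2 (i + 1))" "square_rule (kappa_P_list \<kappa>s) z2 c2' y'"
        using square_rule_Cons[OF sq[unfolded p] inj] by metis
      have "z2 = z" using z[OF 1(2,3)] z[OF 2(2,3)] by simp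
      then have "c' = c2'" using IH(2) 2(4) by blast
      moreover have "c0 i = c2 i" for i using 1(2)[of i] 2(2)[of i] by simp
      ultimately show ?thesis using 1(1) 2(1) by (simp add: fun_eq_iff)
    qed
    then show ?case using IH(1) z[OF 1(2,3)] by (simp add: p)
  qed
  then show "x' = fold (\<lambda>(\<kappa>, \<kappa>'). sse_step_map \<kappa> \<kappa>') \<kappa>s x"
    "square_rule (kappa_P_list \<kappa>s) x d y' \<Longrightarrow> c = d" by blast+
qed

text \<open>The lower row determines the intermediate row by induction, this determines
  \<open>d0\<close> and \<open>c0\<close>, and injectivity of \<open>\<kappa>\<^sub>0\<close> gives
  the upper row.\<close>

lemma square_rule_kappa_P_list_up:
  assumes "\<And>\<kappa>\<^sub>0 \<kappa>\<^sub>1. (\<kappa>\<^sub>0, \<kappa>\<^sub>1) \<in> set \<kappa>s \<Longrightarrow> inj_on \<kappa>\<^sub>0 (dom \<kappa>\<^sub>0) \<and> inj_on \<kappa>\<^sub>1 (dom \<kappa>\<^sub>1)"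
    and "square_rule (kappa_P_list \<kappa>s) x c x'" "square_rule (kappa_P_list \<kappa>s) y d x'"
  shows "x = y"
  using assms
proof (induction \<kappa>s arbitrary: x c y d)
  case Nil
  then show ?case by (auto simp: square_rule_def kappa_P_list_Nil fun_eq_iff)
next
  case (Cons p \<kappa>s)
  obtain \<kappa>\<^sub>0 \<kappa>\<^sub>1 where p: "p = (\<kappa>\<^sub>0, \<kappa>\<^sub>1)" by (cases p)
  have inj: "inj_on \<kappa>\<^sub>0 (dom \<kappa>\<^sub>0)" "inj_on \<kappa>\<^sub>1 (dom \<kappa>\<^sub>1)" using Cons.prems(1) p by auto
  obtain c0 d0 z c' where 1: "\<And>i. c i = c0 i # c' i" "\<And>i. \<kappa>\<^sub>0 (x i) = Some (c0 i, d0 i)"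
    "\<And>i. \<kappa>\<^sub>1 (z i) = Some (d0 i, c0 (i + 1))" "square_rule (kappa_P_list \<kappa>s) z c' x'"
    using square_rule_Cons[OF Cons.prems(2)[unfolded p] inj(2)] by metis
  obtain c2 d2 z2 c2' where 2: "\<And>i. d i = c2 i # c2' i" "\<And>i. \<kappa>\<^sub>0 (y i) = Some (c2 i, d2 i)"
    "\<And>i. \<kappa>\<^sub>1 (z2 i) = Some (d2 i, c2 (i + 1))" "square_rule (kappa_P_list \<kappa>s) z2 c2' x'"
    using square_rule_Cons[OF Cons.prems(3)[unfolded p] inj(2)] by metis
  have "\<And>\<kappa>\<^sub>0 \<kappa>\<^sub>1. (\<kappa>\<^sub>0, \<kappa>\<^sub>1) \<in> set \<kappa>s \<Longrightarrow> inj_on \<kappa>\<^sub>0 (dom \<kappa>\<^sub>0) \<and> inj_on \<kappa>\<^sub>1 (dom \<kappa>\<^sub>1)"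
    using Cons.prems(1) by (meson list.set_intros(2))
  then have "z = z2" by (rule Cons.IH[OF _ 1(4) 2(4)])
  then have "d0 i = d2 i \<and> c0 (i + 1) = c2 (i + 1)" for i using 1(3)[of i] 2(3)[of i] by simp
  \<comment> \<open>The intermediate row shows \<open>c0\<close> at \<open>i + 1\<close>; rows are
    two-sided, so every index is reached.\<close>
  then have "d0 i = d2 i" "c0 i = c2 i" for i by (metis, metis diff_add_cancel)
  then have "\<kappa>\<^sub>0 (x i) = \<kappa>\<^sub>0 (y i)" for i using 1(2) 2(2) by simp
  then show ?case using inj(1) 1(2) by (metis domI ext inj_onD)
qed

text \<open>Step \<open>j\<close> is entered at level \<open>N * l + (j - 1)\<close>, and doubling
  this level gives the two indices in \<open>P_pow\<close>.\<close>

lemma P_pow_levels: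
  assumes "\<And>j l. F j l = P j (2 * l) \<odot>\<^sub>r Y j (2 * l + 1)"
  shows "P_pow N P Y l = word_prod (levels (map F [Suc 0..<Suc 0 + N]) (N * l))"
proof -
  have "map (\<lambda>j. P j (2 * N * l + 2 * j - 2) \<odot>\<^sub>r Y j (2 * N * l + 2 * j - 1)) [1..<N + 1] =
      map (\<lambda>j. F j (N * l + (j - Suc 0))) [Suc 0..<Suc 0 + N]"
  proof (rule map_cong)
    fix j assume "j \<in> set [Suc 0..<Suc 0 + N]"
    then have "Suc 0 \<le> j" by auto
    then obtain i where j: "j = Suc i" by (metis Suc_le_D)
    have "2 * N * l + 2 * j - 2 = 2 * (N * l + (j - Suc 0))" "2 * N * l + 2 * j - 1 = 2 * (N * l + (j - Suc 0)) + 1"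
      by (simp_all add: j)
    then show "P j (2 * N * l + 2 * j - 2) \<odot>\<^sub>r Y j (2 * N * l + 2 * j - 1) = F j (N * l + (j - Suc 0))"
      by (simp only: assms)
  qed simp
  then show ?thesis unfolding P_pow_def levels_map_upt by (simp only:)
qed

theorem theorem7p6:
  fixes N k :: nat
    and S :: "'a set" and M :: "nat \<Rightarrow> 'a smat" and I :: "nat \<Rightarrow> nat mat"
    and Ss :: "nat \<Rightarrow> 'a set" and Ms :: "nat \<Rightarrow> nat \<Rightarrow> 'a smat" and Is :: "nat \<Rightarrow> nat \<Rightarrow> nat mat"
    and C :: "nat \<Rightarrow> 'c set" and D :: "nat \<Rightarrow> 'd set"
    and \<kappa>\<^sub>0 :: "nat \<Rightarrow> 'a \<rightharpoonup> 'c \<times> 'd" and \<kappa>\<^sub>1 :: "nat \<Rightarrow> 'a \<rightharpoonup> 'd \<times> 'c"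
    and P :: "nat \<Rightarrow> nat \<Rightarrow> 'c smat" and Q :: "nat \<Rightarrow> nat \<Rightarrow> 'd smat"
    and X Y :: "nat \<Rightarrow> nat \<Rightarrow> nat mat"
    and \<Lambda> :: "(int \<Rightarrow> 'a) set" and \<phi> :: "(int \<Rightarrow> 'a) \<Rightarrow> (int \<Rightarrow> 'a)"
  assumes "symbolic_matrix_system S M I"
    and "\<Lambda> = presented_subshift (lambda_graph M I)"
    and "N \<ge> 1"
    and "proper_sse_chain N Ss Ms Is C D \<kappa>\<^sub>0 \<kappa>\<^sub>1 P Q X Y"
    and "Ss 0 = S" "Ms 0 = M" "Is 0 = I"
    and "Ss N = S" "Ms N = M" "Is N = I"
    and "\<forall>x\<in>\<Lambda>. \<phi> x = forward_automorphism N \<kappa>\<^sub>0 \<kappa>\<^sub>1 x"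
    and "k \<ge> 1"
    and "expansive_constant \<Lambda> \<phi> (1 / real k)"
  shows "specified_equivalence S (listset (map C [1..<N + 1]))
           (M_pow N M I) (P_pow N P Y) (I_pow N I) (kappa_P N \<kappa>\<^sub>0 \<kappa>\<^sub>1) \<and>
         topologically_conjugate (seq_topology \<Lambda>) \<phi>
           (seq_topology (presented_subshift (relative_higher_block (2 * k)
              (lr_textile (lambda_graph (M_pow N M I) (I_pow N I))
                 (lambda_graph (P_pow N P Y) (I_pow N I)) (kappa_P N \<kappa>\<^sub>0 \<kappa>\<^sub>1)))))
           shift_map"
proof -
  have N: "N \<ge> 1" by (rule assms(3))
  have chain: "symbolic_matrix_system (Ss j) (Ms j) (Is j)" if "j \<le> N" for j
    using assms(4) that unfolding proper_sse_chain_def by blast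
  have sse: "proper_sse_1 (Ss j) (Ms j) (Is j) (Ss (Suc j)) (Ms (Suc j)) (Is (Suc j))
      (C (Suc j)) (D (Suc j)) (\<kappa>\<^sub>0 (Suc j)) (\<kappa>\<^sub>1 (Suc j)) (P (Suc j)) (Q (Suc j)) (X (Suc j)) (Y (Suc j))"
    if "j < N" for j
  proof -
    have "Suc j \<in> {1..N}" using that by simp
    then show ?thesis using assms(4) unfolding proper_sse_chain_def by (metis diff_Suc_1)
  qed
  \<comment> \<open>Each system of the chain provides its level sizes only existentially. Reading
    them off the matrices yields one family, with equal sizes at both ends of the chain.\<close>
  define m where "m = (\<lambda>j l. dim_row (Ms j l))"
  define F where "F = (\<lambda>j l. P j (2 * l) \<odot>\<^sub>r Y j (2 * l + 1))"
  have sms: "sms (m j) (Ss j) (Ms j) (Is j)" if j: "j \<le> N" for j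
  proof -
    obtain m' where m': "sms m' (Ss j) (Ms j) (Is j)"
      using chain[OF j] unfolding symbolic_matrix_system_sms by blast
    show ?thesis using m' unfolding sms_unique[OF m'] m_def .
  qed
  interpret closed_textile_chain N m Ss Ms Is C D \<kappa>\<^sub>0 \<kappa>\<^sub>1 F S M I "m 0"
  proof unfold_locales
    fix j assume j: "j < N"
    show "textile_step (m j) (Ms j) (Is j) (m (Suc j)) (Ms (Suc j)) (Is (Suc j)) (C (Suc j))
        (\<kappa>\<^sub>0 (Suc j)) (\<kappa>\<^sub>1 (Suc j)) (F (Suc j))"
      by (rule proper_sse_1_textile_step[OF sms sms sse]) (use j in \<open>simp_all add: F_def\<close>)
    show "specification_map (Ss j) (C (Suc j) \<times> D (Suc j)) (\<kappa>\<^sub>0 (Suc j))"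
      "specification_map (Ss (Suc j)) (D (Suc j) \<times> C (Suc j)) (\<kappa>\<^sub>1 (Suc j))" "finite (C (Suc j))"
      using sse[OF j] unfolding proper_sse_1_def by blast+
  next
    show "sms (m 0) S M I" using sms[of 0] assms(5-7) by simp
  qed (use N assms(5-10) in \<open>simp_all add: m_def\<close>)
  have B: "P_pow N P Y = B"
    by (rule ext) (rule P_pow_levels, simp add: F_def)
  have T: "listset (map C [1..<N + 1]) = T" and K: "kappa_P N \<kappa>\<^sub>0 \<kappa>\<^sub>1 = K"
    by (simp_all add: kappa_P_def)
  have eq: "specified_equivalence S T (M_pow N M I) (P_pow N P Y) (I_pow N I) (kappa_P N \<kappa>\<^sub>0 \<kappa>\<^sub>1)"
    using specified_equivalence_K unfolding B K .
  interpret L: lgraph_textile "lambda_graph (M_pow N M I) (I_pow N I)" "lambda_graph (P_pow N P Y) (I_pow N I)"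
    "kappa_P N \<kappa>\<^sub>0 \<kappa>\<^sub>1" S T
    by (rule lambda_graph_textile[OF eq])
  have \<Lambda>: "presented_subshift (lambda_graph (M_pow N M I) (I_pow N I)) = \<Lambda>"
    unfolding assms(2) by (rule presented_subshift_pow[OF closed_textile_chain.sms[OF closed_textile_chain_axioms] N])
  have inj: "inj_on \<kappa> (dom \<kappa>) \<and> inj_on \<kappa>' (dom \<kappa>')" if mem: "(\<kappa>, \<kappa>') \<in> set (\<kappa>s 0 N)" for \<kappa> \<kappa>'
  proof -
    obtain i where i: "i \<in> set [Suc 0..<Suc 0 + N]" "\<kappa> = \<kappa>\<^sub>0 i" "\<kappa>' = \<kappa>\<^sub>1 i"
      using mem by auto
    have "Suc 0 \<le> i" "i < Suc N" using i(1) by auto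
    then obtain j where "i = Suc j" "j < N" by (metis Suc_le_D Suc_less_eq)
    note j = i(2,3)[unfolded this(1)] this(2)
    then show ?thesis using inj0 inj1 by simp
  qed
  have down: "x' = forward_automorphism N \<kappa>\<^sub>0 \<kappa>\<^sub>1 x \<and> (square_rule K x d y' \<longrightarrow> c = d)"
    if "square_rule K x c x'" for x c x' d y'
    using square_rule_kappa_P_list_down[OF _ that] inj unfolding forward_automorphism_fold by blast
  have "topologically_conjugate (seq_topology \<Lambda>) \<phi>
      (seq_topology (presented_subshift (L.H k))) shift_map"
    unfolding \<Lambda>[symmetric]
  proof (rule L.topologically_conjugate_higher_block[OF assms(12)])
    show "expansive_constant (presented_subshift (lambda_graph (M_pow N M I) (I_pow N I))) \<phi> (1 / real k)"
      unfolding \<Lambda> by (rule assms(13))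
    show "\<phi> x = x'" if "x \<in> presented_subshift (lambda_graph (M_pow N M I) (I_pow N I))"
      "square_rule (kappa_P N \<kappa>\<^sub>0 \<kappa>\<^sub>1) x c x'" for x c x'
      using down[OF that(2)[unfolded K]] assms(11) that(1)[unfolded \<Lambda>] by simp
    show "c = d \<and> x' = y'" if "square_rule (kappa_P N \<kappa>\<^sub>0 \<kappa>\<^sub>1) x c x'"
      "square_rule (kappa_P N \<kappa>\<^sub>0 \<kappa>\<^sub>1) x d y'" for x c x' d y'
    proof (rule conjI)
      note s = that[unfolded K]
      show "c = d" by (rule down[OF s(1), THEN conjunct2, THEN mp, OF s(2)])
      show "x' = y'" by (rule trans[OF down[OF s(1), THEN conjunct1] down[OF s(2), THEN conjunct1, symmetric]])
    qed
    show "x = y" if "square_rule (kappa_P N \<kappa>\<^sub>0 \<kappa>\<^sub>1) x c x'"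
      "square_rule (kappa_P N \<kappa>\<^sub>0 \<kappa>\<^sub>1) y d x'" for x c x' y d
      by (rule square_rule_kappa_P_list_up[OF _ that[unfolded K]]) (rule inj)
  qed
  then show ?thesis using eq unfolding T by blast
qed

end
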